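(* Let $(W,\sigma)$ be a symplectic vector space and suppose that $W=V_1\oplus\dots\oplus V_{\ell}$ is an orthogonal decomposition with respect to a $\sigma$-compatible inner product on $(W,\sigma)$. Let $t_1>n_1=\dim V_1,\dots,t_{\ell}>n_{\ell}=\dim V_{\ell}$. Let $a_1\in\mathcal{S}^{-t_1}(V_1),\dots,a_{\ell}\in\mathcal{S}^{-t_{\ell}}(V_{\ell})$ and let $g:W\to\mathbb{C}$, $$g=\mathcal{F}^{\dagger}_{V_1}(a_1)\otimes\dots\otimes\mathcal{F}^{\dagger}_{V_{\ell}}(a_{\ell}),$$ where each $\mathcal{F}^{\dagger}_{V}$ is either $\mathcal{F}_V$ or $\mathcal{F}_V^{-1}$. Let $T:W\to W$ be linear with $T+T^{\sigma}$ an isomorphism. If the $\omega_{\sigma,T}$-representation $(\mathcal{H},\mathcal{W}_{\sigma,T},\omega_{\sigma,T})$ is irreducible, then $\mathrm{Op}_{\sigma,T}(g)\in\mathcal{B}_1(\mathcal{H})$.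
   Context: A symplectic vector space $(W,\sigma)$ is a finite-dimensional real vector space with a non-degenerate antisymmetric bilinear form $\sigma$. An inner product $g_0$ on $W$ is $\sigma$-compatible if there is a linear $J:W\to W$ with $J^2=-\mathrm{Id}$ such that $g_0(v,w)=\sigma(v,Jw)$ for all $v,w$ and $\sigma(Jv,Jw)=\sigma(v,w)$. $\mathcal{F}_V$ is the Fourier transform on the Euclidean space $V$ (with respect to the restricted inner product). For $m\in\mathbb{R}$ and a Euclidean space $V$, $\mathcal{S}^m(V)$ is the space of $a\in\mathcal{C}^{\infty}(V)$ such that for every multi-index $\alpha$ there is $C_\alpha>0$ with $|\partial^{\alpha}a(x)|\le C_\alpha\langle x\rangle^{m-|\alpha|}$, where $\langle x\rangle=(1+|x|^2)^{1/2}$. For linear $T:W\to W$, $T^{\sigma}$ is defined by $\sigma(T^{\sigma}\xi,\eta)=\sigma(\xi,T\eta)$. Put $\omega_{\sigma,T}(\xi,\eta)=\mathrm{e}^{\mathrm{i}\sigma(\xi,T\eta)}$. An $\omega_{\sigma,T}$-representation is a complex Hilbert space $\mathcal{H}$ with a strongly continuous map $\mathcal{W}_{\sigma,T}:W\to\mathcal{U}(\mathcal{H})$ such that $\mathcal{W}_{\sigma,T}(\xi)\mathcal{W}_{\sigma,T}(\eta)=\omega_{\sigma,T}(\xi,\eta)\mathcal{W}_{\sigma,T}(\xi+\eta)$; it is irreducible if $\mathcal{H}\neq0$ has no nontrivial closed invariant subspace. $\mathcal{S}\subset\mathcal{H}$ is the space of $\mathcal{C}^{\infty}$ vectors (those $\varphi$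 for which $\xi\mapsto\mathcal{W}_{\sigma,T}(\xi)\varphi$ is $\mathcal{C}^\infty$) with the Fréchet topology of the seminorms $\|\phi_T(\xi_1)\cdots\phi_T(\xi_k)\varphi\|_{\mathcal{H}}$, where $\mathrm{e}^{\mathrm{i}t\phi_T(\xi)}=\mathrm{e}^{\frac{\mathrm{i}}{2}t^2\sigma(\xi,T\xi)}\mathcal{W}_{\sigma,T}(t\xi)$, $\phi_T(\xi)$ self-adjoint; $\mathcal{S}^{*}$ is the space of continuous antilinear functionals on $\mathcal{S}$; $\langle\cdot,\cdot\rangle$ is the antiduality extending the scalar product. $\mathcal{S}^*(W)$ denotes the continuous antilinear functionals on the Schwartz space $\mathcal{S}(W)$; functions $a$ act by $\varphi\mapsto\int\overline{\varphi}\,a\,\mathrm{d}^{\sigma}\xi$. $\mathrm{d}^{\sigma}\xi$ is the unique Haar measure such that $(\mathcal{F}_{\sigma}a)(\xi)=\int_W\mathrm{e}^{-\mathrm{i}\sigma(\xi,\eta)}a(\eta)\,\mathrm{d}^{\sigma}\eta$ is involutive and unitary on $L^2(W)$. For $a\in\mathcal{S}^{*}(W)$, $\mathrm{Op}_{\sigma,T}(a):\mathcal{S}\to\mathcal{S}^*$ is defined by $\langle\varphi,\mathrm{Op}_{\sigma,T}(a)\psi\rangle=\big\langle\overline{\langle\varphi,\mathcal{W}_{\sigma,T}(\cdot)\psi\rangle},\mathcal{F}_{\sigma}(a)\big\rangle_{\mathcal{S}(W),\mathcal{S}^{*}(W)}$, i.e. $\mathrm{Op}_{\sigma,T}(a)=\int_W\mathcal{W}_{\sigma,T}(\xi)\mathcal{F}_{\sigma}(a)(\xi)\,\mathrm{d}^{\sigma}\xi$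 weakly. $\mathcal{B}_1(\mathcal{H})$ is the ideal of trace-class operators; $\mathrm{Op}_{\sigma,T}(g)\in\mathcal{B}_1(\mathcal{H})$ means that it extends to such an operator. *)

theory Defs
  imports "HOL-Analysis.Analysis"
begin

section \<open>Complex Hilbert spaces and trace-class operators\<close>

text \<open>The scalar product is antilinear in the first and linear in the second argument. The
  underlying real inner product (and hence norm and topology) is its real part; positive
  definiteness is inherited from \<^class>\<open>real_inner\<close>.\<close>

class complex_hilbert_space = real_inner + complete_space +
  fixes scaleC :: "complex \<Rightarrow> 'a \<Rightarrow> 'a"  (infixr "*\<^sub>C" 75)
    and cinner :: "'a \<Rightarrow> 'a \<Rightarrow> complex"
  assumes scaleC_add_right: "c *\<^sub>C (x + y) = c *\<^sub>C x + c *\<^sub>C y"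
    and scaleC_add_left: "(c + d) *\<^sub>C x = c *\<^sub>C x + d *\<^sub>C x"
    and scaleC_scaleC: "c *\<^sub>C (d *\<^sub>C x) = (c * d) *\<^sub>C x"
    and scaleC_of_real: "complex_of_real r *\<^sub>C x = r *\<^sub>R x"
    and cinner_commute: "cinner x y = cnj (cinner y x)"
    and cinner_add_right: "cinner x (y + z) = cinner x y + cinner x z"
    and cinner_scaleC_right: "cinner x (c *\<^sub>C y) = c * cinner x y"
    and Re_cinner: "Re (cinner x y) = inner x y"

definition clinear_map :: "('h::complex_hilbert_space \<Rightarrow> 'h) \<Rightarrow> bool" where
  "clinear_map A \<longleftrightarrow> linear A \<and> (\<forall>c x. A (c *\<^sub>C x) = c *\<^sub>C A x)"

definition bounded_op :: "('h::complex_hilbert_space \<Rightarrow> 'h) \<Rightarrow> bool" where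
  "bounded_op A \<longleftrightarrow> bounded_linear A \<and> clinear_map A"

definition unitary_op :: "('h::complex_hilbert_space \<Rightarrow> 'h) \<Rightarrow> bool" where
  "unitary_op A \<longleftrightarrow> clinear_map A \<and> surj A \<and> (\<forall>x y. cinner (A x) (A y) = cinner x y)"

definition closed_csubspace :: "'h::complex_hilbert_space set \<Rightarrow> bool" where
  "closed_csubspace M \<longleftrightarrow> subspace M \<and> (\<forall>c. \<forall>x\<in>M. c *\<^sub>C x \<in> M) \<and> closed M"

definition positive_op :: "('h::complex_hilbert_space \<Rightarrow> 'h) \<Rightarrow> bool" where
  "positive_op P \<longleftrightarrow> bounded_op P \<and> (\<forall>x. Im (cinner x (P x)) = 0 \<and> Re (cinner x (P x)) \<ge> 0)"

text \<open>\<open>P\<close> is the positive square root of \<open>A\<^sup>*A\<close>, i.e. \<open>P = |A|\<close>: since \<open>P\<close> is self-adjoint,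
  the last clause says \<open>P\<^sup>2 = A\<^sup>*A\<close>.\<close>

definition is_abs_op :: "('h::complex_hilbert_space \<Rightarrow> 'h) \<Rightarrow> ('h \<Rightarrow> 'h) \<Rightarrow> bool" where
  "is_abs_op A P \<longleftrightarrow> positive_op P \<and> (\<forall>x y. cinner (P x) (P y) = cinner (A x) (A y))"

definition hilbert_basis :: "'h::complex_hilbert_space set \<Rightarrow> bool" where
  "hilbert_basis E \<longleftrightarrow>
     (\<forall>d\<in>E. \<forall>e\<in>E. cinner d e = (if d = e then 1 else 0)) \<and>
     (\<forall>x. (\<forall>e\<in>E. cinner e x = 0) \<longrightarrow> x = 0)"

text \<open>Finiteness of the trace of \<open>|A|\<close>; the sum does not depend on the orthonormal basis.\<close>

definition trace_class :: "('h::complex_hilbert_space \<Rightarrow> 'h) \<Rightarrow> bool" where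
  "trace_class A \<longleftrightarrow> bounded_op A \<and>
     (\<exists>P E. is_abs_op A P \<and> hilbert_basis E \<and> (\<lambda>e. Re (cinner e (P e))) summable_on E)"


section \<open>Smooth functions on a subspace\<close>

definition dir_deriv :: "'w::real_normed_vector \<Rightarrow> ('w \<Rightarrow> 'b::real_normed_vector) \<Rightarrow> 'w \<Rightarrow> 'b" where
  "dir_deriv v f x = vector_derivative (\<lambda>s. f (x + s *\<^sub>R v)) (at 0)"

text \<open>Lists of direction vectors play the role of multi-indices, with \<open>|\<alpha>|\<close> the length of the
  list. This is coordinate free; if the directions range over a basis one gets the usual partial
  derivatives, and all others are linear combinations of these.\<close>

primrec iter_deriv ::
  "'w::real_normed_vector list \<Rightarrow> ('w \<Rightarrow> 'b::real_normed_vector) \<Rightarrow> 'w \<Rightarrow> 'b" where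
  "iter_deriv [] f = f"
| "iter_deriv (v # vs) f = dir_deriv v (iter_deriv vs f)"

text \<open>A function on a linear subspace \<open>V\<close> is represented by a function on the ambient space of
  which only the values on \<open>V\<close> matter. It is smooth if all iterated directional derivatives along
  \<open>V\<close> exist and are continuous on \<open>V\<close>.\<close>

definition smooth_on_subspace ::
  "'w::real_normed_vector set \<Rightarrow> ('w \<Rightarrow> 'b::real_normed_vector) \<Rightarrow> bool" where
  "smooth_on_subspace V f \<longleftrightarrow> (\<forall>vs. set vs \<subseteq> V \<longrightarrow>
     continuous_on V (iter_deriv vs f) \<and>
     (\<forall>v\<in>V. \<forall>x\<in>V. (\<lambda>s. iter_deriv vs f (x + s *\<^sub>R v)) differentiable (at 0)))"

definition schwartz :: "('w::euclidean_space \<Rightarrow> complex) set" where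
  "schwartz = {f. smooth_on_subspace UNIV f \<and>
     (\<forall>vs k. \<exists>C. \<forall>x. (1 + norm x) ^ k * norm (iter_deriv vs f x) \<le> C)}"


section \<open>Subspaces with an inner product\<close>

definition inner_product :: "('w::real_vector \<Rightarrow> 'w \<Rightarrow> real) \<Rightarrow> bool" where
  "inner_product g \<longleftrightarrow> bilinear g \<and> (\<forall>x y. g x y = g y x) \<and> (\<forall>x. x \<noteq> 0 \<longrightarrow> g x x > 0)"

text \<open>Mutual orthogonality makes the decomposition in the last clause unique.\<close>

definition orthogonal_decomposition ::
  "('w::real_vector \<Rightarrow> 'w \<Rightarrow> real) \<Rightarrow> nat \<Rightarrow> (nat \<Rightarrow> 'w set) \<Rightarrow> bool" where
  "orthogonal_decomposition g l V \<longleftrightarrow>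
     (\<forall>i\<in>{1..l}. subspace (V i)) \<and>
     (\<forall>i\<in>{1..l}. \<forall>j\<in>{1..l}. i \<noteq> j \<longrightarrow> (\<forall>x\<in>V i. \<forall>y\<in>V j. g x y = 0)) \<and>
     (\<forall>x. \<exists>y. (\<forall>i\<in>{1..l}. y i \<in> V i) \<and> x = (\<Sum>i=1..l. y i))"

definition symbol_class ::
  "('w::euclidean_space \<Rightarrow> 'w \<Rightarrow> real) \<Rightarrow> 'w set \<Rightarrow> real \<Rightarrow> ('w \<Rightarrow> complex) set" where
  "symbol_class g V m = {a. smooth_on_subspace V a \<and>
     (\<forall>vs. set vs \<subseteq> V \<longrightarrow> (\<exists>C>0. \<forall>x\<in>V.
        norm (iter_deriv vs a x) \<le> C * sqrt (1 + g x x) powr (m - real (length vs))))}"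

definition orthonormal_basis ::
  "('w::real_vector \<Rightarrow> 'w \<Rightarrow> real) \<Rightarrow> 'w set \<Rightarrow> 'w set \<Rightarrow> bool" where
  "orthonormal_basis g V B \<longleftrightarrow> B \<subseteq> V \<and> span B = V \<and>
     (\<forall>b\<in>B. \<forall>c\<in>B. g b c = (if b = c then 1 else 0))"

text \<open>Lebesgue integral over the Euclidean space \<open>(V, g)\<close>, in the coordinates of an orthonormal
  basis (the value does not depend on the chosen basis). The integrand is evaluated on \<open>V\<close> only.\<close>

definition euclid_integral ::
  "('w::euclidean_space \<Rightarrow> 'w \<Rightarrow> real) \<Rightarrow> 'w set \<Rightarrow> ('w \<Rightarrow> complex) \<Rightarrow> complex" where
  "euclid_integral g V f = (let B = (SOME B. orthonormal_basis g V B) in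
     \<integral>x. f (\<Sum>b\<in>B. x b *\<^sub>R b) \<partial>(\<Pi>\<^sub>M b\<in>B. lborel))"

definition fourier ::
  "('w::euclidean_space \<Rightarrow> 'w \<Rightarrow> real) \<Rightarrow> 'w set \<Rightarrow> ('w \<Rightarrow> complex) \<Rightarrow> 'w \<Rightarrow> complex" where
  "fourier g V a \<xi> = euclid_integral g V (\<lambda>x. cis (- g x \<xi>) * a x)"

definition inv_fourier ::
  "('w::euclidean_space \<Rightarrow> 'w \<Rightarrow> real) \<Rightarrow> 'w set \<Rightarrow> ('w \<Rightarrow> complex) \<Rightarrow> 'w \<Rightarrow> complex" where
  "inv_fourier g V a \<xi> =
     complex_of_real (1 / (2 * pi) ^ dim V) * euclid_integral g V (\<lambda>x. cis (g x \<xi>) * a x)"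


section \<open>Symplectic vector spaces\<close>

definition symplectic_form :: "('w::real_vector \<Rightarrow> 'w \<Rightarrow> real) \<Rightarrow> bool" where
  "symplectic_form \<sigma> \<longleftrightarrow> bilinear \<sigma> \<and> (\<forall>x y. \<sigma> x y = - \<sigma> y x) \<and>
     (\<forall>x. (\<forall>y. \<sigma> x y = 0) \<longrightarrow> x = 0)"

definition compatible_inner_product ::
  "('w::real_vector \<Rightarrow> 'w \<Rightarrow> real) \<Rightarrow> ('w \<Rightarrow> 'w \<Rightarrow> real) \<Rightarrow> bool" where
  "compatible_inner_product \<sigma> g \<longleftrightarrow> inner_product g \<and>
     (\<exists>J. linear J \<and> (\<forall>v. J (J v) = - v) \<and> (\<forall>v w. g v w = \<sigma> v (J w)) \<and>
          (\<forall>v w. \<sigma> (J v) (J w) = \<sigma> v w))"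

definition symplectic_adjoint ::
  "('w::real_vector \<Rightarrow> 'w \<Rightarrow> real) \<Rightarrow> ('w \<Rightarrow> 'w) \<Rightarrow> 'w \<Rightarrow> 'w" where
  "symplectic_adjoint \<sigma> T = (THE S. \<forall>\<xi> \<eta>. \<sigma> (S \<xi>) \<eta> = \<sigma> \<xi> (T \<eta>))"

definition haar_measure :: "'w::euclidean_space measure \<Rightarrow> bool" where
  "haar_measure M \<longleftrightarrow> sets M = sets borel \<and> (\<forall>x. distr M borel ((+) x) = M) \<and>
     (\<forall>K. compact K \<longrightarrow> emeasure M K < \<infinity>) \<and> emeasure M UNIV \<noteq> 0"

definition fourier_wrt ::
  "'w::euclidean_space measure \<Rightarrow> ('w \<Rightarrow> 'w \<Rightarrow> real) \<Rightarrow> ('w \<Rightarrow> complex) \<Rightarrow> 'w \<Rightarrow> complex" where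
  "fourier_wrt M \<sigma> a \<xi> = (\<integral>\<eta>. cis (- \<sigma> \<xi> \<eta>) * a \<eta> \<partial>M)"

text \<open>The measure \<open>d\<^sup>\<sigma>\<xi>\<close>. That the symplectic Fourier transform is involutive and unitary on
  \<open>L\<^sup>2(W)\<close> is expressed on the dense subspace of Schwartz functions, from which the transform
  extends to \<open>L\<^sup>2(W)\<close> by continuity.\<close>

definition symplectic_measure :: "('w::euclidean_space \<Rightarrow> 'w \<Rightarrow> real) \<Rightarrow> 'w measure" where
  "symplectic_measure \<sigma> = (THE M. haar_measure M \<and>
     (\<forall>a\<in>schwartz. fourier_wrt M \<sigma> (fourier_wrt M \<sigma> a) = a) \<and>
     (\<forall>a\<in>schwartz. \<forall>b\<in>schwartz.
        (\<integral>\<xi>. cnj (fourier_wrt M \<sigma> a \<xi>) * fourier_wrt M \<sigma> b \<xi> \<partial>M) =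
        (\<integral>\<xi>. cnj (a \<xi>) * b \<xi> \<partial>M)))"

definition symplectic_fourier ::
  "('w::euclidean_space \<Rightarrow> 'w \<Rightarrow> real) \<Rightarrow> ('w \<Rightarrow> complex) \<Rightarrow> 'w \<Rightarrow> complex" where
  "symplectic_fourier \<sigma> = fourier_wrt (symplectic_measure \<sigma>) \<sigma>"

text \<open>Elements of \<open>S\<^sup>*(W)\<close> are antilinear functionals \<open>u\<close> of Schwartz functions, \<open>u \<phi>\<close> standing
  for \<open>\<langle>\<phi>, u\<rangle>\<close>. Unitarity and involutivity give \<open>\<langle>\<phi>, F u\<rangle> = \<langle>F \<phi>, u\<rangle>\<close> for functions \<open>u\<close>, and this
  formula extends the symplectic Fourier transform \<open>F\<close> to \<open>S\<^sup>*(W)\<close>.\<close>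

definition functional_of ::
  "('w::euclidean_space \<Rightarrow> 'w \<Rightarrow> real) \<Rightarrow> ('w \<Rightarrow> complex) \<Rightarrow> ('w \<Rightarrow> complex) \<Rightarrow> complex" where
  "functional_of \<sigma> a \<phi> = (\<integral>\<xi>. cnj (\<phi> \<xi>) * a \<xi> \<partial>symplectic_measure \<sigma>)"

definition symplectic_fourier_dist ::
  "('w::euclidean_space \<Rightarrow> 'w \<Rightarrow> real) \<Rightarrow>
   (('w \<Rightarrow> complex) \<Rightarrow> complex) \<Rightarrow> ('w \<Rightarrow> complex) \<Rightarrow> complex" where
  "symplectic_fourier_dist \<sigma> u \<phi> = u (symplectic_fourier \<sigma> \<phi>)"


section \<open>Representations and quantization\<close>

definition omega ::
  "('w::real_vector \<Rightarrow> 'w \<Rightarrow> real) \<Rightarrow> ('w \<Rightarrow> 'w) \<Rightarrow> 'w \<Rightarrow> 'w \<Rightarrow> complex" where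
  "omega \<sigma> T \<xi> \<eta> = cis (\<sigma> \<xi> (T \<eta>))"

definition omega_representation ::
  "('w::euclidean_space \<Rightarrow> 'w \<Rightarrow> real) \<Rightarrow> ('w \<Rightarrow> 'w) \<Rightarrow>
   ('w \<Rightarrow> 'h::complex_hilbert_space \<Rightarrow> 'h) \<Rightarrow> bool" where
  "omega_representation \<sigma> T W \<longleftrightarrow>
     (\<forall>\<xi>. unitary_op (W \<xi>)) \<and>
     (\<forall>\<phi>. continuous_on UNIV (\<lambda>\<xi>. W \<xi> \<phi>)) \<and>
     (\<forall>\<xi> \<eta> \<phi>. W \<xi> (W \<eta> \<phi>) = omega \<sigma> T \<xi> \<eta> *\<^sub>C W (\<xi> + \<eta>) \<phi>)"

definition irreducible_rep :: "('w \<Rightarrow> 'h::complex_hilbert_space \<Rightarrow> 'h) \<Rightarrow> bool" where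
  "irreducible_rep W \<longleftrightarrow> (UNIV :: 'h set) \<noteq> {0} \<and>
     (\<forall>M. closed_csubspace M \<and> (\<forall>\<xi>. W \<xi> ` M \<subseteq> M) \<longrightarrow> M = {0} \<or> M = UNIV)"

definition smooth_vectors ::
  "('w::euclidean_space \<Rightarrow> 'h::complex_hilbert_space \<Rightarrow> 'h) \<Rightarrow> 'h set" where
  "smooth_vectors W = {\<phi>. smooth_on_subspace UNIV (\<lambda>\<xi>. W \<xi> \<phi>)}"

text \<open>\<open>Op \<sigma> W u \<psi> \<phi>\<close> is \<open>\<langle>\<phi>, Op(u) \<psi>\<rangle>\<close> for smooth vectors \<open>\<phi>\<close>, \<open>\<psi>\<close>: the value of the antilinear
  functional \<open>Op(u) \<psi>\<close> at \<open>\<phi>\<close>. Formally it is the integral of \<open>\<langle>\<phi>, W(\<xi>) \<psi>\<rangle> (F u)(\<xi>)\<close>; the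
  conjugate compensates for the antilinearity of \<open>F u\<close>.\<close>

definition Op ::
  "('w::euclidean_space \<Rightarrow> 'w \<Rightarrow> real) \<Rightarrow> ('w \<Rightarrow> 'h::complex_hilbert_space \<Rightarrow> 'h) \<Rightarrow>
   (('w \<Rightarrow> complex) \<Rightarrow> complex) \<Rightarrow> 'h \<Rightarrow> 'h \<Rightarrow> complex" where
  "Op \<sigma> W u \<psi> \<phi> = symplectic_fourier_dist \<sigma> u (\<lambda>\<xi>. cnj (cinner \<phi> (W \<xi> \<psi>)))"

text \<open>A map \<open>L\<close> from the smooth vectors to their antidual extends to a trace-class operator; the
  Hilbert space is embedded in the antidual by \<open>h \<mapsto> (\<phi> \<mapsto> \<langle>\<phi>, h\<rangle>)\<close>.\<close>

definition extends_to_trace_class ::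
  "('w::euclidean_space \<Rightarrow> 'h::complex_hilbert_space \<Rightarrow> 'h) \<Rightarrow> ('h \<Rightarrow> 'h \<Rightarrow> complex) \<Rightarrow> bool" where
  "extends_to_trace_class W L \<longleftrightarrow>
     (\<exists>A. trace_class A \<and>
        (\<forall>\<psi>\<in>smooth_vectors W. \<forall>\<phi>\<in>smooth_vectors W. L \<psi> \<phi> = cinner \<phi> (A \<psi>)))"

end

theory Submission
  imports Defs "HOL-Probability.Characteristic_Functions"
begin

text \<open>
  Up to a constant, the operator is \<open>\<integral> b(\<xi>) W(\<xi>) d\<xi>\<close>, where \<open>b\<close> is the product of the symbols \<open>a\<^sub>i\<close>
  composed with linear maps, and every derivative of \<open>b\<close> is dominated by one integrable weight.
  In symplectic coordinates, irreducibility makes the Gaussian operator \<open>\<integral> exp(-|\<xi>|\<^sup>2/4) U(\<xi>) d\<xi>\<close> a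
  multiple of a rank-one projection (the argument of Stone and von Neumann). One writes \<open>b\<close> as an
  integral over \<open>p\<close> of the localisations \<open>b(\<xi>) exp(-|\<xi> - p|\<^sup>2/2)\<close>, removes the translation by
  \<open>W(\<xi> + p) = c W(\<alpha>) W(\<xi>) W(p - \<alpha>)\<close> with \<open>|c| = 1\<close>, and applies Fourier inversion to what is left
  of the symbol besides the Gaussian. This expresses the operator as an absolutely convergent
  integral of rank-one operators.
  Such an operator \<open>A\<close> is of trace class because the sums \<open>\<Sum> \<langle>y\<^sub>e, A e\<rangle>\<close> over orthonormal \<open>e\<close> and Bessel
  families \<open>y\<^sub>e\<close> are bounded; for a contraction, \<open>|A| = 1 - X\<close> with \<open>X\<close> the limit of the iteration
  \<open>X\<^sub>n\<^sub>+\<^sub>1 = (1 - A\<^sup>*A + X\<^sub>n\<^sup>2)/2\<close>.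
\<close>

section \<open>Haar measures and linear substitutions\<close>

text \<open>Integrability of \<open>b\<close> alone gives only a bounded operator; the trace
  estimate also needs derivatives. In a tensor product of symbols, differentiating along one factor
  improves the decay in that factor alone, so one weight serves for all derivatives. It is
  integrable because \<open>t i > dim (V i)\<close> in every block. Near a point p, derivatives of
  order DIM + 1 make the Fourier transform of the localised symbol integrable. Its L1 norm is
  bounded by a convolution of the weight with an integrable function, which is what makes the
  integral over p converge. The localising Gaussian is the square of exp(-|x|^2/4): one factor
  produces the rank-one operator, the other keeps the remaining symbol in the Schwartz class. The
  isomorphism T + T^sigma enters as nondegeneracy of the commutation form of the representation. The
  complex structure J converts the Euclidean kernels into the symplectic one, and a reflection
  equalises the signs of the transforms. Since \<open>trace_class\<close> asks for the operator |A|
  itself, the absolute value has to be constructed before any trace can be estimated.\<close>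

lemma haar_nn_integral_translate:
  assumes "haar_measure M" "f \<in> borel_measurable borel"
  shows "(\<integral>\<^sup>+x. f (x + a) \<partial>M) = (\<integral>\<^sup>+x. f x \<partial>M)"
proof -
  have [measurable_cong]: "sets M = sets borel" and inv: "distr M borel ((+) a) = M"
    using assms(1) by (auto simp: haar_measure_def)
  note [measurable] = assms(2)
  have "(\<integral>\<^sup>+x. f x \<partial>M) = (\<integral>\<^sup>+x. f x \<partial>distr M borel ((+) a))" by (simp add: inv)
  also have "\<dots> = (\<integral>\<^sup>+x. f (a + x) \<partial>M)" by (subst nn_integral_distr) measurable
  finally show ?thesis by (simp add: add.commute)
qed

lemma haar_measure_lborel: "haar_measure (lborel :: 'a::euclidean_space measure)"
  by (auto simp: haar_measure_def lborel_distr_plus less_top[symmetric]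
      dest!: compact_imp_bounded emeasure_bounded_finite)

text \<open>Both sides equal the integral of 1_A(x + y) 1_B(y) over \<open>M\<close> times Lebesgue
  measure: integrate over x first and use the invariance of \<open>M\<close>, or shift y by x first
  and use the invariance of \<open>lborel\<close>. This is the classical uniqueness argument for
  Haar measure.\<close>

lemma haar_measure_swap:
  fixes M :: "'a::euclidean_space measure"
  assumes M: "haar_measure M" and [measurable]: "A \<in> sets borel" "B \<in> sets borel"
  shows "emeasure M A * emeasure lborel B = emeasure lborel A * emeasure M (uminus -` B)"
proof -
  have [measurable_cong]: "sets M = sets borel" and inv: "\<And>x. distr M borel ((+) x) = M"
    and fin: "\<And>K. compact K \<Longrightarrow> emeasure M K < \<infinity>"
    using M by (auto simp: haar_measure_def)
  have spM: "space M = UNIV" using \<open>sets M = sets borel\<close> by (metis sets_eq_imp_space_eq space_borel)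
  interpret M: sigma_finite_measure M
  proof
    have "(\<Union>n. cball 0 (real n)) = (UNIV :: 'a set)"
      by (auto simp: real_arch_simple)
    then show "\<exists>A. countable A \<and> A \<subseteq> sets M \<and> \<Union>A = space M \<and> (\<forall>a\<in>A. emeasure M a \<noteq> \<infinity>)"
      using fin[OF compact_cball]
      by (intro exI[of _ "range (\<lambda>n. cball 0 (real n))"])
        (auto simp: spM \<open>sets M = sets borel\<close> less_top)
  qed
  interpret P: pair_sigma_finite M lborel ..
  have "(\<integral>\<^sup>+y. (\<integral>\<^sup>+x. indicator A (x + y) * indicator B y \<partial>M) \<partial>lborel)
      = (\<integral>\<^sup>+y. emeasure M A * indicator B y \<partial>lborel)"
  proof (rule nn_integral_cong)
    fix y :: 'a
    have "(\<integral>\<^sup>+x. indicator A (x + y) * indicator B y \<partial>M)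
        = (\<integral>\<^sup>+x. indicator A (x + y) \<partial>M) * indicator B y"
      by (subst nn_integral_multc) auto
    then show "(\<integral>\<^sup>+x. indicator A (x + y) * indicator B y \<partial>M) = emeasure M A * indicator B y"
      by (simp add: haar_nn_integral_translate[OF M, of "indicator A"])
  qed
  also have "\<dots> = emeasure M A * emeasure lborel B"
    by (simp add: nn_integral_cmult)
  finally have 1: "emeasure M A * emeasure lborel B =
      (\<integral>\<^sup>+y. (\<integral>\<^sup>+x. indicator A (x + y) * indicator B y \<partial>M) \<partial>lborel)" ..
  also have "\<dots> = (\<integral>\<^sup>+x. (\<integral>\<^sup>+y. indicator A (x + y) * indicator B y \<partial>lborel) \<partial>M)"
    by (rule P.Fubini') measurable
  also have "\<dots> = (\<integral>\<^sup>+x. (\<integral>\<^sup>+y. indicator A y * indicator B (y - x) \<partial>lborel) \<partial>M)"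
  proof (rule nn_integral_cong)
    fix x :: 'a
    show "(\<integral>\<^sup>+y. indicator A (x + y) * indicator B y \<partial>lborel)
        = (\<integral>\<^sup>+y. indicator A y * indicator B (y - x) \<partial>lborel)"
      using haar_nn_integral_translate[OF haar_measure_lborel, of "\<lambda>y. indicator A y * indicator B (y - x)" x]
      by (simp add: add.commute)
  qed
  also have "\<dots> = (\<integral>\<^sup>+y. (\<integral>\<^sup>+x. indicator A y * indicator B (y - x) \<partial>M) \<partial>lborel)"
    by (rule P.Fubini'[symmetric]) measurable
  also have "\<dots> = (\<integral>\<^sup>+y. indicator A y * emeasure M (uminus -` B) \<partial>lborel)"
  proof (rule nn_integral_cong)
    fix y :: 'a
    have "(\<integral>\<^sup>+x. indicator B (y - x) \<partial>M) = (\<integral>\<^sup>+x. indicator (uminus -` B) (x + (-y)) \<partial>M)"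
      by (intro nn_integral_cong) (auto split: split_indicator)
    also have "\<dots> = (\<integral>\<^sup>+x. indicator (uminus -` B) x \<partial>M)"
      by (rule haar_nn_integral_translate[OF M]) measurable
    also have "\<dots> = emeasure M (uminus -` B)"
      using measurable_sets[of uminus borel borel B] \<open>sets M = sets borel\<close> by simp
    finally have "(\<integral>\<^sup>+x. indicator B (y - x) \<partial>M) = emeasure M (uminus -` B)" .
    then show "(\<integral>\<^sup>+x. indicator A y * indicator B (y - x) \<partial>M) = indicator A y * emeasure M (uminus -` B)"
      by (subst nn_integral_cmult) auto
  qed
  also have "\<dots> = emeasure lborel A * emeasure M (uminus -` B)"
    by (simp add: nn_integral_multc)
  finally show ?thesis .
qed

text \<open>In \<open>haar_measure_swap\<close> the second set is fixed as the unit ball, whose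
  Lebesgue measure r is positive and finite, so the ratio s / r does not depend on the first set.
  The result identifies the measure described by \<open>THE\<close> in
  \<open>symplectic_measure\<close> and supplies all Jacobians.\<close>

lemma haar_measure_unique:
  fixes M :: "'a::euclidean_space measure"
  assumes M: "haar_measure M"
  obtains c where "c > 0" "M = density lborel (\<lambda>_. ennreal c)"
proof -
  have setsM: "sets M = sets borel"
    and fin: "\<And>K. compact K \<Longrightarrow> emeasure M K < \<infinity>" and nz: "emeasure M UNIV \<noteq> 0"
    using M by (auto simp: haar_measure_def)
  define B :: "'a set" where "B = cball 0 1"
  have B: "B \<in> sets borel" "uminus -` B \<in> sets borel"
    using measurable_sets[of uminus borel borel B] by (auto simp: B_def)
  have "emeasure lborel B > 0" 
    using emeasure_lborel_cbox_eq content_cball_pos[of 1 "0::'a"]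
    by (metis B_def Sigma_Algebra.measure_def emeasure_eq_0_AE less_irrefl not_gr_zero enn2real_0 zero_less_one)
  moreover have "emeasure lborel B < \<infinity>" unfolding B_def using emeasure_bounded_finite[of "cball 0 1"] by simp
  ultimately obtain r where r: "r > 0" "emeasure lborel B = ennreal r"
    by (metis ennreal_cases ennreal_less_zero_iff infinity_ennreal_def not_less_iff_gr_or_eq)
  have "compact (uminus -` B)"
    by (auto simp: B_def vimage_def dist_norm cball_def intro!: compact_cball[of "0::'a" 1, unfolded cball_def dist_norm, simplified])
  then obtain s where s: "s \<ge> 0" "emeasure M (uminus -` B) = ennreal s"
    by (metis fin ennreal_cases infinity_ennreal_def not_less_iff_gr_or_eq)
  have eq: "emeasure M A = emeasure lborel A * ennreal (s / r)" if "A \<in> sets borel" for A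
  proof -
    have "emeasure M A * ennreal r = emeasure lborel A * ennreal s"
      using haar_measure_swap[OF M that B(1)] r s by simp
    then have "emeasure M A * ennreal r * ennreal (1 / r) = emeasure lborel A * ennreal s * ennreal (1 / r)"
      by simp
    then show ?thesis using r s
      by (simp add: mult.assoc ennreal_mult'[symmetric])
  qed
  have "s \<noteq> 0" using eq[of UNIV] nz by auto
  with s have "s > 0" by simp
  show ?thesis
  proof (rule that)
    show "s / r > 0" using \<open>s > 0\<close> r by simp
    show "M = density lborel (\<lambda>_. ennreal (s / r))"
      by (rule measure_eqI) (auto simp: setsM eq emeasure_density_const mult.commute)
  qed
qed

text \<open>The image measure is again translation invariant and finite on compact sets, so
  uniqueness of Haar measure yields a Jacobian without determinants. Of \<open>k\<close> only the
  positivity is ever used.\<close>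

lemma lborel_linear_image:
  fixes L :: "'a::euclidean_space \<Rightarrow> 'a"
  assumes "linear L" "bij L"
  obtains k where "k > 0" "distr lborel borel L = density lborel (\<lambda>_. ennreal k)"
proof -
  have lin: "linear (inv L)" using assms by (simp add: bij_is_inj inj_linear_imp_inv_linear)
  have cL[measurable]: "L \<in> borel_measurable borel" 
    by (intro borel_measurable_continuous_onI linear_continuous_on linear_conv_bounded_linear[THEN iffD1] assms(1))
  have "haar_measure (distr lborel borel L)"
    unfolding haar_measure_def
  proof safe
    show "distr (distr lborel borel L) borel ((+) x) = distr lborel borel L" for x
    proof -
      have "distr (distr lborel borel L) borel ((+) x) = distr lborel borel (\<lambda>y. x + L y)"
        by (subst distr_distr) (auto simp: comp_def)
      also have "(\<lambda>y. x + L y) = L \<circ> ((+) (inv L x))"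
        using assms by (auto simp: linear_add bij_is_surj surj_f_inv_f)
      also have "distr lborel borel \<dots> = distr (distr lborel borel ((+) (inv L x))) borel L"
        by (subst distr_distr) auto
      finally show ?thesis by (simp add: lborel_distr_plus)
    qed
    show "emeasure (distr lborel borel L) K < \<infinity>" if "compact K" for K
    proof -
      have "L -` K = inv L ` K" using assms by (simp add: bij_vimage_eq_inv_image)
      then have "compact (L -` K)" using that lin 
        by (simp add: compact_continuous_image linear_continuous_on linear_conv_bounded_linear[symmetric])
      then show ?thesis using that
        using emeasure_bounded_finite[OF compact_imp_bounded[OF \<open>compact (L -` K)\<close>]]
        by (subst emeasure_distr) (auto simp: borel_compact)
    qed
    show "emeasure (distr lborel borel L) UNIV = 0 \<Longrightarrow> False"
      by (subst (asm) emeasure_distr) auto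
  qed auto
  then show ?thesis using haar_measure_unique that by metis
qed

lemma lborel_linear_substitution:
  fixes L :: "'a::euclidean_space \<Rightarrow> 'a"
  assumes "linear L" "bij L"
  obtains k where "k > 0"
    "\<And>f::'a \<Rightarrow> 'b::{banach,second_countable_topology}. f \<in> borel_measurable borel \<Longrightarrow>
      (\<integral>x. f (L x) \<partial>lborel) = k *\<^sub>R (\<integral>x. f x \<partial>lborel)"
    "\<And>f::'a \<Rightarrow> 'b::{banach,second_countable_topology}. integrable lborel f \<Longrightarrow>
      integrable lborel (\<lambda>x. f (L x))"
proof -
  obtain k where k: "k > 0" "distr lborel borel L = density lborel (\<lambda>_. ennreal k)"
    using lborel_linear_image[OF assms] .
  have cL[measurable]: "L \<in> borel_measurable borel" 
    by (intro borel_measurable_continuous_onI linear_continuous_on linear_conv_bounded_linear[THEN iffD1] assms(1))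
  show ?thesis
  proof (rule that[OF k(1)])
    fix f :: "'a \<Rightarrow> 'b"
    assume [measurable]: "f \<in> borel_measurable borel"
    have "(\<integral>x. f (L x) \<partial>lborel) = (\<integral>x. f x \<partial>distr lborel borel L)"
      by (subst integral_distr) auto
    also have "\<dots> = k *\<^sub>R (\<integral>x. f x \<partial>lborel)"
      unfolding k(2) using k(1) by (subst integral_density) auto
    finally show "(\<integral>x. f (L x) \<partial>lborel) = k *\<^sub>R (\<integral>x. f x \<partial>lborel)" .
  next
    fix f :: "'a \<Rightarrow> 'b"
    assume i: "integrable lborel f"
    then have [measurable]: "f \<in> borel_measurable borel" by auto
    have "integrable (distr lborel borel L) f"
      unfolding k(2) using k(1) i by (subst integrable_density) auto
    then show "integrable lborel (\<lambda>x. f (L x))"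
      by (subst (asm) integrable_distr_eq) auto
  qed
qed

lemma integrable_linear_substitution:
  fixes f :: "'a::euclidean_space \<Rightarrow> 'b::{banach,second_countable_topology}"
    and L :: "'a \<Rightarrow> 'a"
  assumes "linear L" "bij L" "integrable lborel f"
  shows "integrable lborel (\<lambda>x. f (L x))"
  by (rule lborel_linear_substitution[OF assms(1,2)]) (use assms(3) in blast)

lemma lborel_translate:
  fixes f :: "'a::euclidean_space \<Rightarrow> 'b::{banach,second_countable_topology}"
  shows "integrable lborel (\<lambda>x. f (x + a)) \<longleftrightarrow> integrable lborel f"
    and "(\<integral>x. f (x + a) \<partial>lborel) = (\<integral>x. f x \<partial>lborel)"
proof -
  have imp: "integrable lborel (\<lambda>x. f (x + a))" if "integrable lborel f" for a and f :: "'a \<Rightarrow> 'b"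
  proof -
    have [measurable]: "f \<in> borel_measurable borel" using that by auto
    have "integrable (distr lborel borel ((+) a)) f" using that by (simp add: lborel_distr_plus)
    then show ?thesis by (subst (asm) integrable_distr_eq) (auto simp: add.commute)
  qed
  show iff: "integrable lborel (\<lambda>x. f (x + a)) \<longleftrightarrow> integrable lborel f"
    using imp[of f a] imp[of "\<lambda>x. f (x + a)" "-a"] by auto
  show "(\<integral>x. f (x + a) \<partial>lborel) = (\<integral>x. f x \<partial>lborel)"
  proof (cases "integrable lborel f")
    case True
    then have [measurable]: "f \<in> borel_measurable borel" by auto
    have "(\<integral>x. f x \<partial>lborel) = (\<integral>x. f x \<partial>distr lborel borel ((+) a))" by (simp add: lborel_distr_plus)
    also have "\<dots> = (\<integral>x. f (a + x) \<partial>lborel)" by (subst integral_distr) auto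
    finally show ?thesis by (simp add: add.commute)
  next
    case False
    then show ?thesis using iff by (simp add: not_integrable_integral_eq)
  qed
qed

lemma lborel_scale_integral:
  fixes f :: "'a::euclidean_space \<Rightarrow> 'b::{banach,second_countable_topology}"
  assumes "e > 0" and [measurable]: "f \<in> borel_measurable borel"
  shows "(\<integral>x. f x \<partial>lborel) = e ^ DIM('a) *\<^sub>R (\<integral>x. f (a + e *\<^sub>R x) \<partial>lborel)"
  using assms(1) by (subst lborel_affine[of e a])  (auto simp: integral_density integral_distr)

lemma lborel_reflect:
  fixes f :: "'a::euclidean_space \<Rightarrow> 'b::{banach,second_countable_topology}"
  assumes [measurable]: "f \<in> borel_measurable borel"
  shows "(\<integral>x. f (- x) \<partial>lborel) = (\<integral>x. f x \<partial>lborel)"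
  by (subst (2) lborel_affine[of "-1" 0])  (auto simp: integral_density integral_distr density_1)

section \<open>Integrable weights\<close>

lemma borel_measurable_cis[measurable]: "f \<in> borel_measurable M \<Longrightarrow> (\<lambda>x. cis (f x)) \<in> borel_measurable M"
  by (rule measurable_compose[of f M borel cis borel])
    (auto intro!: borel_measurable_continuous_onI continuous_intros)

lemma integrable_powr_abs:
  fixes s :: real
  assumes "s > 1"
  shows "integrable lborel (\<lambda>x::real. (1 + \<bar>x\<bar>) powr (- s))"
proof -
  define f where "f x = (1 + \<bar>x\<bar>) powr (- s)" for x :: real
  have [measurable]: "f \<in> borel_measurable borel" unfolding f_def by measurable
  have lim: "((\<lambda>x. - ((1 + x) powr (1 - s)) / (s - 1)) \<longlongrightarrow> 0) at_top"
  proof -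
    have "filterlim (\<lambda>x::real. 1 + x) at_top at_top"
      by (intro filterlim_tendsto_add_at_top[OF tendsto_const] filterlim_ident)
    then have "((\<lambda>x. (1 + x) powr (1 - s)) \<longlongrightarrow> 0) at_top"
      using assms by (intro tendsto_neg_powr) auto
    then have "((\<lambda>x. - ((1 + x) powr (1 - s)) / (s - 1)) \<longlongrightarrow> - 0 / (s - 1)) at_top"
      using assms by (intro tendsto_intros) auto
    then show ?thesis by simp
  qed
  have half: "(\<integral>\<^sup>+x. ennreal (f x) * indicator {0..} x \<partial>lborel) = 0 - (- ((1 + 0) powr (1 - s)) / (s - 1))"
  proof (rule nn_integral_FTC_atLeast[OF _ _ _ lim])
    fix x :: real assume x: "0 \<le> x"
    have "((\<lambda>x. - ((1 + x) powr (1 - s)) / (s - 1)) has_real_derivative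
        - ((1 - s) * (1 + x) powr (1 - s - 1)) / (s - 1)) (at x)"
      using x assms by (intro DERIV_cdivide DERIV_minus) (auto intro!: derivative_eq_intros)
    moreover have "- ((1 - s) * (1 + x) powr (1 - s - 1)) / (s - 1) = f x"
      using assms x by (simp add: f_def field_simps)
    ultimately show "((\<lambda>x. - ((1 + x) powr (1 - s)) / (s - 1)) has_real_derivative f x) (at x)" by simp
    show "0 \<le> f x" by (simp add: f_def)
  qed auto
  have "(\<integral>\<^sup>+x. ennreal (f x) \<partial>lborel)
      \<le> (\<integral>\<^sup>+x. ennreal (f x) * indicator {0..} x + ennreal (f (0 + (-1) * x)) * indicator {0..} (0 + (-1) * x) \<partial>lborel)"
    by (intro nn_integral_mono) (auto simp: f_def split: split_indicator)
  also have "\<dots> = (\<integral>\<^sup>+x. ennreal (f x) * indicator {0..} x \<partial>lborel)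
      + (\<integral>\<^sup>+x. ennreal (f (0 + (-1) * x)) * indicator {0..} (0 + (-1) * x) \<partial>lborel)"
    by (rule nn_integral_add) measurable
  also have "(\<integral>\<^sup>+x. ennreal (f (0 + (-1) * x)) * indicator {0..} (0 + (-1) * x) \<partial>lborel)
      = (\<integral>\<^sup>+x. ennreal (f x) * indicator {0..} x \<partial>lborel)"
    by (subst nn_integral_real_affine[where c="-1" and t=0]) auto
  also have "(\<integral>\<^sup>+x. ennreal (f x) * indicator {0..} x \<partial>lborel) + (\<integral>\<^sup>+x. ennreal (f x) * indicator {0..} x \<partial>lborel) < \<infinity>"
    unfolding half by simp
  finally show ?thesis
    by (intro integrableI_bounded) (auto simp: f_def)
qed

lemma integrable_bracket_real:
  fixes s :: real
  assumes "s > 1"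
  shows "integrable lborel (\<lambda>x::real. (1 + x\<^sup>2) powr (- s / 2))"
proof (rule Bochner_Integration.integrable_bound)
  show "integrable lborel (\<lambda>x::real. 2 powr (s / 2) * (1 + \<bar>x\<bar>) powr (- s))"
    using integrable_powr_abs[OF assms] by simp
  show "AE x in lborel. norm ((1 + x\<^sup>2) powr (- s / 2)) \<le> norm (2 powr (s / 2) * (1 + \<bar>x\<bar>) powr (- s))"
  proof (intro AE_I2)
    fix x :: real
    have "(1 + \<bar>x\<bar>)\<^sup>2 / 2 \<le> 1 + x\<^sup>2"
      using sum_squares_bound[of 1 "\<bar>x\<bar>"] by (simp add: power2_eq_square field_simps)
    then have "(1 + x\<^sup>2) powr (- s / 2) \<le> ((1 + \<bar>x\<bar>)\<^sup>2 / 2) powr (- s / 2)"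
      using assms by (intro powr_mono2') auto
    also have "\<dots> = ((1 + \<bar>x\<bar>) powr 2) powr (- s / 2) / 2 powr (- s / 2)"
      by (subst powr_divide) (auto simp: powr_numeral)
    also have "\<dots> = 2 powr (s / 2) * (1 + \<bar>x\<bar>) powr (- s)"
      by (simp only: powr_powr) (simp add: powr_minus field_simps)
    finally show "norm ((1 + x\<^sup>2) powr (- s / 2)) \<le> norm (2 powr (s / 2) * (1 + \<bar>x\<bar>) powr (- s))"
      by simp
  qed
qed auto

text \<open>For n = card B the product of the 1 + x_b^2 is at most (1 + |x|^2)^n. Its power -t/(2n)
  therefore bounds the radial weight by a product of one-dimensional weights with exponent t/n, and
  t/n > 1 by hypothesis. Product coordinates are used because \<open>euclid_integral\<close> is
  defined through them.\<close>

lemma integrable_bracket_PiM: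
  assumes "finite B" "real (card B) < t"
  shows "integrable (\<Pi>\<^sub>M b\<in>B. lborel) (\<lambda>x. (1 + (\<Sum>b\<in>B. (x b)\<^sup>2)) powr (- t / 2) :: real)"
proof (rule Bochner_Integration.integrable_bound)
  define n where "n = real (card B)"
  interpret product_sigma_finite "\<lambda>_::'a. lborel :: real measure" ..
  show "integrable (\<Pi>\<^sub>M b\<in>B. lborel) (\<lambda>x. \<Prod>b\<in>B. (1 + (x b)\<^sup>2) powr (- (t / n) / 2) :: real)"
  proof (intro product_integrable_prod assms integrable_bracket_real)
    fix b assume "b \<in> B"
    then have "card B > 0" using assms by (auto simp: card_gt_0_iff)
    then show "1 < t / n" using assms by (simp add: n_def)
  qed
  show "AE x in (\<Pi>\<^sub>M b\<in>B. lborel). norm ((1 + (\<Sum>b\<in>B. (x b)\<^sup>2)) powr (- t / 2) :: real)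
      \<le> norm (\<Prod>b\<in>B. (1 + (x b)\<^sup>2) powr (- (t / n) / 2) :: real)"
  proof (intro AE_I2)
    fix x :: "'a \<Rightarrow> real"
    show "norm ((1 + (\<Sum>b\<in>B. (x b)\<^sup>2)) powr (- t / 2) :: real)
      \<le> norm (\<Prod>b\<in>B. (1 + (x b)\<^sup>2) powr (- (t / n) / 2) :: real)"
    proof (cases "B = {}")
      case False
      then have n: "n > 0" using assms by (simp add: n_def card_gt_0_iff)
      have S0: "0 \<le> (\<Sum>b\<in>B. (x b)\<^sup>2)" by (simp add: sum_nonneg)
      have "(\<Prod>b\<in>B. 1 + (x b)\<^sup>2) \<le> (\<Prod>b\<in>B. 1 + (\<Sum>b\<in>B. (x b)\<^sup>2))"
        using assms by (intro prod_mono) (auto intro: member_le_sum)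
      also have "\<dots> = (1 + (\<Sum>b\<in>B. (x b)\<^sup>2)) powr n"
        using S0 by (simp add: n_def powr_realpow)
      finally have le: "(\<Prod>b\<in>B. 1 + (x b)\<^sup>2) \<le> (1 + (\<Sum>b\<in>B. (x b)\<^sup>2)) powr n" .
      have pos: "0 < (\<Prod>b\<in>B. 1 + (x b)\<^sup>2)" by (intro prod_pos) (auto intro: add_pos_nonneg)
      have "(1 + (\<Sum>b\<in>B. (x b)\<^sup>2)) powr (- t / 2) = ((1 + (\<Sum>b\<in>B. (x b)\<^sup>2)) powr n) powr (- (t / n) / 2)"
        using n by (simp add: powr_powr)
      also have "\<dots> \<le> (\<Prod>b\<in>B. 1 + (x b)\<^sup>2) powr (- (t / n) / 2)"
        using le pos n assms by (intro powr_mono2') (auto simp: n_def)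
      also have "\<dots> = (\<Prod>b\<in>B. (1 + (x b)\<^sup>2) powr (- (t / n) / 2))"
        by (rule prod_powr_distrib)
      finally show ?thesis by (simp add: prod_nonneg)
    qed simp
  qed
qed measurable

lemma integrable_bracket_euclidean:
  assumes "real DIM('a::euclidean_space) < t"
  shows "integrable lborel (\<lambda>x::'a. (1 + (norm x)\<^sup>2) powr (- t / 2))"
proof -
  have "integrable (distr (\<Pi>\<^sub>M b\<in>(Basis :: 'a set). lborel) borel (\<lambda>f. \<Sum>b\<in>Basis. f b *\<^sub>R b))
      (\<lambda>x::'a. (1 + (norm x)\<^sup>2) powr (- t / 2))"
  proof (subst integrable_distr_eq)
    have "(norm (\<Sum>b\<in>Basis. x b *\<^sub>R b :: 'a))\<^sup>2 = (\<Sum>b\<in>Basis. (x b)\<^sup>2)" for x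
      by (subst power2_norm_eq_inner, subst euclidean_inner) (simp add: power2_eq_square)
    then show "integrable (\<Pi>\<^sub>M b\<in>(Basis :: 'a set). lborel)
        (\<lambda>x. (1 + (norm (\<Sum>b\<in>Basis. x b *\<^sub>R b))\<^sup>2) powr (- t / 2))"
      using integrable_bracket_PiM[of Basis t] assms by simp
  qed measurable
  then show ?thesis by (simp flip: lborel_eq)
qed

lemma integrable_inverse_power_norm:
  "integrable lborel (\<lambda>x::'a::euclidean_space. 1 / (1 + norm x) ^ (DIM('a) + 1))"
proof (rule Bochner_Integration.integrable_bound)
  show "integrable lborel (\<lambda>x::'a. (1 + (norm x)\<^sup>2) powr (- real (DIM('a) + 1) / 2))"
    by (rule integrable_bracket_euclidean) simp
  show "AE x in lborel. norm (1 / (1 + norm x) ^ (DIM('a) + 1))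
      \<le> norm ((1 + (norm (x::'a))\<^sup>2) powr (- real (DIM('a) + 1) / 2))"
  proof (intro AE_I2)
    fix x :: 'a
    have "1 / (1 + norm x) ^ (DIM('a) + 1) = ((1 + norm x)\<^sup>2) powr (- real (DIM('a) + 1) / 2)"
    proof -
      have "1 / (1 + norm x) ^ (DIM('a) + 1) = (1 + norm x) powr (- real (DIM('a) + 1))"
        by (subst powr_minus, subst powr_realpow) (auto simp: add_pos_nonneg inverse_eq_divide)
      also have "\<dots> = ((1 + norm x) powr 2) powr (- real (DIM('a) + 1) / 2)"
        proof -
        have "2 * (- real (DIM('a) + 1) / 2) = - real (DIM('a) + 1)" by simp
        then show ?thesis by (simp only: powr_powr)
      qed
      finally show ?thesis by (simp add: powr_numeral)
    qed
    also have "\<dots> \<le> (1 + (norm x)\<^sup>2) powr (- real (DIM('a) + 1) / 2)"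
      by (intro powr_mono2') (auto simp: power2_eq_square algebra_simps add_pos_nonneg)
    finally show "norm (1 / (1 + norm x) ^ (DIM('a) + 1))
      \<le> norm ((1 + (norm x)\<^sup>2) powr (- real (DIM('a) + 1) / 2))" by simp
  qed
qed auto

section \<open>Fourier inversion\<close>

lemma integrable_pair_bound:
  fixes f :: "'a::euclidean_space \<Rightarrow> 'b::euclidean_space \<Rightarrow> 'c::{banach,second_countable_topology}"
  assumes u: "integrable lborel u" and v: "integrable lborel v"
    and [measurable]: "(\<lambda>(x, y). f x y) \<in> borel_measurable (lborel \<Otimes>\<^sub>M lborel)"
    and le: "\<And>x y. norm (f x y) \<le> u x * v y"
  shows "integrable (lborel \<Otimes>\<^sub>M lborel) (\<lambda>(x, y). f x y)"
proof -
  have fi: "integrable lborel (f x)" for x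
    by (rule Bochner_Integration.integrable_bound[OF integrable_mult_right[OF v, of "u x"]])
      (auto intro!: AE_I2 order_trans[OF le])
  show ?thesis
  proof (rule lborel_pair.Fubini_integrable)
  show "integrable lborel (\<lambda>x. \<integral>y. norm (case (x, y) of (x, y) \<Rightarrow> f x y) \<partial>lborel)"
  proof (rule Bochner_Integration.integrable_bound[OF integrable_mult_left[OF u, of "\<integral>y. v y \<partial>lborel"]])
    show "AE x in lborel. norm (\<integral>y. norm (case (x, y) of (x, y) \<Rightarrow> f x y) \<partial>lborel) \<le> norm (u x * (\<integral>y. v y \<partial>lborel))"
    proof (intro AE_I2)
      fix x
      have "(\<integral>y. norm (f x y) \<partial>lborel) \<le> (\<integral>y. u x * v y \<partial>lborel)"
        using fi v by (intro integral_mono) (auto intro: le)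
      then show "norm (\<integral>y. norm (case (x, y) of (x, y) \<Rightarrow> f x y) \<partial>lborel) \<le> norm (u x * (\<integral>y. v y \<partial>lborel))"
        by simp
    qed
  qed measurable
qed (use fi in auto)
qed

section \<open>Gaussian integrals and inversion by Gaussian summation\<close>

lemma gaussian_real:
  shows "integrable lborel (\<lambda>x::real. complex_of_real (exp (- x\<^sup>2 / 2)) * cis (x * t))"
    and "(\<integral>x. complex_of_real (exp (- x\<^sup>2 / 2)) * cis (x * t) \<partial>(lborel :: real measure))
      = complex_of_real (sqrt (2 * pi) * exp (- t\<^sup>2 / 2))"
proof -
  have i: "integrable lborel (\<lambda>x::real. exp (- x\<^sup>2 / 2))"
    using integrable_mult_right[OF integrable_normal_density[of 1 0], of "sqrt (2 * pi)"]
    by (simp add: normal_density_def)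
  show "integrable lborel (\<lambda>x::real. complex_of_real (exp (- x\<^sup>2 / 2)) * cis (x * t))"
    by (rule Bochner_Integration.integrable_bound[OF i]) (auto simp: norm_mult)
  have "complex_of_real (exp (- t\<^sup>2 / 2)) = (\<integral>x. cis (t * x) \<partial>std_normal_distribution)"
    using char_std_normal_distribution by (auto simp: char_def fun_eq_iff cis_conv_exp)
  also have "\<dots> = (\<integral>x. normal_density 0 1 x *\<^sub>R cis (t * x) \<partial>lborel)"
    by (rule integral_density) auto
  also have "\<dots> = (\<integral>x. complex_of_real (1 / sqrt (2 * pi)) * (complex_of_real (exp (- x\<^sup>2 / 2)) * cis (x * t)) \<partial>lborel)"
    by (rule Bochner_Integration.integral_cong) (auto simp: normal_density_def scaleR_conv_of_real mult_ac)
  also have "\<dots> = complex_of_real (1 / sqrt (2 * pi)) * (\<integral>x. complex_of_real (exp (- x\<^sup>2 / 2)) * cis (x * t) \<partial>lborel)"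
    by (rule integral_mult_right_zero)
  finally show "(\<integral>x. complex_of_real (exp (- x\<^sup>2 / 2)) * cis (x * t) \<partial>(lborel :: real measure))
      = complex_of_real (sqrt (2 * pi) * exp (- t\<^sup>2 / 2))"
    by (simp add: field_simps)
qed

lemma gaussian_euclidean:
  fixes v :: "'a::euclidean_space"
  shows "integrable lborel (\<lambda>x::'a. complex_of_real (exp (- (norm x)\<^sup>2 / 2)) * cis (x \<bullet> v))"
    and "(\<integral>x. complex_of_real (exp (- (norm x)\<^sup>2 / 2)) * cis (x \<bullet> v) \<partial>lborel)
      = complex_of_real (sqrt (2 * pi) ^ DIM('a) * exp (- (norm v)\<^sup>2 / 2))"
proof -
  interpret product_sigma_finite "\<lambda>_::'a. lborel :: real measure" ..
  define F where "F = (\<lambda>b (x::real). complex_of_real (exp (- x\<^sup>2 / 2)) * cis (x * (v \<bullet> b)))"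
  have gauss: "(\<Prod>b\<in>Basis. exp (- (x \<bullet> b)\<^sup>2 / 2)) = exp (- (norm x)\<^sup>2 / 2)" for x :: 'a
  proof -
    have "(norm x)\<^sup>2 = (\<Sum>b\<in>Basis. (x \<bullet> b)\<^sup>2)"
      by (subst power2_norm_eq_inner, subst euclidean_inner) (simp add: power2_eq_square)
    then have "- (norm x)\<^sup>2 / 2 = (\<Sum>b\<in>Basis. - (x \<bullet> b)\<^sup>2 / 2)"
      by (simp only: sum_divide_distrib[symmetric] sum_negf)
    then show ?thesis by (simp only: exp_sum finite_Basis)
  qed
  have cissum: "cis (\<Sum>b\<in>B. f b) = (\<Prod>b\<in>B. cis (f b))" if "finite B" for f and B :: "'a set"
    using that by induction (simp_all flip: cis_mult)
  have prodF: "complex_of_real (exp (- (norm x)\<^sup>2 / 2)) * cis (x \<bullet> v) = (\<Prod>b\<in>Basis. F b (x \<bullet> b))" for x :: 'a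
  proof -
    have "cis (x \<bullet> v) = (\<Prod>b\<in>Basis. cis ((x \<bullet> b) * (v \<bullet> b)))"
      by (subst euclidean_inner) (rule cissum, simp)
    then show ?thesis by (simp only: F_def prod.distrib gauss of_real_prod[symmetric])
  qed
  have coord: "(\<Prod>b\<in>Basis. F b ((\<Sum>b\<in>Basis. x b *\<^sub>R b) \<bullet> b)) = (\<Prod>b\<in>Basis. F b (x b))" for x
    by (intro prod.cong) auto
  have intF: "integrable lborel (F b)" for b
    unfolding F_def by (rule gaussian_real)
  have [measurable]: "F b \<in> borel_measurable borel" for b
    unfolding F_def by measurable
  have F_eq: "(\<lambda>x::'a. complex_of_real (exp (- (norm x)\<^sup>2 / 2)) * cis (x \<bullet> v))
      = (\<lambda>x. \<Prod>b\<in>Basis. F b (x \<bullet> b))"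
    by (rule ext) (rule prodF)
  have "integrable (distr (\<Pi>\<^sub>M b\<in>(Basis :: 'a set). lborel) borel (\<lambda>f. \<Sum>b\<in>Basis. f b *\<^sub>R b))
      (\<lambda>x::'a. \<Prod>b\<in>Basis. F b (x \<bullet> b))"
    by (subst integrable_distr_eq) (simp_all only: coord product_integrable_prod[OF finite_Basis intF], measurable)
  then show "integrable lborel (\<lambda>x::'a. complex_of_real (exp (- (norm x)\<^sup>2 / 2)) * cis (x \<bullet> v))"
    by (simp only: F_eq lborel_eq[symmetric])
  have "(\<integral>x. complex_of_real (exp (- (norm x)\<^sup>2 / 2)) * cis (x \<bullet> v) \<partial>lborel)
      = (\<integral>x. (\<Prod>b\<in>Basis. F b (x b)) \<partial>(\<Pi>\<^sub>M b\<in>(Basis :: 'a set). lborel))"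
    unfolding F_eq by (subst lborel_eq, subst integral_distr) (simp_all only: coord, measurable)
  also have "\<dots> = (\<Prod>b\<in>Basis. \<integral>x. F b x \<partial>lborel)"
    by (rule product_integral_prod) (auto intro: intF)
  also have "\<dots> = (\<Prod>b\<in>(Basis::'a set). complex_of_real (sqrt (2 * pi) * exp (- (v \<bullet> b)\<^sup>2 / 2)))"
    by (simp only: F_def gaussian_real(2))
  also have "\<dots> = complex_of_real (sqrt (2 * pi) ^ DIM('a) * exp (- (norm v)\<^sup>2 / 2))"
    by (simp only: of_real_prod[symmetric] prod.distrib gauss prod_constant)
  finally show "(\<integral>x. complex_of_real (exp (- (norm x)\<^sup>2 / 2)) * cis (x \<bullet> v) \<partial>lborel)
      = complex_of_real (sqrt (2 * pi) ^ DIM('a) * exp (- (norm v)\<^sup>2 / 2))" .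
qed

lemma integrable_gaussian:
  assumes "c > 0"
  shows "integrable lborel (\<lambda>x::'a::euclidean_space. exp (- c * (norm x)\<^sup>2))"
proof -
  have i: "integrable lborel (\<lambda>x::'a. exp (- (norm x)\<^sup>2 / 2))"
    using integrable_norm[OF gaussian_euclidean(1)[of 0]] by (simp add: norm_mult)
  define e where "e = sqrt (2 * c)"
  have e: "e > 0" "e\<^sup>2 = 2 * c" using assms by (auto simp: e_def)
  have "linear (\<lambda>x::'a. e *\<^sub>R x)" by (simp add: linear_iff algebra_simps)
  moreover have "bij (\<lambda>x::'a. e *\<^sub>R x)"
    using e by (intro o_bij[of "\<lambda>x. (1/e) *\<^sub>R x"]) (auto simp: fun_eq_iff)
  ultimately have "integrable lborel (\<lambda>x::'a. exp (- (norm (e *\<^sub>R x))\<^sup>2 / 2))"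
    using i by (rule integrable_linear_substitution)
  then show ?thesis using e by (simp add: power_mult_distrib)
qed

definition ft :: "('a::euclidean_space \<Rightarrow> complex) \<Rightarrow> 'a \<Rightarrow> complex" where
  "ft f q = (\<integral>x. cis (- (q \<bullet> x)) * f x \<partial>lborel)"

text \<open>The damped integrals \<open>I n\<close> tend to the left side by dominated convergence.
  After Fubini they are averages of f against a Gaussian of width \<open>e n\<close> centred at x,
  which tend to a multiple of f x by continuity and boundedness of f.\<close>

lemma fourier_inversion:
  fixes f :: "'a::euclidean_space \<Rightarrow> complex"
  assumes cont: "continuous_on UNIV f" and bdd: "\<And>x. norm (f x) \<le> B"
    and int: "integrable lborel f" and inth: "integrable lborel (ft f)"
  shows "(\<integral>q. cis (q \<bullet> x) * ft f q \<partial>lborel) = complex_of_real ((2 * pi) ^ DIM('a)) * f x"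
proof (rule LIMSEQ_unique)
  define G where "G y = exp (- (norm y)\<^sup>2 / 2)" for y :: 'a
  have intG: "integrable lborel G"
    unfolding G_def using integrable_gaussian[of "1/2"] by simp
  define e where "e n = 1 / real (Suc n)" for n
  have e: "e n > 0" for n by (simp add: e_def)
  have elim: "e \<longlonglongrightarrow> 0" unfolding e_def by (rule LIMSEQ_Suc[OF lim_1_over_n])
  have [measurable]: "f \<in> borel_measurable borel" "ft f \<in> borel_measurable borel" 
    using int inth by auto
  have [measurable]: "G \<in> borel_measurable borel" unfolding G_def by measurable
  have Glim: "(\<lambda>n. G (e n *\<^sub>R q)) \<longlonglongrightarrow> 1" for q
  proof -
    have "(\<lambda>n. exp (- (norm (e n *\<^sub>R q))\<^sup>2 / 2)) \<longlonglongrightarrow> exp (- (norm (0 *\<^sub>R q))\<^sup>2 / 2)"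
      by (intro tendsto_intros elim) auto
    then show ?thesis by (simp add: G_def)
  qed
  define I where "I n = (\<integral>q. complex_of_real (G (e n *\<^sub>R q)) * (cis (q \<bullet> x) * ft f q) \<partial>lborel)" for n
  show "I \<longlonglongrightarrow> (\<integral>q. cis (q \<bullet> x) * ft f q \<partial>lborel)"
    unfolding I_def
  proof (rule integral_dominated_convergence[where w="\<lambda>q. norm (ft f q)"])
    show "AE q in lborel. (\<lambda>n. complex_of_real (G (e n *\<^sub>R q)) * (cis (q \<bullet> x) * ft f q)) \<longlonglongrightarrow> cis (q \<bullet> x) * ft f q"
    proof (intro AE_I2)
      fix q
      have "(\<lambda>n. complex_of_real (G (e n *\<^sub>R q)) * (cis (q \<bullet> x) * ft f q)) \<longlonglongrightarrow> complex_of_real 1 * (cis (q \<bullet> x) * ft f q)"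
        by (intro tendsto_intros Glim)
      then show "(\<lambda>n. complex_of_real (G (e n *\<^sub>R q)) * (cis (q \<bullet> x) * ft f q)) \<longlonglongrightarrow> cis (q \<bullet> x) * ft f q" by simp
    qed
    show "AE q in lborel. norm (complex_of_real (G (e n *\<^sub>R q)) * (cis (q \<bullet> x) * ft f q)) \<le> norm (ft f q)" for n
      by (auto simp: norm_mult G_def intro!: mult_left_le_one_le)
  qed (use inth in auto)
  \<comment> \<open>The transform of a wide Gaussian is a narrow one: rescaling by 1 /
    \<open>e n\<close> produces the approximate identity.\<close>
  have inner: "(\<integral>q. complex_of_real (G (e n *\<^sub>R q)) * cis (q \<bullet> (x - y)) \<partial>lborel)
      = complex_of_real ((1 / e n) ^ DIM('a) * sqrt (2 * pi) ^ DIM('a) * G ((1 / e n) *\<^sub>R (x - y)))" for n y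
  proof -
    have "(\<integral>q. complex_of_real (G (e n *\<^sub>R q)) * cis (q \<bullet> (x - y)) \<partial>lborel)
        = (1 / e n) ^ DIM('a) *\<^sub>R (\<integral>q. complex_of_real (G (e n *\<^sub>R (0 + (1 / e n) *\<^sub>R q))) * cis ((0 + (1 / e n) *\<^sub>R q) \<bullet> (x - y)) \<partial>lborel)"
      by (rule lborel_scale_integral) (use e in auto)
    also have "(\<integral>q. complex_of_real (G (e n *\<^sub>R (0 + (1 / e n) *\<^sub>R q))) * cis ((0 + (1 / e n) *\<^sub>R q) \<bullet> (x - y)) \<partial>lborel)
        = (\<integral>q. complex_of_real (exp (- (norm q)\<^sup>2 / 2)) * cis (q \<bullet> ((1 / e n) *\<^sub>R (x - y))) \<partial>lborel)"
      using e[of n] by (simp add: G_def)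
    also have "\<dots> = complex_of_real (sqrt (2 * pi) ^ DIM('a) * G ((1 / e n) *\<^sub>R (x - y)))"
      unfolding G_def by (rule gaussian_euclidean)
    finally show ?thesis by (simp add: scaleR_conv_of_real)
  qed
  have I_eq: "I n = complex_of_real (sqrt (2 * pi) ^ DIM('a)) * (\<integral>z. f (x + e n *\<^sub>R z) * complex_of_real (G z) \<partial>lborel)" for n
  proof -
    have eG: "integrable lborel (\<lambda>q. G (e n *\<^sub>R q))"
      unfolding G_def using integrable_gaussian[of "(e n)\<^sup>2/2", where ?'a='a] e[of n] by (simp add: power_mult_distrib)
    have "I n = (\<integral>q. (\<integral>y. (complex_of_real (G (e n *\<^sub>R q)) * cis (q \<bullet> x)) * (cis (- (q \<bullet> y)) * f y) \<partial>lborel) \<partial>lborel)"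
      unfolding I_def ft_def by (simp add: mult.assoc)
    also have "\<dots> = (\<integral>y. (\<integral>q. (complex_of_real (G (e n *\<^sub>R q)) * cis (q \<bullet> x)) * (cis (- (q \<bullet> y)) * f y) \<partial>lborel) \<partial>lborel)"
    proof (rule lborel_pair.Fubini_integral, rule integrable_pair_bound)
      show "integrable lborel (\<lambda>y. norm (f y))" "integrable lborel (\<lambda>q. G (e n *\<^sub>R q))"
        using int eG by auto
    qed (auto simp: norm_mult G_def)
    also have "\<dots> = (\<integral>y. f y * (\<integral>q. complex_of_real (G (e n *\<^sub>R q)) * cis (q \<bullet> (x - y)) \<partial>lborel) \<partial>lborel)"
    proof (rule Bochner_Integration.integral_cong[OF refl])
      fix y
      have "cis (q \<bullet> (x - y)) = cis (q \<bullet> x) * cis (- (q \<bullet> y))" for q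
        by (simp add: cis_mult inner_diff_right)
      then show "(\<integral>q. (complex_of_real (G (e n *\<^sub>R q)) * cis (q \<bullet> x)) * (cis (- (q \<bullet> y)) * f y) \<partial>lborel)
          = f y * (\<integral>q. complex_of_real (G (e n *\<^sub>R q)) * cis (q \<bullet> (x - y)) \<partial>lborel)"
        by (subst integral_mult_right_zero[symmetric]) (simp add: mult_ac)
    qed
    also have "\<dots> = complex_of_real ((1 / e n) ^ DIM('a) * sqrt (2 * pi) ^ DIM('a)) * (\<integral>y. f y * complex_of_real (G ((1 / e n) *\<^sub>R (x - y))) \<partial>lborel)"
      unfolding inner by (subst integral_mult_right_zero[symmetric]) (simp add: mult_ac)
    also have "(\<integral>y. f y * complex_of_real (G ((1 / e n) *\<^sub>R (x - y))) \<partial>lborel)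
        = e n ^ DIM('a) *\<^sub>R (\<integral>z. f (x + e n *\<^sub>R z) * complex_of_real (G ((1 / e n) *\<^sub>R (x - (x + e n *\<^sub>R z)))) \<partial>lborel)"
      by (rule lborel_scale_integral) (use e in auto)
    finally show ?thesis using e[of n]
      by (simp add: scaleR_conv_of_real G_def power_divide)
  qed
  have "(\<lambda>n. \<integral>z. f (x + e n *\<^sub>R z) * complex_of_real (G z) \<partial>lborel) \<longlonglongrightarrow> (\<integral>z. f x * complex_of_real (G z) \<partial>lborel)"
  proof (rule integral_dominated_convergence[where w="\<lambda>z. B * G z"])
    show "AE z in lborel. (\<lambda>n. f (x + e n *\<^sub>R z) * complex_of_real (G z)) \<longlonglongrightarrow> f x * complex_of_real (G z)"
    proof (intro AE_I2 tendsto_intros)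
      fix z
      have "(\<lambda>n. x + e n *\<^sub>R z) \<longlonglongrightarrow> x + 0 *\<^sub>R z" by (intro tendsto_intros elim)
      then show "(\<lambda>n. f (x + e n *\<^sub>R z)) \<longlonglongrightarrow> f x"
        using cont by (auto intro: continuous_on_tendsto_compose)
    qed
    show "AE z in lborel. norm (f (x + e n *\<^sub>R z) * complex_of_real (G z)) \<le> B * G z" for n
      using bdd by (auto simp: norm_mult G_def intro!: mult_right_mono)
  qed (use intG in auto)
  also have "(\<integral>z. f x * complex_of_real (G z) \<partial>lborel) = f x * complex_of_real (sqrt (2 * pi) ^ DIM('a))"
    using gaussian_euclidean(2)[of "0::'a"] by (simp add: G_def)
  finally have "I \<longlonglongrightarrow> complex_of_real (sqrt (2 * pi) ^ DIM('a)) * (f x * complex_of_real (sqrt (2 * pi) ^ DIM('a)))"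
    unfolding I_eq by (intro tendsto_intros)
  also have "complex_of_real (sqrt (2 * pi) ^ DIM('a)) * (f x * complex_of_real (sqrt (2 * pi) ^ DIM('a)))
      = complex_of_real ((sqrt (2 * pi) * sqrt (2 * pi)) ^ DIM('a)) * f x"
    by (simp only: power_mult_distrib of_real_mult mult_ac)
  also have "sqrt (2 * pi) * sqrt (2 * pi) = 2 * pi" by simp
  finally show "I \<longlonglongrightarrow> complex_of_real ((2 * pi) ^ DIM('a)) * f x" .
qed

section \<open>Iterated directional derivatives\<close>

lemma iter_deriv_append: "iter_deriv (vs @ ws) f = iter_deriv vs (iter_deriv ws f)"
  by (induction vs) auto

lemma dir_deriv_eq:
  assumes "((\<lambda>s. f (x + s *\<^sub>R v)) has_vector_derivative d) (at 0)"
  shows "dir_deriv v f x = d"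
  unfolding dir_deriv_def by (rule vector_derivative_at[OF assms])

text \<open>\<open>smooth_on_subspace\<close> speaks of the parameter 0 on each line only; moving
  the base point along the line reaches every parameter, as the fundamental theorem of calculus
  requires.\<close>

lemma has_vector_derivative_line_shift:
  fixes f :: "'a::real_vector \<Rightarrow> 'b::real_normed_vector"
  assumes "((\<lambda>h. f (x + s *\<^sub>R v + h *\<^sub>R v)) has_vector_derivative d) (at 0)"
  shows "((\<lambda>s. f (x + s *\<^sub>R v)) has_vector_derivative d) (at s)"
proof -
  have "((\<lambda>h. f (x + (s + h) *\<^sub>R v)) has_vector_derivative d) (at 0)"
  proof -
    have "x + (s + h) *\<^sub>R v = x + s *\<^sub>R v + h *\<^sub>R v" for h by (simp add: scaleR_add_left)
    then show ?thesis using assms by (simp add: add.assoc)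
  qed
  then have "((\<lambda>h. f (x + h *\<^sub>R v)) \<circ> (\<lambda>h. s + h) has_vector_derivative d) (at 0)"
    by (simp add: comp_def)
  then have "((\<lambda>h. f (x + h *\<^sub>R v)) \<circ> (\<lambda>h. s + h) \<circ> (\<lambda>h. h - s) has_vector_derivative 1 *\<^sub>R d) (at s)"
    by (intro vector_diff_chain_at[of "\<lambda>h. h - s" 1]) (auto intro!: derivative_eq_intros)
  then show ?thesis by (simp add: comp_def)
qed

definition smooth :: "('a::euclidean_space \<Rightarrow> 'b::real_normed_vector) \<Rightarrow> bool" where
  "smooth f \<longleftrightarrow> smooth_on_subspace UNIV f"

lemma smooth_continuous: "smooth f \<Longrightarrow> continuous_on UNIV (iter_deriv vs f)"
  by (auto simp: smooth_def smooth_on_subspace_def)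

lemma smooth_line0:
  assumes "smooth f"
  shows "((\<lambda>s. iter_deriv vs f (x + s *\<^sub>R v)) has_vector_derivative iter_deriv (v # vs) f x) (at 0)"
proof -
  have "(\<lambda>s. iter_deriv vs f (x + s *\<^sub>R v)) differentiable (at 0)"
    using assms by (simp add: smooth_def smooth_on_subspace_def)
  then show ?thesis unfolding iter_deriv.simps dir_deriv_def by (rule vector_derivative_works[THEN iffD1])
qed

lemma smooth_line:
  assumes "smooth f"
  shows "((\<lambda>s. iter_deriv vs f (x + s *\<^sub>R v)) has_vector_derivative iter_deriv (v # vs) f (x + s *\<^sub>R v)) (at s)"
  by (rule has_vector_derivative_line_shift) (rule smooth_line0[OF assms])

lemma smooth_iter_deriv: "smooth f \<Longrightarrow> smooth (iter_deriv vs f)"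
  by (simp add: smooth_def smooth_on_subspace_def flip: iter_deriv_append)

text \<open>A family indexed by lists of directions that obeys the recursion of
  \<open>iter_deriv\<close> must coincide with it, which gives smoothness and a formula for all
  derivatives at once.\<close>

lemma smoothI:
  fixes f :: "'a::euclidean_space \<Rightarrow> 'b::real_normed_vector"
  assumes D0: "\<And>x. D [] x = f x"
    and Dc: "\<And>vs. continuous_on UNIV (D vs)"
    and Dd: "\<And>vs v x. ((\<lambda>s. D vs (x + s *\<^sub>R v)) has_vector_derivative D (v # vs) x) (at 0)"
  shows "smooth f" and "iter_deriv vs f = D vs"
proof -
  show eq: "iter_deriv vs f = D vs" for vs
    by (induction vs) (auto simp: D0 fun_eq_iff intro!: dir_deriv_eq Dd)
  show "smooth f"
    unfolding smooth_def smooth_on_subspace_def eq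
    using Dc Dd by (simp add: differentiableI_vector[OF Dd])
qed

text \<open>Stability of a class of functions under differentiation replaces formulas for iterated
  derivatives: by induction each \<open>iter_deriv vs f\<close> stays in the class. Polynomials
  times Gaussians and matrix coefficients are treated in this way.\<close>

lemma closed_family_derivs:
  assumes cont: "\<And>f. f \<in> G \<Longrightarrow> continuous_on UNIV f"
    and der: "\<And>f v. f \<in> G \<Longrightarrow> \<exists>f'\<in>G. \<forall>x. ((\<lambda>s. f (x + s *\<^sub>R v)) has_vector_derivative f' x) (at 0)"
    and f: "f \<in> G"
  shows "smooth f" and "iter_deriv vs f \<in> G"
proof -
  have mem: "iter_deriv vs f \<in> G" for vs
  proof (induction vs)
    case (Cons v vs)
    from der[OF Cons] obtain f' where f': "f' \<in> G"
      "\<And>x. ((\<lambda>s. iter_deriv vs f (x + s *\<^sub>R v)) has_vector_derivative f' x) (at 0)" by blast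
    then have "iter_deriv (v # vs) f = f'"
      by (auto simp: fun_eq_iff intro!: dir_deriv_eq)
    with f' show ?case by simp
  qed (use f in simp)
  then show "iter_deriv vs f \<in> G" .
  show "smooth f"
    unfolding smooth_def smooth_on_subspace_def
    using mem cont der by (fastforce simp: differentiable_def has_vector_derivative_def)
qed

lemma iter_deriv_affine:
  fixes f :: "'a::real_normed_vector \<Rightarrow> 'b::real_normed_vector"
  assumes "linear L"
  shows "iter_deriv vs (\<lambda>x. f (L x + p)) x = iter_deriv (map L vs) f (L x + p)"
proof (induction vs arbitrary: x)
  case (Cons v vs)
  have "iter_deriv vs (\<lambda>x. f (L x + p)) (x + s *\<^sub>R v) = iter_deriv (map L vs) f (L x + p + s *\<^sub>R L v)" for s
    unfolding Cons linear_add[OF assms] linear_scale[OF assms] by (simp add: add_ac)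
  then show ?case by (simp add: dir_deriv_def)
qed simp

text \<open>By the chain rule only directions \<open>L v\<close> and points of V occur, so
  information about f on V suffices. With \<open>L\<close> a projection onto V this makes a symbol
  on V a smooth function on the whole space.\<close>

lemma smooth_affine:
  fixes f :: "'a::euclidean_space \<Rightarrow> 'b::real_normed_vector"
  assumes L: "linear (L :: 'a \<Rightarrow> 'a)" and f: "smooth_on_subspace V f"
    and V: "\<And>x. L x \<in> V" "\<And>x. L x + p \<in> V"
  shows "smooth (\<lambda>x. f (L x + p))"
  unfolding smooth_def smooth_on_subspace_def
proof safe
  fix vs :: "'a list" and v x :: 'a
  have sub: "set (map L vs) \<subseteq> V" using V by auto
  have eq: "iter_deriv vs (\<lambda>x. f (L x + p)) = (\<lambda>x. iter_deriv (map L vs) f (L x + p))"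
    by (rule ext) (rule iter_deriv_affine[OF L])
  have cL: "continuous_on UNIV (\<lambda>x. L x + p)"
    using L by (intro continuous_on_add continuous_on_const linear_continuous_on) (simp add: linear_conv_bounded_linear)
  have "continuous_on V (iter_deriv (map L vs) f)"
    using f sub unfolding smooth_on_subspace_def by blast
  from continuous_on_compose2[OF this cL] V(2) show "continuous_on UNIV (iter_deriv vs (\<lambda>x. f (L x + p)))"
    unfolding eq by auto
  have "(\<lambda>s. iter_deriv (map L vs) f (L x + p + s *\<^sub>R L v)) differentiable at 0"
    using f sub V unfolding smooth_on_subspace_def by blast
  then show "(\<lambda>s. iter_deriv vs (\<lambda>x. f (L x + p)) (x + s *\<^sub>R v)) differentiable at 0"
    unfolding eq by (simp add: linear_add[OF L] linear_scale[OF L] add_ac)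
qed

section \<open>The Leibniz rule and classes of functions with a common weight\<close>

lemma has_vector_derivative_sum_list:
  assumes "\<And>p. p \<in> set ps \<Longrightarrow> (F p has_vector_derivative F' p) net"
  shows "((\<lambda>s. \<Sum>p\<leftarrow>ps. F p s) has_vector_derivative (\<Sum>p\<leftarrow>ps. F' p)) net"
  using assms by (induction ps) (auto intro!: derivative_eq_intros)

lemma continuous_on_sum_list:
  fixes F :: "'c \<Rightarrow> 'a::topological_space \<Rightarrow> 'b::real_normed_vector"
  assumes "\<And>p. p \<in> set ps \<Longrightarrow> continuous_on S (F p)"
  shows "continuous_on S (\<lambda>s. \<Sum>p\<leftarrow>ps. F p s)"
  using assms by (induction ps) (auto intro!: continuous_intros)

text \<open>All ways of distributing a list of directions over two factors, with repetitions, so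
  that the Leibniz rule is free of binomial coefficients.\<close>

primrec splits :: "'a list \<Rightarrow> ('a list \<times> 'a list) list" where
  "splits [] = [([], [])]"
| "splits (v # vs) = map (\<lambda>p. (v # fst p, snd p)) (splits vs) @ map (\<lambda>p. (fst p, v # snd p)) (splits vs)"

lemma leibniz:
  fixes f g :: "'a::euclidean_space \<Rightarrow> complex"
  assumes f: "smooth f" and g: "smooth g"
  shows smooth_mult: "smooth (\<lambda>x. f x * g x)"
    and iter_deriv_mult: "iter_deriv vs (\<lambda>x. f x * g x)
      = (\<lambda>x. \<Sum>p\<leftarrow>splits vs. iter_deriv (fst p) f x * iter_deriv (snd p) g x)"
proof -
  define D where "D vs = (\<lambda>x. \<Sum>p\<leftarrow>splits vs. iter_deriv (fst p) f x * iter_deriv (snd p) g x)" for vs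
  have D0: "D [] x = f x * g x" for x by (simp add: D_def)
  have Dc: "continuous_on UNIV (D vs)" for vs
    unfolding D_def by (intro continuous_on_sum_list continuous_intros smooth_continuous f g)
  have Dd: "((\<lambda>s. D vs (x + s *\<^sub>R v)) has_vector_derivative D (v # vs) x) (at 0)" for vs v x
  proof -
    have "((\<lambda>s. D vs (x + s *\<^sub>R v)) has_vector_derivative
        (\<Sum>p\<leftarrow>splits vs. iter_deriv (fst p) f (x + 0 *\<^sub>R v) * iter_deriv (v # snd p) g (x + 0 *\<^sub>R v)
          + iter_deriv (v # fst p) f (x + 0 *\<^sub>R v) * iter_deriv (snd p) g (x + 0 *\<^sub>R v))) (at 0)"
      unfolding D_def
      by (intro has_vector_derivative_sum_list has_vector_derivative_mult smooth_line f g)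
    then show ?thesis
      by (simp add: D_def sum_list_addf o_def add.commute)
  qed
  show "smooth (\<lambda>x. f x * g x)" by (rule smoothI(1)[of D]) (auto intro: D0 Dc Dd)
  show "iter_deriv vs (\<lambda>x. f x * g x)
      = (\<lambda>x. \<Sum>p\<leftarrow>splits vs. iter_deriv (fst p) f x * iter_deriv (snd p) g x)"
    using smoothI(2)[of D "\<lambda>x. f x * g x" vs, OF D0 Dc Dd] by (simp add: D_def)
qed

text \<open>The estimate is pointwise: \<open>w\<close> and \<open>u\<close> are numbers belonging
  to the one point x, so it also applies when the weights are translated by a parameter.\<close>

lemma norm_iter_deriv_mult_le:
  fixes f g :: "'a::euclidean_space \<Rightarrow> complex"
  assumes f: "smooth f" and g: "smooth g"
    and bf: "\<And>vs. norm (iter_deriv vs f x) \<le> Cf vs * w"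
    and bg: "\<And>vs. norm (iter_deriv vs g x) \<le> Cg vs * u"
  shows "norm (iter_deriv vs (\<lambda>x. f x * g x) x) \<le> (\<Sum>p\<leftarrow>splits vs. Cf (fst p) * Cg (snd p)) * (w * u)"
proof -
  have "norm (\<Sum>p\<leftarrow>ps. iter_deriv (fst p) f x * iter_deriv (snd p) g x)
      \<le> (\<Sum>p\<leftarrow>ps. Cf (fst p) * Cg (snd p)) * (w * u)" for ps
  proof (induction ps)
    case (Cons p ps)
    have "norm (iter_deriv (fst p) f x * iter_deriv (snd p) g x) \<le> (Cf (fst p) * w) * (Cg (snd p) * u)"
      unfolding norm_mult by (intro mult_mono bf bg norm_ge_zero order_trans[OF norm_ge_zero bf])
    then have "norm (iter_deriv (fst p) f x * iter_deriv (snd p) g x) \<le> (Cf (fst p) * Cg (snd p)) * (w * u)"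
      by (simp add: mult_ac)
    with Cons show ?case by (auto simp: distrib_right intro: order_trans[OF norm_triangle_ineq add_mono])
  qed simp
  then show ?thesis by (simp add: iter_deriv_mult[OF f g])
qed

text \<open>Unlike in a symbol class, the weight does not improve with the order of the derivative.
  This makes the classes stable under tensor products, where a derivative gains decay in one group
  of variables only.\<close>

definition weighted :: "('a::euclidean_space \<Rightarrow> real) \<Rightarrow> ('a \<Rightarrow> complex) set" where
  "weighted w = {f. smooth f \<and> (\<forall>vs. \<exists>C. \<forall>x. norm (iter_deriv vs f x) \<le> C * w x)}"

lemma weighted_bounds:
  assumes "f \<in> weighted w"
  obtains C where "\<And>vs x. norm (iter_deriv vs f x) \<le> C vs * w x"
  using assms unfolding weighted_def by (simp add: choice_iff) blast

lemma weighted_mult: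
  assumes "f \<in> weighted w" "g \<in> weighted u"
  shows "(\<lambda>x. f x * g x) \<in> weighted (\<lambda>x. w x * u x)"
proof -
  have s: "smooth f" "smooth g" using assms by (auto simp: weighted_def)
  obtain Cf where Cf: "\<And>vs x. norm (iter_deriv vs f x) \<le> Cf vs * w x" by (rule weighted_bounds[OF assms(1)]) blast
  obtain Cg where Cg: "\<And>vs x. norm (iter_deriv vs g x) \<le> Cg vs * u x" by (rule weighted_bounds[OF assms(2)]) blast
  show ?thesis
    unfolding weighted_def using smooth_mult[OF s] norm_iter_deriv_mult_le[OF s, of _ Cf "w _" Cg "u _"] Cf Cg by blast
qed

lemma smooth_const: "smooth (\<lambda>x. c)"
  by (rule smoothI(1)[of "\<lambda>vs x. if vs = [] then c else 0"]) auto

lemma iter_deriv_const: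
  "iter_deriv vs (\<lambda>x::'a::euclidean_space. c) = (\<lambda>x. if vs = [] then c else 0)"
  using smoothI(2)[of "\<lambda>vs x::'a. if vs = [] then c else 0" "\<lambda>x. c" vs] by simp

lemma weighted_const: "(\<lambda>x. c) \<in> weighted (\<lambda>x. 1)"
  by (auto simp: weighted_def smooth_const iter_deriv_const intro!: exI[of _ "norm c"])

lemma weighted_prod:
  assumes "finite I" "\<And>i. i \<in> I \<Longrightarrow> f i \<in> weighted (w i)"
  shows "(\<lambda>x. \<Prod>i\<in>I. f i x) \<in> weighted (\<lambda>x. \<Prod>i\<in>I. w i x)"
  using assms
proof (induction)
  case empty
  show ?case by (simp add: weighted_const)
next
  case (insert i I)
  then show ?case using weighted_mult[of "f i" "w i" "\<lambda>x. \<Prod>i\<in>I. f i x"] by simp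
qed

section \<open>Schwartz functions\<close>

text \<open>Decay in the norm is reduced to decay in single coordinates, which multiplication by
  coordinates and pure derivatives \<open>replicate k b\<close> can control. Here \<open>m\<close>
  is the largest of 1 and the absolute values of the coordinates.\<close>

lemma power_norm_le:
  fixes x :: "'a::euclidean_space"
  shows "(1 + norm x) ^ k \<le> real (DIM('a) + 1) ^ k * (1 + (\<Sum>b\<in>Basis. \<bar>x \<bullet> b\<bar> ^ k))"
proof -
  define m where "m = Max (insert 1 ((\<lambda>b. \<bar>x \<bullet> b\<bar>) ` Basis))"
  have m1: "1 \<le> m" and mb: "\<And>b. b \<in> Basis \<Longrightarrow> \<bar>x \<bullet> b\<bar> \<le> m"
    unfolding m_def by (rule Max_ge; simp)+
  have "1 + norm x \<le> 1 + (\<Sum>b\<in>Basis. \<bar>x \<bullet> b\<bar>)" using norm_le_l1[of x] by simp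
  also have "\<dots> \<le> m + (\<Sum>b\<in>(Basis::'a set). m)" using m1 mb by (intro add_mono sum_mono)
  also have "\<dots> = real (DIM('a) + 1) * m" by (simp add: algebra_simps)
  finally have "(1 + norm x) ^ k \<le> (real (DIM('a) + 1) * m) ^ k" by (intro power_mono) auto
  moreover have "m ^ k \<le> 1 + (\<Sum>b\<in>Basis. \<bar>x \<bullet> b\<bar> ^ k)"
  proof -
    have "m \<in> insert 1 ((\<lambda>b. \<bar>x \<bullet> b\<bar>) ` Basis)" unfolding m_def by (rule Max_in) auto
    then show ?thesis
    proof
      assume "m = 1" then show ?thesis by (simp add: sum_nonneg)
    next
      assume "m \<in> (\<lambda>b. \<bar>x \<bullet> b\<bar>) ` Basis"
      then obtain b where b: "b \<in> Basis" "m = \<bar>x \<bullet> b\<bar>" by auto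
      then have "m ^ k \<le> (\<Sum>b\<in>Basis. \<bar>x \<bullet> b\<bar> ^ k)" by (auto intro!: member_le_sum)
      then show ?thesis by simp
    qed
  qed
  ultimately show ?thesis
    by (simp add: power_mult_distrib mult_left_mono order_trans)
qed

lemma schwartz_iff_weighted:
  "f \<in> schwartz \<longleftrightarrow> smooth f \<and> (\<forall>k. f \<in> weighted (\<lambda>x. 1 / (1 + norm x) ^ k))"
proof -
  have "(1 + norm x) ^ k * a \<le> C \<longleftrightarrow> a \<le> C * (1 / (1 + norm x) ^ k)" for x :: 'a and a C k
    using zero_less_power[of "1 + norm x" k] by (simp add: field_simps add_pos_nonneg)
  then show ?thesis unfolding schwartz_def weighted_def smooth_def by auto
qed

text \<open>Iterating \<open>mult\<close> turns mere boundedness into decay of every polynomial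
  order, and \<open>der\<close> carries this decay to all derivatives. What remains to be checked
  for a concrete class are statements about one derivative and one coordinate.\<close>

lemma schwartz_closed_family:
  fixes G :: "('a::euclidean_space \<Rightarrow> complex) set"
  assumes cont: "\<And>f. f \<in> G \<Longrightarrow> continuous_on UNIV f"
    and bdd: "\<And>f. f \<in> G \<Longrightarrow> \<exists>C. \<forall>x. norm (f x) \<le> C"
    and der: "\<And>f v. f \<in> G \<Longrightarrow> \<exists>f'\<in>G. \<forall>x. ((\<lambda>s. f (x + s *\<^sub>R v)) has_vector_derivative f' x) (at 0)"
    and mult: "\<And>f b. f \<in> G \<Longrightarrow> b \<in> Basis \<Longrightarrow> (\<lambda>x. complex_of_real (x \<bullet> b) * f x) \<in> G"
  shows "G \<subseteq> schwartz"
proof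
  fix f assume f: "f \<in> G"
  have pow: "(\<lambda>x. complex_of_real (x \<bullet> b) ^ k * g x) \<in> G" if "g \<in> G" "b \<in> Basis" for g b k
    using that
  proof (induction k)
    case (Suc k)
    from mult[OF Suc.IH[OF Suc.prems] Suc.prems(2)] show ?case by (simp add: mult.assoc)
  qed simp
  have "\<exists>C. \<forall>x. (1 + norm x) ^ k * norm (g x) \<le> C" if g: "g \<in> G" for g k
  proof -
    obtain C0 where C0: "\<And>x. norm (g x) \<le> C0" using bdd[OF g] by auto
    have "\<forall>b\<in>Basis. \<exists>C. \<forall>x. norm (complex_of_real (x \<bullet> b) ^ k * g x) \<le> C"
      using bdd pow[OF g] by blast
    then obtain C where C: "\<And>b x. b \<in> Basis \<Longrightarrow> norm (complex_of_real (x \<bullet> b) ^ k * g x) \<le> C b"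
      by metis
    have "(1 + norm x) ^ k * norm (g x) \<le> real (DIM('a) + 1) ^ k * (C0 + (\<Sum>b\<in>Basis. C b))" for x
    proof -
      have "(1 + norm x) ^ k * norm (g x) \<le> real (DIM('a) + 1) ^ k * (1 + (\<Sum>b\<in>Basis. \<bar>x \<bullet> b\<bar> ^ k)) * norm (g x)"
        by (intro mult_right_mono power_norm_le) auto
      also have "\<dots> = real (DIM('a) + 1) ^ k * (norm (g x) + (\<Sum>b\<in>Basis. norm (complex_of_real (x \<bullet> b) ^ k * g x)))"
        by (simp add: norm_mult norm_power sum_distrib_left sum_distrib_right algebra_simps)
      also have "\<dots> \<le> real (DIM('a) + 1) ^ k * (C0 + (\<Sum>b\<in>Basis. C b))"
        by (intro mult_left_mono add_mono C0 sum_mono C) auto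
      finally show ?thesis .
    qed
    then show ?thesis by blast
  qed
  then show "f \<in> schwartz"
    using closed_family_derivs[OF cont der f] unfolding schwartz_def smooth_def by auto
qed

lemma schwartz_mult_bounded:
  assumes f: "f \<in> schwartz" and g: "g \<in> weighted (\<lambda>x. 1)"
  shows "(\<lambda>x. g x * f x) \<in> schwartz"
proof -
  have "smooth f" "smooth g" using assms by (auto simp: schwartz_iff_weighted weighted_def)
  then have "smooth (\<lambda>x. g x * f x)" by (intro smooth_mult)
  moreover have "(\<lambda>x. g x * f x) \<in> weighted (\<lambda>x. 1 / (1 + norm x) ^ k)" for k
    using weighted_mult[OF g, of f "\<lambda>x. 1 / (1 + norm x) ^ k"] f by (simp add: schwartz_iff_weighted)
  ultimately show ?thesis by (simp add: schwartz_iff_weighted)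
qed

lemma schwartz_iter_deriv:
  assumes f: "f \<in> schwartz"
  shows "iter_deriv vs f \<in> schwartz"
  using assms smooth_iter_deriv[of f]
  by (auto simp: schwartz_def smooth_def[symmetric] simp flip: iter_deriv_append)

lemma schwartz_smooth: "f \<in> schwartz \<Longrightarrow> smooth f"
  by (simp add: schwartz_def smooth_def)

lemma schwartz_continuous: "f \<in> schwartz \<Longrightarrow> continuous_on UNIV f"
  using smooth_continuous[of f "[]"] by (simp add: schwartz_smooth)

lemma schwartz_measurable: "f \<in> schwartz \<Longrightarrow> f \<in> borel_measurable borel"
  by (intro borel_measurable_continuous_onI schwartz_continuous)

lemma schwartz_bound:
  assumes "f \<in> schwartz"
  obtains C where "\<And>x. norm (f x) \<le> C * (1 / (1 + norm x) ^ k)"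
proof -
  from assms have "f \<in> weighted (\<lambda>x. 1 / (1 + norm x) ^ k)" by (simp add: schwartz_iff_weighted)
  then have "\<exists>C. \<forall>x. norm (iter_deriv [] f x) \<le> C * (1 / (1 + norm x) ^ k)"
    unfolding weighted_def by blast
  then show ?thesis using that by auto
qed

lemma schwartz_bounded:
  assumes "f \<in> schwartz"
  obtains C where "\<And>x. norm (f x) \<le> C"
  using schwartz_bound[OF assms, of 0] by auto

lemma schwartz_integrable:
  fixes f :: "'a::euclidean_space \<Rightarrow> complex"
  assumes f: "f \<in> schwartz"
  shows "integrable lborel f"
proof -
  obtain C where C: "\<And>x. norm (f x) \<le> C * (1 / (1 + norm x) ^ (DIM('a) + 1))"
    by (rule schwartz_bound[OF f]) blast
  show ?thesis
    by (rule Bochner_Integration.integrable_bound[OF integrable_mult_right[OF integrable_inverse_power_norm, of C]])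
      (auto intro!: AE_I2 order_trans[OF C order_trans[OF abs_ge_self]] schwartz_measurable f simp del: power_Suc)
qed

text \<open>Averaging F' over its translates by s v with 0 \<le> s \<le> 1 leaves the integral
  unchanged and produces F(x + v) - F(x), whose integral vanishes by translation invariance.
  Integrability of F thus replaces a discussion of boundary terms at infinity.\<close>

lemma integral_dir_deriv_zero:
  fixes F F' :: "'a::euclidean_space \<Rightarrow> complex"
  assumes F: "integrable lborel F" and F': "integrable lborel F'" and cont: "continuous_on UNIV F'"
    and der: "\<And>x. ((\<lambda>s. F (x + s *\<^sub>R v)) has_vector_derivative F' x) (at 0)"
  shows "(\<integral>x. F' x \<partial>lborel) = 0"
proof -
  have [measurable]: "F' \<in> borel_measurable borel" using F' by auto
  have ftc: "(\<integral>s. indicator {0..1::real} s *\<^sub>R F' (x + s *\<^sub>R v) \<partial>lborel) = F (x + v) - F x" for x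
  proof -
    have "(\<integral>s. indicator {0..1::real} s *\<^sub>R F' (x + s *\<^sub>R v) \<partial>lborel) = F (x + 1 *\<^sub>R v) - F (x + 0 *\<^sub>R v)"
    proof (rule integral_FTC_Icc)
      show "continuous_on {0..1} (\<lambda>s. F' (x + s *\<^sub>R v))"
        by (intro continuous_on_compose2[OF cont] continuous_intros) auto
      show "((\<lambda>s. F (x + s *\<^sub>R v)) has_vector_derivative F' (x + s *\<^sub>R v)) (at s within {0..1})" for s
        by (rule has_vector_derivative_at_within, rule has_vector_derivative_line_shift, rule der)
    qed auto
    then show ?thesis by simp
  qed
  have shift: "(\<integral>x. indicator {0..1::real} s *\<^sub>R F' (x + s *\<^sub>R v) \<partial>lborel)
      = indicator {0..1::real} s *\<^sub>R (\<integral>x. F' x \<partial>lborel)" for s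
    by (simp add: lborel_translate(2)[of F'])
  have "(\<integral>x. (\<integral>s. indicator {0..1::real} s *\<^sub>R F' (x + s *\<^sub>R v) \<partial>lborel) \<partial>lborel)
      = (\<integral>s. (\<integral>x. indicator {0..1::real} s *\<^sub>R F' (x + s *\<^sub>R v) \<partial>lborel) \<partial>lborel)"
  proof (rule lborel_pair.Fubini_integral)
    show "integrable (lborel \<Otimes>\<^sub>M lborel) (\<lambda>(s, x). indicator {0..1::real} s *\<^sub>R F' (x + s *\<^sub>R v))"
    proof (rule lborel_pair.Fubini_integrable)
      have "(\<integral>x. norm (F' (x + s *\<^sub>R v)) \<partial>lborel) = (\<integral>x. norm (F' x) \<partial>lborel)" for s
        by (rule lborel_translate(2))
      then show "integrable lborel (\<lambda>s. \<integral>x. norm (case (s, x) of (s, x) \<Rightarrow> indicator {0..1::real} s *\<^sub>R F' (x + s *\<^sub>R v)) \<partial>lborel)"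
        by simp
      show "AE s in lborel. integrable lborel (\<lambda>x. case (s, x) of (s, x) \<Rightarrow> indicator {0..1::real} s *\<^sub>R F' (x + s *\<^sub>R v))"
        using F' by (simp add: lborel_translate(1)[of F'])
    qed measurable
  qed
  also have "\<dots> = (\<integral>s. indicator {0..1::real} s *\<^sub>R (\<integral>x. F' x \<partial>lborel) \<partial>lborel)" 
    by (simp only: shift)
  also have "\<dots> = (\<integral>x. F' x \<partial>lborel)" by simp
  finally have "(\<integral>x. F' x \<partial>lborel) = (\<integral>x. F (x + v) - F x \<partial>lborel)"
    by (simp only: ftc)
  also have "\<dots> = 0"
    using F by (subst Bochner_Integration.integral_diff) (auto simp: lborel_translate)
  finally show ?thesis .
qed

section \<open>Decay of the Fourier transform of a Schwartz function\<close>

lemma ft_dir_deriv: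
  assumes u: "u \<in> schwartz"
  shows "ft (iter_deriv [v] u) q = \<i> * complex_of_real (q \<bullet> v) * ft u q"
proof -
  define F where "F x = cis (- (q \<bullet> x)) * u x" for x
  define F' where "F' x = cis (- (q \<bullet> x)) * iter_deriv [v] u x - \<i> * complex_of_real (q \<bullet> v) * (cis (- (q \<bullet> x)) * u x)" for x
  have u': "iter_deriv [v] u \<in> schwartz" by (rule schwartz_iter_deriv[OF u])
  have bnd: "integrable lborel (\<lambda>x. cis (- (q \<bullet> x)) * w x)" if "w \<in> schwartz" for w
    using schwartz_integrable[OF that] schwartz_measurable[OF that]
    by (elim Bochner_Integration.integrable_bound[OF integrable_norm]) (auto simp: norm_mult)
  have "(\<integral>x. F' x \<partial>lborel) = 0"
  proof (rule integral_dir_deriv_zero)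
    show "integrable lborel F" unfolding F_def by (rule bnd[OF u])
    show "integrable lborel F'" unfolding F'_def
      by (intro Bochner_Integration.integrable_diff integrable_mult_right bnd u u')
    show "continuous_on UNIV F'" unfolding F'_def
      by (intro continuous_intros schwartz_continuous u u')
    show "((\<lambda>s. F (x + s *\<^sub>R v)) has_vector_derivative F' x) (at 0)" for x
    proof -
      have c: "((\<lambda>s. cis (- (q \<bullet> (x + s *\<^sub>R v)))) has_vector_derivative
          cis (- (q \<bullet> x)) * (- \<i> * complex_of_real (q \<bullet> v))) (at 0)"
      proof -
        have "((\<lambda>s. cis (- (q \<bullet> x) + s * (- (q \<bullet> v)))) has_vector_derivative
            (- (q \<bullet> v)) *\<^sub>R (\<i> * cis (- (q \<bullet> x) + 0 * (- (q \<bullet> v))))) (at 0)"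
          unfolding has_vector_derivative_def
          by (rule has_derivative_eq_rhs, rule has_derivative_cis, (rule derivative_intros)+) auto
        then show ?thesis by (simp add: inner_add_right scaleR_conv_of_real mult_ac)
      qed
      have "((\<lambda>s. cis (- (q \<bullet> (x + s *\<^sub>R v))) * u (x + s *\<^sub>R v)) has_vector_derivative
          cis (- (q \<bullet> (x + 0 *\<^sub>R v))) * iter_deriv [v] u x + cis (- (q \<bullet> x)) * (- \<i> * complex_of_real (q \<bullet> v)) * u (x + 0 *\<^sub>R v)) (at 0)"
        using smooth_line0[OF schwartz_smooth[OF u], of "[]" x v]
        by (intro has_vector_derivative_mult c) auto
      then show ?thesis by (simp add: F_def F'_def algebra_simps)
    qed
  qed
  moreover have "(\<integral>x. F' x \<partial>lborel) = ft (iter_deriv [v] u) q - \<i> * complex_of_real (q \<bullet> v) * ft u q"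
    unfolding F'_def ft_def
    by (subst Bochner_Integration.integral_diff)
      (auto intro!: integrable_mult_right bnd u u' simp del: iter_deriv.simps)
  ultimately show ?thesis by simp
qed

lemma ft_iter_deriv:
  assumes u: "u \<in> schwartz"
  shows "ft (iter_deriv (replicate k v) u) q = (\<i> * complex_of_real (q \<bullet> v)) ^ k * ft u q"
proof (induction k)
  case (Suc k)
  have "iter_deriv (replicate (Suc k) v) u = iter_deriv [v] (iter_deriv (replicate k v) u)" by simp
  then show ?case
    using ft_dir_deriv[OF schwartz_iter_deriv[OF u, of "replicate k v"], of v q] Suc
    by (simp del: iter_deriv.simps add: mult_ac)
qed simp

lemma norm_ft_le: "norm (ft u q) \<le> (\<integral>x. norm (u x) \<partial>lborel)"
proof -
  have "norm (ft u q) \<le> (\<integral>x. norm (cis (- (q \<bullet> x)) * u x) \<partial>lborel)"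
    unfolding ft_def by (rule integral_norm_bound)
  then show ?thesis by (simp add: norm_mult)
qed

text \<open>DIM + 1 is the smallest integer order for which the resulting decay of
  \<open>ft u\<close> is integrable. Pure derivatives along the basis are enough because of
  \<open>power_norm_le\<close>.\<close>

definition sobolev_norm :: "('a::euclidean_space \<Rightarrow> complex) \<Rightarrow> real" where
  "sobolev_norm u = (\<integral>x. norm (u x) \<partial>lborel)
    + (\<Sum>b\<in>Basis. \<integral>x. norm (iter_deriv (replicate (DIM('a) + 1) b) u x) \<partial>lborel)"

text \<open>\<open>power_norm_le\<close> splits the weight into coordinate powers and contributes
  the constant; \<open>ft_iter_deriv\<close> turns each coordinate power into a derivative of u. The
  dependence on u is confined to \<open>sobolev_norm\<close>, so the bound can be integrated over a
  parameter in u.\<close>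

lemma norm_ft_decay:
  fixes u :: "'a::euclidean_space \<Rightarrow> complex"
  assumes u: "u \<in> schwartz"
  shows "norm (ft u q) \<le> real (DIM('a) + 1) ^ (DIM('a) + 1) * sobolev_norm u * (1 / (1 + norm q) ^ (DIM('a) + 1))"
proof -
  define n where "n = DIM('a) + 1"
  have "(1 + norm q) ^ n * norm (ft u q) \<le> real n ^ n * (1 + (\<Sum>b\<in>Basis. \<bar>q \<bullet> b\<bar> ^ n)) * norm (ft u q)"
    unfolding n_def by (intro mult_right_mono power_norm_le) auto
  also have "\<dots> = real n ^ n * (norm (ft u q) + (\<Sum>b\<in>Basis. norm (ft (iter_deriv (replicate n b) u) q)))"
    by (simp add: ft_iter_deriv[OF u] norm_mult norm_power sum_distrib_right distrib_right mult.assoc)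
  also have "\<dots> \<le> real n ^ n * sobolev_norm u"
    unfolding sobolev_norm_def n_def
    by (intro mult_left_mono add_mono sum_mono norm_ft_le) auto
  finally have "norm (ft u q) \<le> real n ^ n * sobolev_norm u / (1 + norm q) ^ n"
    by (subst pos_le_divide_eq) (auto simp: mult_ac intro!: zero_less_power add_pos_nonneg)
  then show ?thesis by (simp add: n_def)
qed

lemma ft_measurable[measurable]:
  assumes [measurable]: "u \<in> borel_measurable borel"
  shows "ft u \<in> borel_measurable borel"
  unfolding ft_def by measurable

lemma ft_integrable:
  fixes u :: "'a::euclidean_space \<Rightarrow> complex"
  assumes u: "u \<in> schwartz"
  shows "integrable lborel (ft u)"
proof (rule Bochner_Integration.integrable_bound)
  show "integrable lborel (\<lambda>q::'a. real (DIM('a) + 1) ^ (DIM('a) + 1) * sobolev_norm u * (1 / (1 + norm q) ^ (DIM('a) + 1)))"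
    by (intro integrable_mult_right integrable_inverse_power_norm)
  show "AE q in lborel. norm (ft u q) \<le> norm (real (DIM('a) + 1) ^ (DIM('a) + 1) * sobolev_norm u * (1 / (1 + norm q) ^ (DIM('a) + 1)))"
    unfolding real_norm_def by (intro AE_I2 order_trans[OF norm_ft_decay[OF u] abs_ge_self])
qed (use schwartz_measurable[OF u] in measurable)

lemma schwartz_inversion:
  fixes u :: "'a::euclidean_space \<Rightarrow> complex"
  assumes u: "u \<in> schwartz"
  shows "(\<integral>q. cis (q \<bullet> x) * ft u q \<partial>lborel) = complex_of_real ((2 * pi) ^ DIM('a)) * u x"
proof -
  obtain C where "\<And>x. norm (u x) \<le> C" using schwartz_bounded[OF u] by auto
  then show ?thesis
    by (rule fourier_inversion[OF schwartz_continuous[OF u] _ schwartz_integrable[OF u] ft_integrable[OF u]])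
qed

section \<open>Gaussians with a quadratic phase\<close>

lemma borel_measurable_cnj[measurable]: "f \<in> borel_measurable M \<Longrightarrow> (\<lambda>x. cnj (f x)) \<in> borel_measurable M"
  by (rule measurable_compose[of f M borel cnj borel])
    (auto intro!: borel_measurable_continuous_onI continuous_intros)

lemma linear_functional_inner:
  fixes l :: "'a::euclidean_space \<Rightarrow> real"
  assumes "linear l"
  obtains u where "\<And>x. l x = x \<bullet> u"
  using adjoint_works[OF assms, of _ 1] by (metis inner_real_def mult.right_neutral)

section \<open>Polynomials, which times a Gaussian form a class stable under differentiation\<close>

inductive_set poly_functions :: "('a::euclidean_space \<Rightarrow> complex) set" where
  const: "(\<lambda>x. c) \<in> poly_functions"
| lin: "p \<in> poly_functions \<Longrightarrow> (\<lambda>x. complex_of_real (x \<bullet> u) * p x) \<in> poly_functions"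
| add: "p \<in> poly_functions \<Longrightarrow> q \<in> poly_functions \<Longrightarrow> (\<lambda>x. p x + q x) \<in> poly_functions"

lemma poly_functions_scale: "p \<in> poly_functions \<Longrightarrow> (\<lambda>x. c * p x) \<in> poly_functions"
proof (induction rule: poly_functions.induct)
  case (const d) show ?case by (rule poly_functions.const)
next
  case (lin p u)
  from poly_functions.lin[OF lin.IH, of u] show ?case by (simp add: mult_ac)
next
  case (add p q)
  from poly_functions.add[OF add.IH] show ?case by (simp add: distrib_left)
qed

lemma poly_functions_continuous: "p \<in> poly_functions \<Longrightarrow> continuous_on UNIV p"
  by (induction rule: poly_functions.induct) (auto intro!: continuous_intros)

lemma has_vector_derivative_inner_line:
  "((\<lambda>s. complex_of_real ((x + s *\<^sub>R v) \<bullet> u)) has_vector_derivative complex_of_real (v \<bullet> u)) (at 0)"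
  unfolding inner_add_left inner_scaleR_left
  by (auto simp: has_vector_derivative_def scaleR_conv_of_real intro!: derivative_eq_intros)

lemma poly_functions_deriv:
  assumes "p \<in> poly_functions"
  shows "\<exists>p'\<in>poly_functions. \<forall>x. ((\<lambda>s. p (x + s *\<^sub>R v)) has_vector_derivative p' x) (at 0)"
  using assms
proof (induction rule: poly_functions.induct)
  case (const c)
  show ?case by (rule bexI[OF _ poly_functions.const[of 0]]) auto
next
  case (lin p u)
  then obtain p' where p': "p' \<in> poly_functions"
    "\<And>x. ((\<lambda>s. p (x + s *\<^sub>R v)) has_vector_derivative p' x) (at 0)" by blast
  show ?case
  proof (rule bexI[OF _ poly_functions.add[OF poly_functions.lin[OF p'(1), of u] poly_functions_scale[OF lin(1), of "complex_of_real (v \<bullet> u)"]]], intro allI)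
    fix x
    from has_vector_derivative_mult[OF has_vector_derivative_inner_line p'(2), of x v u x]
    show "((\<lambda>s. complex_of_real ((x + s *\<^sub>R v) \<bullet> u) * p (x + s *\<^sub>R v)) has_vector_derivative
        complex_of_real (x \<bullet> u) * p' x + complex_of_real (v \<bullet> u) * p x) (at 0)"
      by simp
  qed
next
  case (add p q)
  then obtain p' q' where *: "p' \<in> poly_functions" "q' \<in> poly_functions"
    "\<And>x. ((\<lambda>s. p (x + s *\<^sub>R v)) has_vector_derivative p' x) (at 0)"
    "\<And>x. ((\<lambda>s. q (x + s *\<^sub>R v)) has_vector_derivative q' x) (at 0)" by blast
  then show ?case
    by (intro bexI[OF _ poly_functions.add[OF *(1,2)]]) (auto intro!: has_vector_derivative_add)
qed

lemma poly_functions_growth: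
  assumes "p \<in> poly_functions"
  shows "\<exists>C\<ge>0. \<exists>k. \<forall>x. norm (p x) \<le> C * (1 + norm x) ^ k"
  using assms
proof (induction rule: poly_functions.induct)
  case (const c)
  show ?case by (intro exI[of _ "norm c"] conjI exI[of _ 0]) auto
next
  case (lin p u)
  then obtain C k where C: "C \<ge> 0" "\<And>x. norm (p x) \<le> C * (1 + norm x) ^ k" by blast
  have "norm (complex_of_real (x \<bullet> u) * p x) \<le> (norm u * C) * (1 + norm x) ^ Suc k" for x
  proof -
    have "norm (complex_of_real (x \<bullet> u) * p x) \<le> ((1 + norm x) * norm u) * (C * (1 + norm x) ^ k)"
      unfolding norm_mult norm_of_real real_norm_def
      by (intro mult_mono C order_trans[OF Cauchy_Schwarz_ineq2] mult_right_mono) auto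
    then show ?thesis by (simp add: mult_ac)
  qed
  with C(1) show ?case by (intro exI[of _ "norm u * C"] conjI exI[of _ "Suc k"]) auto
next
  case (add p q)
  then obtain C k D m where C: "C \<ge> 0" "\<And>x. norm (p x) \<le> C * (1 + norm x) ^ k"
    and D: "D \<ge> 0" "\<And>x. norm (q x) \<le> D * (1 + norm x) ^ m" by blast
  have "norm (p x + q x) \<le> (C + D) * (1 + norm x) ^ (k + m)" for x
  proof -
    have "norm (p x + q x) \<le> C * (1 + norm x) ^ k + D * (1 + norm x) ^ m"
      by (intro order_trans[OF norm_triangle_ineq] add_mono C D)
    also have "\<dots> \<le> C * (1 + norm x) ^ (k + m) + D * (1 + norm x) ^ (k + m)"
      using C D by (intro add_mono mult_left_mono power_increasing) auto
    finally show ?thesis by (simp add: distrib_right)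
  qed
  with C D show ?case by (intro exI[of _ "C + D"] conjI exI[of _ "k + m"]) auto
qed

lemma power_gaussian_bounded:
  fixes r :: real
  assumes r: "r \<ge> 0"
  shows "(1 + r) ^ k * exp (- r\<^sup>2 / 4) \<le> (1 + real k) ^ k * exp 1"
proof -
  have le: "(1 + r) ^ k \<le> (1 + real k) ^ k * exp r"
  proof (cases "k = 0")
    case False
    have "1 + r \<le> (1 + real k) * (1 + r / real k)"
      using r False by (simp add: field_simps)
    also have "\<dots> \<le> (1 + real k) * exp (r / real k)"
      by (intro mult_left_mono exp_ge_add_one_self) auto
    finally have "(1 + r) ^ k \<le> ((1 + real k) * exp (r / real k)) ^ k"
      using r by (intro power_mono) auto
    also have "\<dots> = (1 + real k) ^ k * exp r"
      using False by (simp add: power_mult_distrib flip: exp_of_nat_mult)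
    finally show ?thesis .
  qed (use r in simp)
  have "(1 + r) ^ k * exp (- r\<^sup>2 / 4) \<le> ((1 + real k) ^ k * exp r) * exp (- r\<^sup>2 / 4)"
    by (intro mult_right_mono le) auto
  also have "\<dots> = (1 + real k) ^ k * exp (r - r\<^sup>2 / 4)"
    by (simp add: exp_add[symmetric])
  also have "\<dots> \<le> (1 + real k) ^ k * exp 1"
    \<comment> \<open>The exponent satisfies r - r^2/4 \<le> 1 because (r/2 - 1)^2 is
      nonnegative.\<close>
    using zero_le_power2[of "r / 2 - 1"] by (intro mult_left_mono) (auto simp: power2_eq_square field_simps)
  finally show ?thesis .
qed

text \<open>The modulus is the Gaussian later called \<open>h\<close>; for B = -tau/2 the phase is
  the factor between \<open>W\<close> and \<open>U\<close>. With B = 0 the function also serves as a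
  test function with value 1 at 0.\<close>

definition gaussian_chirp :: "('a::euclidean_space \<Rightarrow> 'a \<Rightarrow> real) \<Rightarrow> 'a \<Rightarrow> complex" where
  "gaussian_chirp B x = complex_of_real (exp (- (norm x)\<^sup>2 / 4)) * cis (B x x)"

lemma norm_gaussian_chirp: "norm (gaussian_chirp B x) = exp (- (norm x)\<^sup>2 / 4)"
  by (simp add: gaussian_chirp_def norm_mult)

lemma gaussian_chirp_schwartz:
  fixes B :: "'a::euclidean_space \<Rightarrow> 'a \<Rightarrow> real"
  assumes B: "bilinear B"
  shows "gaussian_chirp B \<in> schwartz"
proof -
  define G where "G = (\<lambda>p x. p x * gaussian_chirp B x) ` poly_functions"
  interpret B: bounded_bilinear B
    using B bilinear_conv_bounded_bilinear by blast
  have contg: "continuous_on UNIV (gaussian_chirp B)"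
    unfolding gaussian_chirp_def by (intro continuous_intros B.continuous_on) auto
  have derg: "\<exists>u w. \<forall>x. ((\<lambda>s. gaussian_chirp B (x + s *\<^sub>R v)) has_vector_derivative
      (complex_of_real (x \<bullet> u) + \<i> * complex_of_real (x \<bullet> w)) * gaussian_chirp B x) (at 0)" for v
  proof -
    \<comment> \<open>This linear form is the derivative of the quadratic form B x x in the
      direction v.\<close>
    have "linear (\<lambda>x. B x v + B v x)"
      by (simp add: linear_iff B.add_left B.add_right B.scaleR_left B.scaleR_right algebra_simps)
    then obtain w where w: "\<And>x. B x v + B v x = x \<bullet> w" by (rule linear_functional_inner) blast
    have "((\<lambda>s. gaussian_chirp B (x + s *\<^sub>R v)) has_vector_derivative
      (complex_of_real (x \<bullet> ((-1/2) *\<^sub>R v)) + \<i> * complex_of_real (x \<bullet> w)) * gaussian_chirp B x) (at 0)" for x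
    proof -
      \<comment> \<open>\<open>q\<close> and \<open>r\<close> are the real and imaginary parts of
        the exponent along the line, ordered by powers of s so that the derivative at 0 can be read
        off.\<close>
      define q where "q s = - (norm x)\<^sup>2 / 4 + (s * (- (x \<bullet> v) / 2) - s\<^sup>2 * ((v \<bullet> v) / 4))" for s
      define r where "r s = B x x + (s * (x \<bullet> w) + s\<^sup>2 * B v v)" for s
      have eq: "gaussian_chirp B (x + s *\<^sub>R v) = exp (complex_of_real (q s) + \<i> * complex_of_real (r s))" for s
      proof -
        have "- (norm (x + s *\<^sub>R v))\<^sup>2 / 4 = q s"
        proof -
          have "(norm (x + s *\<^sub>R v))\<^sup>2 = (norm x)\<^sup>2 + 2 * (s * (x \<bullet> v)) + s\<^sup>2 * (v \<bullet> v)"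
            unfolding power2_norm_eq_inner inner_add_left inner_add_right inner_scaleR_left inner_scaleR_right
            by (simp add: inner_commute[of v x] power2_eq_square distrib_left)
          then show ?thesis by (simp add: q_def add_divide_distrib diff_divide_distrib)
        qed
        moreover have "B (x + s *\<^sub>R v) (x + s *\<^sub>R v) = r s"
          unfolding r_def w[symmetric] B.add_left B.add_right B.scaleR_left B.scaleR_right
          by (simp add: power2_eq_square distrib_left)
        ultimately show ?thesis
          by (simp only: gaussian_chirp_def cis_conv_exp exp_add exp_of_real)
      qed
      have "((\<lambda>s. complex_of_real (q s) + \<i> * complex_of_real (r s)) has_vector_derivative
          (complex_of_real (- (x \<bullet> v) / 2) + \<i> * complex_of_real (x \<bullet> w))) (at 0)"
      proof -
        have "(q has_vector_derivative - (x \<bullet> v) / 2) (at 0)"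
          unfolding q_def has_real_derivative_iff_has_vector_derivative[symmetric]
          by (auto intro!: derivative_eq_intros)
        moreover have "(r has_vector_derivative x \<bullet> w) (at 0)"
          unfolding r_def has_real_derivative_iff_has_vector_derivative[symmetric]
          by (auto intro!: derivative_eq_intros)
        ultimately show ?thesis
          by (intro has_vector_derivative_add has_vector_derivative_mult_right
              has_vector_derivative_of_real)
            (simp_all add: has_real_derivative_iff_has_vector_derivative)
      qed
      then have "(exp \<circ> (\<lambda>s. complex_of_real (q s) + \<i> * complex_of_real (r s)) has_vector_derivative
          (complex_of_real (- (x \<bullet> v) / 2) + \<i> * complex_of_real (x \<bullet> w)) * exp (complex_of_real (q 0) + \<i> * complex_of_real (r 0))) (at 0)"
        by (rule field_vector_diff_chain_at) (rule DERIV_exp)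
      moreover have "gaussian_chirp B x = exp (complex_of_real (q 0) + \<i> * complex_of_real (r 0))"
        using eq[of 0] by simp
      moreover have "complex_of_real (- (x \<bullet> v) / 2) = complex_of_real (x \<bullet> ((-1/2) *\<^sub>R v))"
        by simp
      ultimately show ?thesis by (simp only: eq comp_def)
    qed
    then show ?thesis by blast
  qed
  have "G \<subseteq> schwartz"
  proof (rule schwartz_closed_family)
    fix f assume "f \<in> G"
    then obtain p where p: "p \<in> poly_functions" "f = (\<lambda>x. p x * gaussian_chirp B x)" by (auto simp: G_def)
    show "continuous_on UNIV f"
      unfolding p(2) by (intro continuous_intros contg poly_functions_continuous p(1))
    obtain C k where C: "C \<ge> 0" "\<And>x. norm (p x) \<le> C * (1 + norm x) ^ k"
      using poly_functions_growth[OF p(1)] by blast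
    have "norm (f x) \<le> C * ((1 + real k) ^ k * exp 1)" for x
    proof -
      have "norm (f x) \<le> (C * (1 + norm x) ^ k) * exp (- (norm x)\<^sup>2 / 4)"
        unfolding p(2) norm_mult norm_gaussian_chirp by (intro mult_right_mono C) auto
      also have "\<dots> = C * ((1 + norm x) ^ k * exp (- (norm x)\<^sup>2 / 4))" by simp
      also have "\<dots> \<le> C * ((1 + real k) ^ k * exp 1)"
        by (intro mult_left_mono power_gaussian_bounded C) auto
      finally show ?thesis .
    qed
    then show "\<exists>C. \<forall>x. norm (f x) \<le> C" by blast
    show "\<exists>f'\<in>G. \<forall>x. ((\<lambda>s. f (x + s *\<^sub>R v)) has_vector_derivative f' x) (at 0)" for v
    proof -
      obtain p' where p': "p' \<in> poly_functions"
        "\<And>x. ((\<lambda>s. p (x + s *\<^sub>R v)) has_vector_derivative p' x) (at 0)"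
        using poly_functions_deriv[OF p(1)] by blast
      obtain u w where uw: "\<And>x. ((\<lambda>s. gaussian_chirp B (x + s *\<^sub>R v)) has_vector_derivative
          (complex_of_real (x \<bullet> u) + \<i> * complex_of_real (x \<bullet> w)) * gaussian_chirp B x) (at 0)"
        using derg by blast
      let ?r = "\<lambda>x. (complex_of_real (x \<bullet> u) * p x + \<i> * (complex_of_real (x \<bullet> w) * p x)) + p' x"
      have "?r \<in> poly_functions"
        by (intro poly_functions.add poly_functions_scale poly_functions.lin p p')
      then have "(\<lambda>x. ?r x * gaussian_chirp B x) \<in> G" unfolding G_def by (rule imageI)
      moreover have "((\<lambda>s. f (x + s *\<^sub>R v)) has_vector_derivative ?r x * gaussian_chirp B x) (at 0)" for x
        using has_vector_derivative_mult[OF p'(2)[of x] uw[of x]] by (simp add: p(2) algebra_simps)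
      ultimately show ?thesis by (intro bexI[of _ "\<lambda>x. ?r x * gaussian_chirp B x"] allI)
    qed
    show "(\<lambda>x. complex_of_real (x \<bullet> b) * f x) \<in> G" for b
      using imageI[OF poly_functions.lin[OF p(1), of b], of "\<lambda>p x. p x * gaussian_chirp B x"]
      by (simp add: G_def p(2) mult.assoc)
  qed
  moreover have "gaussian_chirp B \<in> G"
    using imageI[OF poly_functions.const[of 1], of "\<lambda>p x. p x * gaussian_chirp B x"] by (simp add: G_def)
  ultimately show ?thesis by blast
qed

section \<open>The symplectic Fourier transform\<close>

text \<open>Writing the form through an invertible map makes the symplectic Fourier transform equal
  to \<open>ft\<close> composed with \<open>L\<close>, up to the constant of the measure.\<close>

lemma symplectic_form_representation:
  fixes \<sigma> :: "'a::euclidean_space \<Rightarrow> 'a \<Rightarrow> real"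
  assumes bil: "bilinear \<sigma>" and nd: "\<And>x. (\<And>y. \<sigma> x y = 0) \<Longrightarrow> x = 0"
  obtains L where "linear L" "bij L" "\<And>x y. \<sigma> x y = L x \<bullet> y"
proof -
  have lin: "linear (\<sigma> x)" and lin': "linear (\<lambda>x. \<sigma> x y)" for x y
    using bil by (auto simp: bilinear_def)
  define L where "L x = adjoint (\<sigma> x) 1" for x
  have L: "\<sigma> x y = L x \<bullet> y" for x y
    using adjoint_works[OF lin, of y x 1] by (simp add: L_def inner_commute)
  have "linear L"
    by (rule linearI; rule vector_eq_rdot[THEN iffD1])
      (simp_all add: L[symmetric] inner_add_left linear_add[OF lin'] linear_scale[OF lin'])
  moreover have "inj L"
    using nd by (subst linear_injective_0[OF \<open>linear L\<close>]) (auto simp: L)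
  ultimately have "bij L"
    using linear_injective_imp_surjective[of L] by (auto simp: bij_def)
  with \<open>linear L\<close> L show ?thesis using that by blast
qed

lemma fourier_wrt_density:
  fixes \<sigma> :: "'a::euclidean_space \<Rightarrow> 'a \<Rightarrow> real"
  assumes "c \<ge> 0" "linear L" "\<And>x y. \<sigma> x y = L x \<bullet> y" and [measurable]: "a \<in> borel_measurable borel"
  shows "fourier_wrt (density lborel (\<lambda>_. ennreal c)) \<sigma> a \<xi> = complex_of_real c * ft a (L \<xi>)"
proof -
  have "(\<lambda>\<eta>. \<sigma> \<xi> \<eta>) = (\<lambda>\<eta>. L \<xi> \<bullet> \<eta>)" using assms by auto
  then show ?thesis
    unfolding fourier_wrt_def ft_def using assms(1)
    by (simp add: integral_density scaleR_conv_of_real)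
qed

lemma fourier_wrt_integrable:
  fixes \<sigma> :: "'a::euclidean_space \<Rightarrow> 'a \<Rightarrow> real"
  assumes "c \<ge> 0" "linear L" "bij L" "\<And>x y. \<sigma> x y = L x \<bullet> y" and a: "a \<in> schwartz"
  shows "integrable lborel (fourier_wrt (density lborel (\<lambda>_. ennreal c)) \<sigma> a)"
proof -
  have "integrable lborel (\<lambda>\<xi>. complex_of_real c * ft a (L \<xi>))"
    by (rule integrable_mult_right[OF integrable_linear_substitution[OF assms(2,3) ft_integrable[OF a]]])
  moreover have "fourier_wrt (density lborel (\<lambda>_. ennreal c)) \<sigma> a = (\<lambda>\<xi>. complex_of_real c * ft a (L \<xi>))"
    by (rule ext) (rule fourier_wrt_density[OF assms(1,2,4) schwartz_measurable[OF a]])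
  ultimately show ?thesis by (simp only:)
qed

text \<open>Antisymmetry turns the kernel of the outer transform into cis (L \<eta> \<bullet>
  \<xi>), which after the substitution by \<open>L\<close> is the kernel of Fourier inversion. So
  the square of the transform is a multiple of the identity, and the factor is quadratic in the
  constant of the measure.\<close>

lemma fourier_wrt_twice:
  fixes \<sigma> :: "'a::euclidean_space \<Rightarrow> 'a \<Rightarrow> real"
  assumes \<sigma>: "symplectic_form \<sigma>" and L: "linear L" "bij L" "\<And>x y. \<sigma> x y = L x \<bullet> y"
  obtains k where "k > 0" "\<And>a c \<xi>. c > 0 \<Longrightarrow> a \<in> schwartz \<Longrightarrow>
    fourier_wrt (density lborel (\<lambda>_. ennreal c)) \<sigma> (fourier_wrt (density lborel (\<lambda>_. ennreal c)) \<sigma> a) \<xi>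
      = complex_of_real (c\<^sup>2 * k) * a \<xi>"
proof -
  obtain k where k: "k > 0" "\<And>f::'a \<Rightarrow> complex. f \<in> borel_measurable borel \<Longrightarrow>
      (\<integral>x. f (L x) \<partial>lborel) = k *\<^sub>R (\<integral>x. f x \<partial>lborel)"
    by (rule lborel_linear_substitution[OF L(1,2), where ?'b=complex]) blast
  have [measurable]: "L \<in> borel_measurable borel" 
    by (intro borel_measurable_continuous_onI linear_continuous_on linear_conv_bounded_linear[THEN iffD1] L(1))
  show ?thesis
  proof (rule that[of "k * (2 * pi) ^ DIM('a)"])
    show "k * (2 * pi) ^ DIM('a) > 0" using k by simp
    fix a :: "'a \<Rightarrow> complex" and c \<xi>
    assume c: "c > (0::real)" and a: "a \<in> schwartz"
    let ?M = "density lborel (\<lambda>_. ennreal c)"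
    have [measurable]: "a \<in> borel_measurable borel" by (rule schwartz_measurable[OF a])
    have F: "fourier_wrt ?M \<sigma> a = (\<lambda>\<xi>. complex_of_real c * ft a (L \<xi>))"
      using c by (auto simp: fourier_wrt_density[OF _ L(1,3)])
    have "fourier_wrt ?M \<sigma> (fourier_wrt ?M \<sigma> a) \<xi> = complex_of_real c * (\<integral>\<eta>. cis (- (L \<xi> \<bullet> \<eta>)) * (complex_of_real c * ft a (L \<eta>)) \<partial>lborel)"
      unfolding F using c by (subst fourier_wrt_density[OF _ L(1,3)]) (auto simp: ft_def)
    also have "(\<lambda>\<eta>. cis (- (L \<xi> \<bullet> \<eta>)) * (complex_of_real c * ft a (L \<eta>)))
        = (\<lambda>\<eta>. complex_of_real c * (cis (L \<eta> \<bullet> \<xi>) * ft a (L \<eta>)))"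
    proof
      fix \<eta>
      have "- (L \<xi> \<bullet> \<eta>) = L \<eta> \<bullet> \<xi>" using \<sigma> L(3) unfolding symplectic_form_def by metis
      then show "cis (- (L \<xi> \<bullet> \<eta>)) * (complex_of_real c * ft a (L \<eta>))
          = complex_of_real c * (cis (L \<eta> \<bullet> \<xi>) * ft a (L \<eta>))" by simp
    qed
    also have "(\<integral>\<eta>. complex_of_real c * (cis (L \<eta> \<bullet> \<xi>) * ft a (L \<eta>)) \<partial>lborel)
        = complex_of_real c * (\<integral>\<eta>. cis (L \<eta> \<bullet> \<xi>) * ft a (L \<eta>) \<partial>lborel)"
      by (rule integral_mult_right_zero)
    also have "(\<integral>\<eta>. cis (L \<eta> \<bullet> \<xi>) * ft a (L \<eta>) \<partial>lborel) = k *\<^sub>R (\<integral>q. cis (q \<bullet> \<xi>) * ft a q \<partial>lborel)"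
      by (rule k(2)[of "\<lambda>q. cis (q \<bullet> \<xi>) * ft a q"]) measurable
    also have "\<dots> = k *\<^sub>R (complex_of_real ((2 * pi) ^ DIM('a)) * a \<xi>)"
      by (simp only: schwartz_inversion[OF a])
    finally show "fourier_wrt ?M \<sigma> (fourier_wrt ?M \<sigma> a) \<xi> = complex_of_real (c\<^sup>2 * (k * (2 * pi) ^ DIM('a))) * a \<xi>"
      by (simp add: scaleR_conv_of_real power2_eq_square mult_ac)
  qed
qed

text \<open>Parseval's formula in which the second function is merely integrable: Fubini moves the
  kernel onto the transform of v, where it acts as a second transform and returns v. Schwartz b give
  the unitarity required of \<open>symplectic_measure\<close>; the integrable symbol b gives the
  value of the operator.\<close>

lemma fourier_wrt_pairing:
  fixes \<sigma> :: "'a::euclidean_space \<Rightarrow> 'a \<Rightarrow> real"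
  assumes \<sigma>: "symplectic_form \<sigma>" and L: "linear L" "bij L" "\<And>x y. \<sigma> x y = L x \<bullet> y"
    and c: "c > 0" and M: "M = density lborel (\<lambda>_. ennreal c)"
    and v: "v \<in> schwartz" and FF: "fourier_wrt M \<sigma> (fourier_wrt M \<sigma> v) = v"
    and b: "integrable lborel b"
  shows "(\<integral>\<xi>. cnj (fourier_wrt M \<sigma> v \<xi>) * (\<integral>\<eta>. cis (- \<sigma> \<xi> \<eta>) * b \<eta> \<partial>M) \<partial>M)
    = (\<integral>\<eta>. cnj (v \<eta>) * b \<eta> \<partial>M)"
proof -
  define Fv where "Fv = fourier_wrt M \<sigma> v"
  have intF: "integrable lborel Fv"
    unfolding Fv_def M using c by (intro fourier_wrt_integrable[OF _ L v]) simp
  have [measurable]: "L \<in> borel_measurable borel" 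
    by (intro borel_measurable_continuous_onI linear_continuous_on linear_conv_bounded_linear[THEN iffD1] L(1))
  have [measurable]: "Fv \<in> borel_measurable borel" "b \<in> borel_measurable borel" using intF b by auto
  have intM: "(\<integral>x. f x \<partial>M) = complex_of_real c * (\<integral>x. f x \<partial>lborel)" if "f \<in> borel_measurable borel" for f
    unfolding M using that c by (subst integral_density) (auto simp: scaleR_conv_of_real)
  have anti: "- (L x \<bullet> y) = L y \<bullet> x" for x y
    using \<sigma> L(3) unfolding symplectic_form_def by metis
  have "(\<integral>\<xi>. cnj (Fv \<xi>) * (\<integral>\<eta>. cis (- \<sigma> \<xi> \<eta>) * b \<eta> \<partial>M) \<partial>M)
      = complex_of_real c * (\<integral>\<xi>. cnj (Fv \<xi>) * (complex_of_real c * (\<integral>\<eta>. cis (- (L \<xi> \<bullet> \<eta>)) * b \<eta> \<partial>lborel)) \<partial>lborel)"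
  proof -
    have "(\<integral>\<eta>. cis (- (L \<xi> \<bullet> \<eta>)) * b \<eta> \<partial>M) = complex_of_real c * (\<integral>\<eta>. cis (- (L \<xi> \<bullet> \<eta>)) * b \<eta> \<partial>lborel)" for \<xi>
      by (rule intM) measurable
    then show ?thesis unfolding L(3) by (simp only:) (rule intM, measurable)
  qed
  also have "\<dots> = complex_of_real (c * c) * (\<integral>\<xi>. (\<integral>\<eta>. cnj (Fv \<xi>) * (cis (- (L \<xi> \<bullet> \<eta>)) * b \<eta>) \<partial>lborel) \<partial>lborel)"
  proof -
    have "(\<integral>\<xi>. cnj (Fv \<xi>) * (complex_of_real c * (\<integral>\<eta>. cis (- (L \<xi> \<bullet> \<eta>)) * b \<eta> \<partial>lborel)) \<partial>lborel)
        = (\<integral>\<xi>. complex_of_real c * (\<integral>\<eta>. cnj (Fv \<xi>) * (cis (- (L \<xi> \<bullet> \<eta>)) * b \<eta>) \<partial>lborel) \<partial>lborel)"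
      by (simp add: mult.left_commute)
    then show ?thesis by (simp only: integral_mult_right_zero of_real_mult mult.assoc)
  qed
  also have "(\<integral>\<xi>. (\<integral>\<eta>. cnj (Fv \<xi>) * (cis (- (L \<xi> \<bullet> \<eta>)) * b \<eta>) \<partial>lborel) \<partial>lborel)
      = (\<integral>\<eta>. (\<integral>\<xi>. cnj (Fv \<xi>) * (cis (- (L \<xi> \<bullet> \<eta>)) * b \<eta>) \<partial>lborel) \<partial>lborel)"
  proof (rule lborel_pair.Fubini_integral, rule integrable_pair_bound)
    show "integrable lborel (\<lambda>\<xi>. norm (b \<xi>))" "integrable lborel (\<lambda>\<xi>. norm (Fv \<xi>))" using intF b by auto
  qed (auto simp: norm_mult)
  also have "\<dots> = (\<integral>\<eta>. cnj (\<integral>\<xi>. cis (- (L \<eta> \<bullet> \<xi>)) * Fv \<xi> \<partial>lborel) * b \<eta> \<partial>lborel)"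
  proof (rule Bochner_Integration.integral_cong[OF refl])
    fix \<eta>
    have "cnj (cis (- (L \<eta> \<bullet> \<xi>)) * Fv \<xi>) = cnj (Fv \<xi>) * cis (- (L \<xi> \<bullet> \<eta>))" for \<xi>
      by (simp add: cis_cnj anti mult_ac)
    then have "cnj (\<integral>\<xi>. cis (- (L \<eta> \<bullet> \<xi>)) * Fv \<xi> \<partial>lborel) = (\<integral>\<xi>. cnj (Fv \<xi>) * cis (- (L \<xi> \<bullet> \<eta>)) \<partial>lborel)"
      by (simp only: Bochner_Integration.integral_cnj[symmetric])
    then show "(\<integral>\<xi>. cnj (Fv \<xi>) * (cis (- (L \<xi> \<bullet> \<eta>)) * b \<eta>) \<partial>lborel)
        = cnj (\<integral>\<xi>. cis (- (L \<eta> \<bullet> \<xi>)) * Fv \<xi> \<partial>lborel) * b \<eta>"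
      by (simp add: mult.assoc[symmetric])
  qed
  also have "complex_of_real (c * c) * \<dots> = complex_of_real c * (\<integral>\<eta>. cnj (complex_of_real c * (\<integral>\<xi>. cis (- (L \<eta> \<bullet> \<xi>)) * Fv \<xi> \<partial>lborel)) * b \<eta> \<partial>lborel)"
    by (simp add: mult.assoc)
  also have "(\<lambda>\<eta>. complex_of_real c * (\<integral>\<xi>. cis (- (L \<eta> \<bullet> \<xi>)) * Fv \<xi> \<partial>lborel)) = fourier_wrt M \<sigma> Fv"
    unfolding fourier_wrt_def L(3) by (subst intM) auto
  also have "\<dots> = v" using FF by (simp add: Fv_def)
  also have "complex_of_real c * (\<integral>\<eta>. cnj (v \<eta>) * b \<eta> \<partial>lborel) = (\<integral>\<eta>. cnj (v \<eta>) * b \<eta> \<partial>M)"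
    using schwartz_measurable[OF v] by (subst intM) auto
  finally show ?thesis by (simp add: Fv_def)
qed

text \<open>The value of a \<open>THE\<close> is accessible only through existence and uniqueness.
  Both come from Haar uniqueness, which leaves a single positive constant to be determined.\<close>

lemma symplectic_measure_properties:
  fixes \<sigma> :: "'a::euclidean_space \<Rightarrow> 'a \<Rightarrow> real"
  assumes \<sigma>: "symplectic_form \<sigma>"
  obtains c where "c > 0" "symplectic_measure \<sigma> = density lborel (\<lambda>_. ennreal c)"
    "\<And>a. a \<in> schwartz \<Longrightarrow> symplectic_fourier \<sigma> (symplectic_fourier \<sigma> a) = a"
proof -
  obtain L where L: "linear L" "bij L" "\<And>x y. \<sigma> x y = L x \<bullet> y"
    using symplectic_form_representation[of \<sigma>] \<sigma> unfolding symplectic_form_def by metis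
  obtain k where k: "k > 0" "\<And>a c \<xi>. c > 0 \<Longrightarrow> a \<in> schwartz \<Longrightarrow>
    fourier_wrt (density lborel (\<lambda>_. ennreal c)) \<sigma> (fourier_wrt (density lborel (\<lambda>_. ennreal c)) \<sigma> a) \<xi>
      = complex_of_real (c\<^sup>2 * k) * a \<xi>"
    using fourier_wrt_twice[OF \<sigma> L] by metis
  \<comment> \<open>The square of the transform is c^2 k times the identity, so involutivity fixes
    c.\<close>
  define c where "c = 1 / sqrt k"
  have c: "c > 0" "c\<^sup>2 * k = 1" using k(1) by (auto simp: c_def power_divide)
  define M where "M = (density lborel (\<lambda>_. ennreal c) :: 'a measure)"
  have FF: "fourier_wrt M \<sigma> (fourier_wrt M \<sigma> a) = a" if "a \<in> schwartz" for a
    using k(2)[OF c(1) that] c(2) by (simp add: fun_eq_iff M_def)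
  have haar: "haar_measure M"
    unfolding haar_measure_def
  proof safe
    show "distr M borel ((+) x) = M" for x
    proof (rule measure_eqI)
      fix A assume "A \<in> sets (distr M borel ((+) x))"
      then have [measurable]: "A \<in> sets borel" by simp
      have "(+) x -` A \<in> sets borel"
        using measurable_sets[of "(+) x" borel borel A] by simp
      then have "emeasure (distr M borel ((+) x)) A = ennreal c * emeasure lborel ((+) x -` A)"
        unfolding M_def by (subst emeasure_distr) (auto simp: emeasure_density_const)
      also have "emeasure lborel ((+) x -` A) = emeasure (distr lborel borel ((+) x)) A"
        by (subst emeasure_distr) auto
      finally show "emeasure (distr M borel ((+) x)) A = emeasure M A"
        by (simp add: lborel_distr_plus M_def emeasure_density_const)
 qed (simp add: M_def)
    show "emeasure M K < \<infinity>" if "compact K" for K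
      using that emeasure_compact_finite[of K] by (simp add: M_def emeasure_density_const borel_compact ennreal_mult_less_top)
    show "emeasure M UNIV = 0 \<Longrightarrow> False"
      using c(1) by (simp add: M_def emeasure_density_const ennreal_mult_eq_top_iff)
  qed (auto simp: M_def)
  have pars: "(\<integral>\<xi>. cnj (fourier_wrt M \<sigma> a \<xi>) * fourier_wrt M \<sigma> b \<xi> \<partial>M) = (\<integral>\<xi>. cnj (a \<xi>) * b \<xi> \<partial>M)"
    if "a \<in> schwartz" "b \<in> schwartz" for a b
    using fourier_wrt_pairing[OF \<sigma> L c(1) M_def that(1) FF[OF that(1)] schwartz_integrable[OF that(2)]]
    by (simp add: fourier_wrt_def)
  have eq: "symplectic_measure \<sigma> = M"
    unfolding symplectic_measure_def
  proof (rule the_equality)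
    fix N :: "'a measure"
    assume N: "haar_measure N \<and> (\<forall>a\<in>schwartz. fourier_wrt N \<sigma> (fourier_wrt N \<sigma> a) = a) \<and>
     (\<forall>a\<in>schwartz. \<forall>b\<in>schwartz.
        (\<integral>\<xi>. cnj (fourier_wrt N \<sigma> a \<xi>) * fourier_wrt N \<sigma> b \<xi> \<partial>N) = (\<integral>\<xi>. cnj (a \<xi>) * b \<xi> \<partial>N))"
    then obtain d where d: "d > 0" "N = density lborel (\<lambda>_. ennreal d)"
      using haar_measure_unique by blast
    \<comment> \<open>A competing measure has density d; evaluating involutivity on one Schwartz
      function that does not vanish at 0 forces d^2 k = 1.\<close>
    have sch: "gaussian_chirp (\<lambda>x y. 0) \<in> (schwartz :: ('a \<Rightarrow> complex) set)"
      by (rule gaussian_chirp_schwartz) (simp add: bilinear_def linear_iff)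
    with N have "fourier_wrt N \<sigma> (fourier_wrt N \<sigma> (gaussian_chirp (\<lambda>x y. 0))) = gaussian_chirp (\<lambda>x y. 0)"
      by blast
    then have "fourier_wrt N \<sigma> (fourier_wrt N \<sigma> (gaussian_chirp (\<lambda>x y. 0))) 0 = gaussian_chirp (\<lambda>x y. 0) (0::'a)"
      by (rule fun_cong)
    then have "complex_of_real (d\<^sup>2 * k) * gaussian_chirp (\<lambda>x y. 0) (0::'a) = gaussian_chirp (\<lambda>x y. 0) (0::'a)"
      by (simp only: d(2) k(2)[OF d(1) sch])
    moreover have "gaussian_chirp (\<lambda>x y. 0) (0::'a) = 1" by (simp add: gaussian_chirp_def)
    ultimately have "complex_of_real (d\<^sup>2 * k) = 1" by (simp only: mult_1_right)
    then have "d\<^sup>2 * k = 1" by (simp only: of_real_eq_1_iff)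
    then have "d\<^sup>2 = c\<^sup>2" using c(2) k(1) by (metis mult_right_cancel less_irrefl)
    then show "N = M" using c(1) d by (simp add: M_def)
  qed (use haar FF pars in auto)
  show ?thesis
    by (rule that[OF c(1)]) (use FF in \<open>auto simp: eq M_def symplectic_fourier_def\<close>)
qed

section \<open>Operators on complex Hilbert spaces\<close>

lemma cinner_add_left: "cinner (x + y) z = cinner x z + cinner (y::'h::complex_hilbert_space) z"
  by (subst (1 2 3) cinner_commute) (simp add: cinner_add_right)

lemma cinner_scaleC_left: "cinner (c *\<^sub>C x) y = cnj c * cinner (x::'h::complex_hilbert_space) y"
  by (subst (1 2) cinner_commute) (simp add: cinner_scaleC_right)

lemma cinner_scaleR_right: "cinner x (r *\<^sub>R y) = complex_of_real r * cinner x (y::'h::complex_hilbert_space)"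
  by (simp add: scaleC_of_real[symmetric] cinner_scaleC_right)

lemma cinner_scaleR_left: "cinner (r *\<^sub>R x) y = complex_of_real r * cinner x (y::'h::complex_hilbert_space)"
  by (simp add: scaleC_of_real[symmetric] cinner_scaleC_left)

lemma cinner_self: "cinner x x = complex_of_real ((norm (x::'h::complex_hilbert_space))\<^sup>2)"
proof (rule complex_eqI)
  have "Im (cinner x x) = - Im (cinner x x)"
    using arg_cong[OF cinner_commute[of x x], of Im] by simp
  then show "Im (cinner x x) = Im (complex_of_real ((norm x)\<^sup>2))" by simp
qed (simp add: Re_cinner power2_norm_eq_inner)

lemma norm_scaleC: "norm (c *\<^sub>C x) = cmod c * norm (x::'h::complex_hilbert_space)"
proof -
  have "complex_of_real ((norm (c *\<^sub>C x))\<^sup>2) = (c * cnj c) * complex_of_real ((norm x)\<^sup>2)"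
    by (simp only: cinner_self[symmetric] cinner_scaleC_left cinner_scaleC_right mult_ac)
  also have "c * cnj c = complex_of_real ((cmod c)\<^sup>2)" by (rule complex_norm_square[symmetric])
  finally have "(norm (c *\<^sub>C x))\<^sup>2 = (cmod c * norm x)\<^sup>2"
    by (simp only: of_real_mult[symmetric] of_real_eq_iff power_mult_distrib)
  then show ?thesis by (simp add: power2_eq_iff_nonneg)
qed

lemma cmod_cinner_le: "cmod (cinner x y) \<le> norm x * norm (y::'h::complex_hilbert_space)"
proof (cases "cinner x y = 0")
  case False
  \<comment> \<open>This unimodular factor rotates the scalar product to a nonnegative real, which
    reduces the claim to the real Cauchy-Schwarz inequality.\<close>
  define c where "c = cnj (cinner x y) / complex_of_real (cmod (cinner x y))"
  have c1: "cmod c = 1" using False by (simp add: c_def norm_divide)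
  have "cinner x (c *\<^sub>C y) = complex_of_real (cmod (cinner x y))"
    using False complex_norm_square[of "cinner x y"]
    by (simp add: c_def cinner_scaleC_right field_simps power2_eq_square)
  then have "cmod (cinner x y) = inner x (c *\<^sub>C y)" by (simp add: Re_cinner[symmetric])
  also have "\<dots> \<le> norm x * norm (c *\<^sub>C y)" by (rule norm_cauchy_schwarz)
  finally show ?thesis by (simp add: norm_scaleC c1)
qed simp

interpretation cinner: bounded_bilinear "cinner :: 'h::complex_hilbert_space \<Rightarrow> 'h \<Rightarrow> complex"
  by unfold_locales
    (auto simp: cinner_add_left cinner_add_right cinner_scaleR_left cinner_scaleR_right
      scaleR_conv_of_real intro!: exI[of _ 1] cmod_cinner_le)

lemma scaleC_simps:
  fixes x :: "'h::complex_hilbert_space"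
  shows "c *\<^sub>C 0 = (0::'h)" "1 *\<^sub>C x = x" "c *\<^sub>C (- x) = - (c *\<^sub>C x)"
    "c *\<^sub>C (x - y) = c *\<^sub>C x - c *\<^sub>C y"
    "c *\<^sub>C (r *\<^sub>R x) = r *\<^sub>R (c *\<^sub>C x)"
proof -
  show "c *\<^sub>C 0 = (0::'h)" using norm_scaleC[of c "0::'h"] by simp
  show "1 *\<^sub>C x = x" using scaleC_of_real[of 1 x] by simp
  have sR: "c *\<^sub>C (r *\<^sub>R y) = r *\<^sub>R (c *\<^sub>C y)" for r and y :: 'h
    by (simp add: scaleC_of_real[symmetric] scaleC_scaleC mult.commute)
  then show "c *\<^sub>C (r *\<^sub>R x) = r *\<^sub>R (c *\<^sub>C x)" .
  have m: "c *\<^sub>C (- y) = - (c *\<^sub>C y)" for y :: 'h using sR[of "-1" y] by simp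
  then show "c *\<^sub>C (- x) = - (c *\<^sub>C x)" .
  show "c *\<^sub>C (x - y) = c *\<^sub>C x - c *\<^sub>C y"
    using scaleC_add_right[of c x "-y"] m[of y] by simp
qed

lemma cinner_ext:
  assumes "\<And>z. cinner z x = cinner z (y::'h::complex_hilbert_space)"
  shows "x = y"
proof -
  have "cinner (x - y) (x - y) = 0" by (simp add: cinner.diff_right assms)
  then show ?thesis by (simp add: cinner_self)
qed

section \<open>The Riesz representation theorem and bounded sesquilinear forms\<close>

lemma par_bound:
  fixes s :: real
  assumes "s \<le> 2 * (j + k) - 4 * m" "j < m + u" "k < m + w" "u \<le> z" "w \<le> z"
  shows "s < 4 * z"
  using assms by argo

text \<open>Minimise J x = |x|^2 - 2 r x. The parallelogram law makes a minimising sequence Cauchy,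
  completeness provides a minimiser y, and stationarity of J at y is the claim.\<close>

lemma real_riesz:
  fixes r :: "'h::complex_hilbert_space \<Rightarrow> real"
  assumes "bounded_linear r"
  obtains y where "\<And>x. r x = inner y x"
proof -
  interpret r: bounded_linear r by fact
  obtain K where K: "\<And>x. norm (r x) \<le> norm x * K" using r.bounded by blast
  define J where "J x = (norm x)\<^sup>2 - 2 * r x" for x
  have lower: "- K\<^sup>2 \<le> J x" for x
  proof -
    have "r x \<le> norm x * K" using K[of x] by simp
    then show ?thesis using zero_le_power2[of "norm x - K"] by (simp add: J_def power2_eq_square algebra_simps)
  qed
  define m where "m = Inf (range J)"
  have bdd: "bdd_below (range J)" using lower by (rule bdd_belowI2)
  have mle: "m \<le> J x" for x unfolding m_def by (rule cInf_lower[OF _ bdd]) simp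
  have "\<exists>x. J x < m + 1 / real (Suc n)" for n
  proof -
    have "Inf (range J) < m + 1 / real (Suc n)" unfolding m_def by simp
    then show ?thesis using cInf_less_iff[OF _ bdd] by auto
  qed
  then obtain X where X: "\<And>n. J (X n) < m + 1 / real (Suc n)" by metis
  have par: "(norm (x - y))\<^sup>2 \<le> 2 * (J x + J y) - 4 * m" for x y
  proof -
    have "4 * J ((1/2) *\<^sub>R (x + y)) = 2 * (J x + J y) - (norm (x - y))\<^sup>2"
      by (simp add: J_def r.scaleR r.add power2_norm_eq_inner inner_simps inner_commute algebra_simps)
    with mle[of "(1/2) *\<^sub>R (x + y)"] show ?thesis by simp
  qed
  have "Cauchy X"
  proof (rule metric_CauchyI)
    fix e :: real assume e: "e > 0"
    obtain N where N: "4 / real (Suc N) < e\<^sup>2"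
    proof -
      obtain N where "4 / e\<^sup>2 < real N" using reals_Archimedean2 by blast
      then have "4 / real (Suc N) < e\<^sup>2" using e by (simp add: field_simps) (smt (verit) zero_less_power2 mult_less_cancel_left2 zero_le_power2)
      then show ?thesis by (rule that)
    qed
    have "dist (X p) (X q) < e" if "p \<ge> N" "q \<ge> N" for p q
    proof -
      have "1 / real (Suc p) \<le> 1 / real (Suc N)" "1 / real (Suc q) \<le> 1 / real (Suc N)"
        using that by (auto simp: frac_le)
      then have "(norm (X p - X q))\<^sup>2 < e\<^sup>2"
      proof -
        have "(norm (X p - X q))\<^sup>2 < 4 * (1 / real (Suc N))"
          by (rule par_bound[OF par X X]) fact+
        then show ?thesis using N by simp
      qed
      then have "norm (X p - X q) < e" by (rule power2_less_imp_less) (use e in simp)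
      then show ?thesis by (simp only: dist_norm)
    qed
    then show "\<exists>M. \<forall>p\<ge>M. \<forall>q\<ge>M. dist (X p) (X q) < e" by blast
  qed
  then obtain y where y: "X \<longlonglongrightarrow> y" using Cauchy_convergent convergent_def by blast
  have "(\<lambda>n. J (X n)) \<longlonglongrightarrow> J y"
    unfolding J_def by (intro tendsto_intros y r.tendsto)
  moreover have "(\<lambda>n. m + 1 / real (Suc n)) \<longlonglongrightarrow> m + 0"
    by (intro tendsto_intros LIMSEQ_Suc[OF lim_1_over_n])
  ultimately have Jy: "J y \<le> m"
    using X by (intro LIMSEQ_le[of "\<lambda>n. J (X n)" "J y" "\<lambda>n. m + 1 / real (Suc n)" m]) (auto intro: less_imp_le)
  have "r x = inner y x" for x
  proof (cases "x = 0")
    case False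
    define d where "d = inner y x - r x"
    \<comment> \<open>This t minimises J (y + t x) - J y = 2 t d + t^2 |x|^2. The minimum is
      -d^2/|x|^2, which minimality of y allows only for d = 0.\<close>
    define t where "t = - d / (norm x)\<^sup>2"
    have n: "(norm x)\<^sup>2 > 0" using False by simp
    have "J y \<le> J (y + t *\<^sub>R x)" using Jy mle order_trans by blast
    moreover have "(norm (y + t *\<^sub>R x))\<^sup>2 = (norm y)\<^sup>2 + 2 * t * inner y x + t\<^sup>2 * (norm x)\<^sup>2"
      unfolding power2_norm_eq_inner inner_add_left inner_add_right inner_scaleR_left inner_scaleR_right
      by (simp add: inner_commute[of x y] power2_eq_square algebra_simps)
    ultimately have "0 \<le> 2 * t * d + t\<^sup>2 * (norm x)\<^sup>2"
      by (simp add: J_def d_def r.scaleR r.add algebra_simps)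
    also have "2 * t * d + t\<^sup>2 * (norm x)\<^sup>2 = - d\<^sup>2 / (norm x)\<^sup>2"
      using n by (simp add: t_def power2_eq_square field_simps)
    finally have "d\<^sup>2 \<le> 0" using n by (simp add: divide_simps)
    then show ?thesis by (simp add: d_def)
  qed (simp add: r.zero)
  then show ?thesis by (rule that)
qed

text \<open>\<open>real_riesz\<close> represents the real part; complex linearity then yields the
  imaginary part at x as the real part at -i x.\<close>

lemma riesz:
  fixes f :: "'h::complex_hilbert_space \<Rightarrow> complex"
  assumes add: "\<And>x y. f (x + y) = f x + f y" and sc: "\<And>c x. f (c *\<^sub>C x) = c * f x"
    and bd: "\<And>x. cmod (f x) \<le> K * norm x" and K0: "0 \<le> K"
  obtains y where "\<And>x. f x = cinner y x" "norm y \<le> K"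
proof -
  have "bounded_linear (\<lambda>x. Re (f x))"
  proof (rule bounded_linear_intro[of _ K])
    show "Re (f (r *\<^sub>R x)) = r *\<^sub>R Re (f x)" for r x
      using sc[of "complex_of_real r" x] by (simp add: scaleC_of_real)
    show "norm (Re (f x)) \<le> norm x * K" for x
      using bd[of x] abs_Re_le_cmod[of "f x"] by (simp add: mult.commute)
  qed (simp add: add)
  then obtain y where y: "\<And>x. Re (f x) = inner y x" by (rule real_riesz) blast
  have eq: "f x = cinner y x" for x
  proof (rule complex_eqI)
    show "Re (f x) = Re (cinner y x)" by (simp add: y Re_cinner)
    have "Re (f ((- \<i>) *\<^sub>C x)) = Re (cinner y ((- \<i>) *\<^sub>C x))" by (simp add: y Re_cinner)
    then show "Im (f x) = Im (cinner y x)" by (simp add: sc cinner_scaleC_right)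
  qed
  have "norm y \<le> K"
  proof (cases "y = 0")
    case True
    then show ?thesis using K0 by simp
  next
    case False
    have "(norm y)\<^sup>2 \<le> K * norm y" using bd[of y] by (simp add: eq cinner_self norm_power)
    then show ?thesis using False by (simp add: power2_eq_square)
  qed
  with eq show ?thesis by (rule that)
qed

definition sesquilinear :: "real \<Rightarrow> ('h::complex_hilbert_space \<Rightarrow> 'h \<Rightarrow> complex) \<Rightarrow> bool" where
  "sesquilinear K B \<longleftrightarrow> 0 \<le> K \<and>
    (\<forall>x y z. B (x + y) z = B x z + B y z) \<and> (\<forall>x y z. B x (y + z) = B x y + B x z) \<and>
    (\<forall>c x y. B (c *\<^sub>C x) y = cnj c * B x y) \<and> (\<forall>c x y. B x (c *\<^sub>C y) = c * B x y) \<and>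
    (\<forall>x y. cmod (B x y) \<le> K * norm x * norm y)"

lemma bounded_opI:
  assumes "\<And>x y. A (x + y) = A x + A y" "\<And>c x. A (c *\<^sub>C x) = c *\<^sub>C A x" "\<And>x. norm (A x) \<le> K * norm x"
  shows "bounded_op A"
proof -
  have sR: "A (r *\<^sub>R x) = r *\<^sub>R A x" for r x
    using assms(2)[of "complex_of_real r" x] by (simp add: scaleC_of_real)
  have "bounded_linear A"
    using assms sR by (intro bounded_linear_intro[of _ K]) (auto simp: mult.commute)
  then show ?thesis
    using assms by (auto simp: bounded_op_def clinear_map_def bounded_linear.linear)
qed

lemma sesquilinear_operator:
  assumes B: "sesquilinear K B"
  obtains A where "bounded_op A" "\<And>x. norm (A x) \<le> K * norm x" "\<And>x y. cinner x (A y) = B x y"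
proof -
  note * = B[unfolded sesquilinear_def]
  have "\<exists>a. (\<forall>x. cinner x a = B x y) \<and> norm a \<le> K * norm y" for y
  proof -
    obtain a where a: "\<And>x. cnj (B x y) = cinner a x" "norm a \<le> K * norm y"
      by (rule riesz[of "\<lambda>x. cnj (B x y)" "K * norm y"]) (use * in \<open>auto simp: mult_ac\<close>)
    have "cinner x a = B x y" for x using a(1)[of x] by (subst cinner_commute) (metis complex_cnj_cnj)
    with a(2) show ?thesis by blast
  qed
  then obtain A where A: "\<And>x y. cinner x (A y) = B x y" "\<And>y. norm (A y) \<le> K * norm y" by metis
  have "bounded_op A"
    by (rule bounded_opI[OF _ _ A(2)]; rule cinner_ext)
      (use * in \<open>simp_all add: A cinner_add_right cinner_scaleC_right\<close>)
  with A show ?thesis by (intro that) auto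
qed

lemma bounded_op_simps:
  assumes "bounded_op A"
  shows "A (x + y) = A x + A y" "A (c *\<^sub>C x) = c *\<^sub>C A x" "A 0 = 0" "A (- x) = - A x"
    "A (x - y) = A x - A y" "A (r *\<^sub>R x) = r *\<^sub>R A x" "A (sum f I) = (\<Sum>i\<in>I. A (f i))"
  using assms bounded_linear.linear[of A]
  by (auto simp: bounded_op_def clinear_map_def linear_add linear_0 linear_neg linear_diff linear_scale linear_sum)

lemma bounded_op_bound:
  assumes "bounded_op A"
  obtains K where "K > 0" "\<And>x. norm (A x) \<le> K * norm x"
  using assms bounded_linear.pos_bounded[of A] by (auto simp: bounded_op_def mult.commute)

section \<open>Orthonormal sets and bases\<close>

definition orthonormal :: "'h::complex_hilbert_space set \<Rightarrow> bool" where
  "orthonormal E \<longleftrightarrow> (\<forall>d\<in>E. \<forall>e\<in>E. cinner d e = (if d = e then 1 else 0))"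

lemma bessel:
  assumes F: "finite F" "orthonormal F"
  shows "(\<Sum>e\<in>F. (cmod (cinner e z))\<^sup>2) \<le> (norm z)\<^sup>2"
proof -
  define s where "s = (\<Sum>e\<in>F. cinner e z *\<^sub>C e)"
  have es: "cinner e s = cinner e z" if "e \<in> F" for e
  proof -
    have "cinner e s = (\<Sum>d\<in>F. if d = e then cinner d z else 0)"
      unfolding s_def cinner.sum_right using F(2) that
      by (intro sum.cong) (auto simp: orthonormal_def cinner_scaleC_right)
    then show ?thesis using F(1) that by simp
  qed
  have sw: "cinner s w = (\<Sum>e\<in>F. cnj (cinner e z) * cinner e w)" for w
    unfolding s_def cinner.sum_left by (simp add: cinner_scaleC_left)
  have ss: "cinner s s = cinner s z" unfolding sw using es by (intro sum.cong) auto
  have sz: "cinner s z = complex_of_real (\<Sum>e\<in>F. (cmod (cinner e z))\<^sup>2)"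
    unfolding sw of_real_sum
    by (intro sum.cong refl) (metis complex_norm_square mult.commute)
  have "cinner z s = cinner s z" by (subst cinner_commute) (simp add: sz)
  then have "cinner (z - s) (z - s) = cinner z z - cinner s z"
    by (simp add: cinner.diff_left cinner.diff_right ss)
  then have "complex_of_real ((norm (z - s))\<^sup>2) = complex_of_real ((norm z)\<^sup>2 - (\<Sum>e\<in>F. (cmod (cinner e z))\<^sup>2))"
    by (simp only: cinner_self sz of_real_diff)
  then have "(norm (z - s))\<^sup>2 = (norm z)\<^sup>2 - (\<Sum>e\<in>F. (cmod (cinner e z))\<^sup>2)"
    by (simp only: of_real_eq_iff)
  then show ?thesis using zero_le_power2[of "norm (z - s)"] by simp
qed

text \<open>Zorn's lemma: a nonzero vector orthogonal to a maximal orthonormal set could be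
  normalised and adjoined.\<close>

lemma hilbert_basis_exists: "\<exists>E::'h::complex_hilbert_space set. hilbert_basis E"
proof -
  have "\<exists>M\<in>Collect orthonormal. \<forall>X\<in>Collect orthonormal. M \<subseteq> X \<longrightarrow> X = (M::'h set)"
  proof (rule subset_Zorn_nonempty)
    show "Collect orthonormal \<noteq> ({} :: 'h set set)" by (auto intro!: exI[of _ "{}"] simp: orthonormal_def)
    fix C :: "'h set set" assume C: "C \<noteq> {}" "subset.chain (Collect orthonormal) C"
    show "\<Union>C \<in> Collect orthonormal"
      unfolding mem_Collect_eq orthonormal_def
    proof safe
      fix d e D E assume "d \<in> D" "D \<in> C" "e \<in> E" "E \<in> C"
      with C(2) have "(D \<subseteq> E \<or> E \<subseteq> D) \<and> orthonormal D \<and> orthonormal E"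
        by (auto simp: subset.chain_def)
      then show "cinner d e = (if d = e then 1 else 0)"
        using \<open>d \<in> D\<close> \<open>e \<in> E\<close> unfolding orthonormal_def by blast
    qed
  qed
  then obtain M :: "'h set" where M: "orthonormal M" "\<And>X. orthonormal X \<Longrightarrow> M \<subseteq> X \<Longrightarrow> X = M" by auto
  have "x = 0" if x: "\<And>e. e \<in> M \<Longrightarrow> cinner e x = 0" for x
  proof (rule ccontr)
    assume nz: "x \<noteq> 0"
    define u where "u = (1 / norm x) *\<^sub>R x"
    have u: "cinner u u = 1" using nz by (simp add: u_def cinner_self)
    have eu: "cinner e u = 0" "cinner u e = 0" if "e \<in> M" for e
    proof -
      show "cinner e u = 0" using x[OF that] by (simp add: u_def cinner_scaleR_right)
      then show "cinner u e = 0" by (subst cinner_commute) simp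
    qed
    have "orthonormal (insert u M)"
      using M(1) u eu unfolding orthonormal_def by auto
    then have "u \<in> M" using M(2)[of "insert u M"] by auto
    with eu(1)[of u] u show False by simp
  qed
  with M(1) have "hilbert_basis M" unfolding hilbert_basis_def orthonormal_def by blast
  then show ?thesis by blast
qed

section \<open>The absolute value of a contraction\<close>

text \<open>For X = 1 - |A| the equation |A|^2 = A^*A becomes X = (C + X^2)/2 with C = 1 - A^*A, a
  fixed point equation solved by iteration from 0. The iterates are symmetric contractions, and both
  properties pass to the strong limit.\<close>

lemma contraction_sqrt:
  fixes A :: "'h::complex_hilbert_space \<Rightarrow> 'h"
  assumes A: "bounded_op A" and A1: "\<And>x. norm (A x) \<le> norm x"
  obtains X where "bounded_op X" "\<And>x. norm (X x) \<le> norm x" "\<And>x y. cinner (X x) y = cinner x (X y)"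
    "\<And>x y. cinner (x - X x) (y - X y) = cinner (A x) (A y)"
proof -
  have "sesquilinear 1 (\<lambda>x y. cinner (A x) (A y))"
    unfolding sesquilinear_def
    by (auto simp: bounded_op_simps[OF A] cinner_add_left cinner_add_right cinner_scaleC_left cinner_scaleC_right
        intro!: order_trans[OF cmod_cinner_le] mult_mono A1)
  then obtain B where B: "bounded_op B" "\<And>x. norm (B x) \<le> 1 * norm x" "\<And>x y. cinner x (B y) = cinner (A x) (A y)"
    by (rule sesquilinear_operator) blast
  define C where "C x = x - B x" for x
  have BA: "norm (B x) \<le> norm (A x)" for x
  proof (cases "B x = 0")
    case False
    have "(norm (B x))\<^sup>2 = cmod (cinner (A (B x)) (A x))"
      by (simp add: B(3)[symmetric] cinner_self norm_power)
    also have "\<dots> \<le> norm (A (B x)) * norm (A x)" by (rule cmod_cinner_le)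
    also have "\<dots> \<le> norm (B x) * norm (A x)" by (intro mult_right_mono A1) auto
    finally show ?thesis using False by (simp add: power2_eq_square)
  qed simp
  \<comment> \<open>Expanding gives |C x|^2 = |x|^2 - 2 |A x|^2 + |B x|^2, and \<open>BA\<close>
    lets the last term be absorbed by the middle one.\<close>
  have C1: "norm (C x) \<le> norm x" for x
  proof -
    have "cinner (B x) x = cinner (A x) (A x)"
      by (subst cinner_commute) (simp add: B(3) cinner_self)
    moreover have "cinner (C x) (C x) = cinner x x - cinner x (B x) - (cinner (B x) x - cinner (B x) (B x))"
      by (simp only: C_def cinner.diff_left cinner.diff_right) simp
    moreover have "cinner x (B x) = cinner (A x) (A x)" by (rule B(3))
    ultimately have "cinner (C x) (C x) = cinner x x - 2 * cinner (A x) (A x) + cinner (B x) (B x)"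
      by simp
    then have "complex_of_real ((norm (C x))\<^sup>2) = complex_of_real ((norm x)\<^sup>2 - 2 * (norm (A x))\<^sup>2 + (norm (B x))\<^sup>2)"
      by (simp add: cinner_self)
    then have "(norm (C x))\<^sup>2 = (norm x)\<^sup>2 - 2 * (norm (A x))\<^sup>2 + (norm (B x))\<^sup>2"
      by (simp only: of_real_eq_iff)
    also have "(norm (B x))\<^sup>2 \<le> (norm (A x))\<^sup>2" using BA by (intro power_mono) auto
    finally have "(norm (C x))\<^sup>2 \<le> (norm x)\<^sup>2" using zero_le_power2[of "norm (A x)"] by linarith
    then show ?thesis by (rule power2_le_imp_le) simp
  qed
  have Cadd: "C (x + y) = C x + C y" and Csc: "C (c *\<^sub>C x) = c *\<^sub>C C x" for x y c
    by (simp_all add: C_def bounded_op_simps[OF B(1)] scaleC_simps)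
  have Csym: "cinner (C x) y = cinner x (C y)" for x y
  proof -
    have "cinner (B x) y = cinner x (B y)"
      by (subst cinner_commute) (simp add: B(3) cinner_commute[of "A y"])
    then show ?thesis by (simp add: C_def cinner.diff_left cinner.diff_right)
  qed
  define X where "X = rec_nat (\<lambda>x. 0) (\<lambda>_ Y x. (1/2) *\<^sub>R (C x + Y (Y x)))"
  have X0: "X 0 x = 0" and XS: "X (Suc n) x = (1/2) *\<^sub>R (C x + X n (X n x))" for n x
    by (simp_all add: X_def)
  \<comment> \<open>The same iteration for numbers with C replaced by 1. It increases and is bounded
    by 1, and it majorises both the norms of the iterates and their increments, so its convergence
    carries over to the operators.\<close>
  define t where "t = rec_nat (0::real) (\<lambda>_ s. (1 + s\<^sup>2) / 2)"
  have t0: "t 0 = 0" and tS: "t (Suc n) = (1 + (t n)\<^sup>2) / 2" for n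
    by (simp_all add: t_def)
  have t01: "0 \<le> t n \<and> t n \<le> 1" for n
    by (induction n) (auto simp: t0 tS power_le_one)
  have tmono: "t n \<le> t (Suc n)" for n
    using zero_le_power2[of "t n - 1"] by (simp add: tS power2_eq_square algebra_simps)
  have Xadd: "X n (x + y) = X n x + X n y" and Xsc: "X n (c *\<^sub>C x) = c *\<^sub>C X n x" for n x y c
    by (induction n arbitrary: x y) (simp_all add: X0 XS Cadd Csc scaleC_simps scaleC_add_right algebra_simps)
  have XscR: "X n (r *\<^sub>R x) = r *\<^sub>R X n x" for n r x
    using Xsc[of n "complex_of_real r" x] by (simp add: scaleC_of_real)
  have Xdiff: "X n (x - y) = X n x - X n y" for n x y
    using Xadd[of n x "(-1) *\<^sub>R y"] XscR[of n "-1" y] by simp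
  have Xsym: "cinner (X n x) y = cinner x (X n y)" for n x y
    by (induction n arbitrary: x y)
      (simp_all add: X0 XS cinner.zero_left cinner.zero_right cinner_scaleR_left cinner_scaleR_right cinner_add_left cinner_add_right Csym)
  have Xnorm: "norm (X n x) \<le> t n * norm x" for n x
  proof (induction n arbitrary: x)
    case (Suc n)
    have "norm (X n (X n x)) \<le> t n * (t n * norm x)"
      by (rule order_trans[OF Suc]) (intro mult_left_mono Suc, use t01 in simp)
    then have "norm (C x + X n (X n x)) \<le> norm x + t n * (t n * norm x)"
      by (intro order_trans[OF norm_triangle_ineq] add_mono C1)
    moreover have "norm (X (Suc n) x) = (1/2) * norm (C x + X n (X n x))"
      unfolding XS norm_scaleR by simp
    moreover have "t (Suc n) * norm x = (1/2) * (norm x + t n * (t n * norm x))"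
      by (simp add: tS power2_eq_square distrib_right)
    ultimately show ?case by simp
  qed (simp add: X0 t0)
  have Xstep: "norm (X (Suc n) x - X n x) \<le> (t (Suc n) - t n) * norm x" for n x
  proof (induction n arbitrary: x)
    case 0
    show ?case using C1[of x] by (simp add: X0 XS t0 tS)
  next
    case (Suc n)
    let ?D = "\<lambda>x. X (Suc n) x - X n x" and ?d = "t (Suc n) - t n"
    have d0: "0 \<le> ?d" using tmono[of n] by simp
    \<comment> \<open>With D the difference of the iterates X' = \<open>X (Suc n)\<close> and X =
      \<open>X n\<close>, this is X'X' - XX = X'D + DX, valid without commuting the iterates. The
      scalar increments obey the same identity.\<close>
    have "X (Suc (Suc n)) x - X (Suc n) x = (1/2) *\<^sub>R (X (Suc n) (?D x) + ?D (X n x))"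
      by (simp only: XS[of "Suc n"] XS[of n x] Xdiff) (simp add: XS[of n x, symmetric] Xdiff algebra_simps)
    also have "norm \<dots> \<le> (1/2) * (t (Suc n) * (?d * norm x) + ?d * (t n * norm x))"
    proof -
      have "norm (X (Suc n) (?D x)) \<le> t (Suc n) * (?d * norm x)"
        by (rule order_trans[OF Xnorm]) (intro mult_left_mono Suc.IH, use t01 in auto)
      moreover have "norm (?D (X n x)) \<le> ?d * (t n * norm x)"
        by (rule order_trans[OF Suc.IH]) (intro mult_left_mono Xnorm d0)
      ultimately show ?thesis by (simp del: XS) (meson add_mono norm_triangle_le)
    qed
    also have "\<dots> = (t (Suc (Suc n)) - t (Suc n)) * norm x"
      by (simp add: tS[of "Suc n"] power2_eq_square algebra_simps) (simp add: tS[of n] power2_eq_square algebra_simps)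
    finally show ?case .
  qed
  have Xdist: "norm (X (n + k) x - X n x) \<le> (t (n + k) - t n) * norm x" for n k x
  proof (induction k)
    case (Suc k)
    have "norm (X (n + Suc k) x - X n x) \<le> norm (X (Suc (n + k)) x - X (n + k) x) + norm (X (n + k) x - X n x)"
      using norm_triangle_ineq[of "X (Suc (n + k)) x - X (n + k) x" "X (n + k) x - X n x"] by simp
    also have "\<dots> \<le> (t (Suc (n + k)) - t (n + k)) * norm x + (t (n + k) - t n) * norm x"
      by (intro add_mono Xstep Suc)
    finally show ?case by (simp add: algebra_simps)
  qed simp
  have "incseq t" using tmono by (rule incseq_SucI)
  then have "convergent t"
    using t01 by (intro Bseq_mono_convergent BseqI'[of _ 1]) (auto simp: incseq_def)
  then have tC: "Cauchy t" by (rule convergent_Cauchy)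
  have "Cauchy (\<lambda>n. X n x)" for x
  proof (rule metric_CauchyI)
    fix e :: real assume e: "e > 0"
    define e' where "e' = e / (norm x + 1)"
    have e': "e' > 0" using e by (simp add: e'_def add_nonneg_pos)
    from metric_CauchyD[OF tC this] obtain M where M: "\<And>p q. p \<ge> M \<Longrightarrow> q \<ge> M \<Longrightarrow> dist (t p) (t q) < e'" by blast
    have main: "dist (X p x) (X q x) < e" if "p \<ge> M" "q \<ge> p" for p q
    proof -
      have "norm (X q x - X p x) \<le> (t q - t p) * norm x" using Xdist[of p "q - p" x] that by simp
      also have "\<dots> \<le> e' * norm x"
        using M[of q p] that by (intro mult_right_mono) (auto simp: dist_real_def)
      also have "\<dots> < e" using e unfolding e'_def by (simp add: divide_simps add_nonneg_pos) 
      finally show ?thesis by (simp add: dist_norm norm_minus_commute)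
    qed
    have "dist (X p x) (X q x) < e" if "p \<ge> M" "q \<ge> M" for p q
      using main[of p q] main[of q p] that by (cases "p \<le> q") (auto simp: dist_commute)
    then show "\<exists>M. \<forall>p\<ge>M. \<forall>q\<ge>M. dist (X p x) (X q x) < e" by blast
  qed
  then have Xlim: "(\<lambda>n. X n x) \<longlonglongrightarrow> lim (\<lambda>n. X n x)" for x
    by (simp only: Cauchy_convergent_iff convergent_LIMSEQ_iff)
  define Y where "Y x = lim (\<lambda>n. X n x)" for x
  have Y: "(\<lambda>n. X n x) \<longlonglongrightarrow> Y x" for x unfolding Y_def by (rule Xlim)
  have Xnorm1: "norm (X n x) \<le> norm x" for n x
    using mult_right_mono[of "t n" 1 "norm x"] t01[of n] by (intro order_trans[OF Xnorm]) simp
  have Yadd: "Y (x + y) = Y x + Y y" for x y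
    by (rule LIMSEQ_unique[OF Y]) (use tendsto_add[OF Y[of x] Y[of y]] in \<open>simp only: Xadd\<close>)
  have Ysc: "Y (c *\<^sub>C x) = c *\<^sub>C Y x" for c x
  proof (rule cinner_ext)
    fix z
    have "(\<lambda>n. cinner z (X n (c *\<^sub>C x))) \<longlonglongrightarrow> cinner z (Y (c *\<^sub>C x))"
      by (intro cinner.tendsto tendsto_const Y)
    moreover have "(\<lambda>n. cinner z (X n (c *\<^sub>C x))) \<longlonglongrightarrow> c * cinner z (Y x)"
      unfolding Xsc cinner_scaleC_right by (intro tendsto_mult cinner.tendsto tendsto_const Y)
    ultimately show "cinner z (Y (c *\<^sub>C x)) = cinner z (c *\<^sub>C Y x)"
      unfolding cinner_scaleC_right by (rule LIMSEQ_unique)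
  qed
  have Ynorm: "norm (Y x) \<le> norm x" for x
    by (rule LIMSEQ_le_const2[OF tendsto_norm[OF Y]]) (use Xnorm1 in auto)
  have Ysym: "cinner (Y x) y = cinner x (Y y)" for x y
  proof (rule LIMSEQ_unique)
    show "(\<lambda>n. cinner (X n x) y) \<longlonglongrightarrow> cinner (Y x) y" by (intro cinner.tendsto tendsto_const Y)
    show "(\<lambda>n. cinner (X n x) y) \<longlonglongrightarrow> cinner x (Y y)" unfolding Xsym by (intro cinner.tendsto tendsto_const Y)
  qed
  \<comment> \<open>Strong convergence passes to the square because the iterates are uniformly
    bounded by 1.\<close>
  have YY: "(\<lambda>n. X n (X n x)) \<longlonglongrightarrow> Y (Y x)" for x
  proof -
    have "(\<lambda>n. X n (X n x - Y x)) \<longlonglongrightarrow> 0"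
    proof (rule Lim_null_comparison)
      show "\<forall>\<^sub>F n in sequentially. norm (X n (X n x - Y x)) \<le> norm (X n x - Y x)"
        by (intro always_eventually allI Xnorm1)
      show "(\<lambda>n. norm (X n x - Y x)) \<longlonglongrightarrow> 0"
        using Y[of x] by (simp add: LIM_zero tendsto_norm_zero)
    qed
    from tendsto_add[OF this Y[of "Y x"]] show ?thesis by (simp add: Xdiff)
  qed
  have fix_eq: "Y x = (1/2) *\<^sub>R (C x + Y (Y x))" for x
  proof (rule LIMSEQ_unique)
    show "(\<lambda>n. X (Suc n) x) \<longlonglongrightarrow> Y x" by (rule LIMSEQ_Suc[OF Y])
    show "(\<lambda>n. X (Suc n) x) \<longlonglongrightarrow> (1/2) *\<^sub>R (C x + Y (Y x))"
      unfolding XS by (intro tendsto_intros YY)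
  qed
  have Bop: "bounded_op Y" using Yadd Ysc Ynorm by (intro bounded_opI[of _ 1]) auto
  show ?thesis
  proof (rule that[OF Bop Ynorm Ysym])
    fix x y
    have "2 *\<^sub>R Y y = C y + Y (Y y)" using arg_cong[OF fix_eq[of y], of "\<lambda>z. 2 *\<^sub>R z"] by simp
    then have "(y - Y y) - Y (y - Y y) = B y"
      by (simp add: bounded_op_simps[OF Bop] C_def scaleR_2 algebra_simps)
    then have "cinner x ((y - Y y) - Y (y - Y y)) = cinner (A x) (A y)" by (simp add: B(3))
    then show "cinner (x - Y x) (y - Y y) = cinner (A x) (A y)"
      by (simp add: cinner.diff_left cinner.diff_right Ysym bounded_op_simps[OF Bop])
  qed
qed

section \<open>A criterion for trace-class operators\<close>

text \<open>Up to conjugation, the products with z are the products of the vectors e with w = R^* z,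
  so Bessel's inequality for F applies to w.\<close>

lemma bessel_operator:
  fixes R :: "'h::complex_hilbert_space \<Rightarrow> 'h"
  assumes F: "finite F" "orthonormal F"
    and R: "bounded_op R" "\<And>x. norm (R x) \<le> K * norm x" and K: "K \<ge> 0"
  shows "(\<Sum>e\<in>F. (cmod (cinner (R e) z))\<^sup>2) \<le> (K * norm z)\<^sup>2"
proof -
  obtain w where w: "\<And>x. cinner z (R x) = cinner w x" "norm w \<le> K * norm z"
  proof (rule riesz[of "\<lambda>x. cinner z (R x)" "K * norm z"])
    show "cmod (cinner z (R x)) \<le> K * norm z * norm x" for x
      using order_trans[OF cmod_cinner_le mult_left_mono[OF R(2)[of x], of "norm z"]] by (simp add: mult_ac)
  qed (use K in \<open>auto simp: bounded_op_simps[OF R(1)] cinner_add_right cinner_scaleC_right\<close>)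
  have "cmod (cinner (R e) z) = cmod (cinner e w)" for e
    using w(1)[of e] cinner_commute[of "R e" z] cinner_commute[of e w] by simp
  then have "(\<Sum>e\<in>F. (cmod (cinner (R e) z))\<^sup>2) \<le> (norm w)\<^sup>2"
    using bessel[OF F, of w] by simp
  also have "\<dots> \<le> (K * norm z)\<^sup>2" using w(2) by (intro power_mono) auto
  finally show ?thesis .
qed

text \<open>With \<open>X = 1 - |A|\<close> and \<open>R\<^sub>n = A (1 + X + \<dots> + X\<^sup>n\<^sup>-\<^sup>1)\<close> one has
  \<open>\<langle>R\<^sub>n e, A e\<rangle> = \<langle>e, |A| e\<rangle> - \<langle>X\<^sup>n e, e\<rangle> + \<langle>X\<^sup>n\<^sup>+\<^sup>1 e, e\<rangle>\<close>, and averaging over \<open>n\<close> removes the error. So \<open>R\<^sub>n\<close>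
  replaces the partial isometry of the polar decomposition.\<close>

lemma trace_class_contractionI:
  fixes A :: "'h::complex_hilbert_space \<Rightarrow> 'h"
  assumes A: "bounded_op A" and A1: "\<And>x. norm (A x) \<le> norm x"
    and bnd: "\<And>F y. finite F \<Longrightarrow> orthonormal F \<Longrightarrow>
      (\<And>z. (\<Sum>e\<in>F. (cmod (cinner (y e) z))\<^sup>2) \<le> (2 * norm z)\<^sup>2) \<Longrightarrow>
      cmod (\<Sum>e\<in>F. cinner (y e) (A e)) \<le> K"
  shows "trace_class A"
proof -
  obtain X where X: "bounded_op X" "\<And>x. norm (X x) \<le> norm x" "\<And>x y. cinner (X x) y = cinner x (X y)"
    and P2: "\<And>x y. cinner (x - X x) (y - X y) = cinner (A x) (A y)"
    using contraction_sqrt[OF A A1] by metis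
  define P where "P x = x - X x" for x
  have Pop: "bounded_op P"
  proof (rule bounded_opI[of _ 2])
    show "norm (P x) \<le> 2 * norm x" for x
      using norm_triangle_ineq4[of x "X x"] X(2)[of x] by (simp add: P_def)
  qed (simp_all add: P_def bounded_op_simps[OF X(1)] scaleC_simps)
  have Xreal: "cinner x (X x) = complex_of_real (Re (cinner x (X x)))" for x
  proof -
    have "cnj (cinner x (X x)) = cinner x (X x)" using cinner_commute[of "X x" x] X(3)[of x x] by simp
    then show ?thesis by (metis Reals_cnj_iff of_real_Re)
  qed
  have XRe: "\<bar>Re (cinner x (X x))\<bar> \<le> (norm x)\<^sup>2" for x
    using abs_Re_le_cmod[of "cinner x (X x)"] cmod_cinner_le[of x "X x"] mult_left_mono[OF X(2)[of x], of "norm x"]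
    by (simp add: power2_eq_square)
  have xPx: "cinner x (P x) = complex_of_real ((norm x)\<^sup>2 - Re (cinner x (X x)))" for x
    using Xreal[of x] by (simp add: P_def cinner.diff_right cinner_self)
  have "positive_op P"
    unfolding positive_op_def using Pop XRe by (auto simp: xPx abs_le_iff)
  then have abs: "is_abs_op A P"
    unfolding is_abs_op_def using P2 by (simp add: P_def)
  define a where "a n e = Re (cinner ((X ^^ n) e) e)" for n e
  have Xn: "norm ((X ^^ n) x) \<le> norm x" for n x
    by (induction n) (auto intro: order_trans[OF X(2)])
  have Xnop: "(X ^^ n) (x + y) = (X ^^ n) x + (X ^^ n) y" "(X ^^ n) (c *\<^sub>C x) = c *\<^sub>C (X ^^ n) x" for n x y c
    by (induction n) (simp_all add: bounded_op_simps[OF X(1)])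
  define V where "V n x = (\<Sum>k<n. (X ^^ k) x)" for n x
  \<comment> \<open>Geometric sum: (1 - X)(1 + X + ... + X^(n-1)) = 1 - X^n.\<close>
  have PV: "P (V n x) = x - (X ^^ n) x" for n x
    by (induction n) (simp_all add: V_def bounded_op_simps[OF Pop] P_def[of "(X ^^ _) _"])
  have AP: "norm (A x) = norm (P x)" for x
  proof -
    have "complex_of_real ((norm (P x))\<^sup>2) = complex_of_real ((norm (A x))\<^sup>2)"
      using P2[of x x] by (simp only: cinner_self P_def)
    then have "(norm (P x))\<^sup>2 = (norm (A x))\<^sup>2" by (simp only: of_real_eq_iff)
    then show ?thesis by (simp add: power2_eq_iff_nonneg)
  qed
  \<comment> \<open>The constant 2 in the hypothesis \<open>bnd\<close> originates here: |A (V n x)|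
    = |P (V n x)| = |x - X^n x|, uniformly in n.\<close>
  have Rb: "norm (A (V n x)) \<le> 2 * norm x" for n x
    using norm_triangle_ineq4[of x "(X ^^ n) x"] Xn[of n x] by (simp add: AP PV)
  have Rop: "bounded_op (\<lambda>x. A (V n x))" for n
  proof (rule bounded_opI[OF _ _ Rb])
    have "V n (x + y) = V n x + V n y" for x y by (simp add: V_def Xnop sum.distrib)
    then show "A (V n (x + y)) = A (V n x) + A (V n y)" for x y by (simp add: bounded_op_simps[OF A])
    have "V n (c *\<^sub>C x) = c *\<^sub>C V n x" for c x
      by (induction n) (simp_all add: V_def Xnop scaleC_simps scaleC_add_right)
    then show "A (V n (c *\<^sub>C x)) = c *\<^sub>C A (V n x)" for c x by (simp add: bounded_op_simps[OF A])
  qed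
  have RA: "Re (cinner (A (V n e)) (A e)) = Re (cinner e (P e)) - (a n e - a (Suc n) e)" for n e
  proof -
    have "cinner (A (V n e)) (A e) = cinner (P (V n e)) (P e)" using P2 by (simp add: P_def)
    also have "\<dots> = cinner e (P e) - cinner ((X ^^ n) e) (P e)" by (simp add: PV cinner.diff_left)
    also have "cinner ((X ^^ n) e) (P e) = cinner ((X ^^ n) e) e - cinner ((X ^^ Suc n) e) e"
      by (simp add: P_def cinner.diff_right X(3))
    finally show ?thesis by (simp add: a_def)
  qed
  have tr: "(\<Sum>e\<in>F. Re (cinner e (P e))) \<le> K" if F: "finite F" "orthonormal F" for F
  proof -
    define S where "S = (\<Sum>e\<in>F. Re (cinner e (P e)))"
    have step: "S \<le> K + (\<Sum>e\<in>F. a n e - a (Suc n) e)" for n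
    proof -
      have "Re (\<Sum>e\<in>F. cinner (A (V n e)) (A e)) \<le> K"
        using complex_Re_le_cmod bnd[OF F bessel_operator[OF F Rop Rb]] by (meson order_trans zero_le_numeral)
      then show ?thesis by (simp add: S_def RA sum_subtractf)
    qed
    have a1: "\<bar>a n e\<bar> \<le> 1" if "e \<in> F" for n e
    proof -
      have "norm e = 1" using F(2) that cinner_self[of e] unfolding orthonormal_def
        by (metis norm_ge_zero of_real_eq_1_iff power2_eq_1_iff abs_of_nonneg abs_1 abs_minus)
      then show ?thesis
        using abs_Re_le_cmod[of "cinner ((X ^^ n) e) e"] cmod_cinner_le[of "(X ^^ n) e" e] Xn[of n e]
        by (simp add: a_def)
    qed
    \<comment> \<open>The errors a n e - a (n + 1) e telescope over n < N, leaving at most 2 for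
      each vector of F. Division by N removes this contribution, so the final bound does not depend
      on the size of F.\<close>
    have "real N * S \<le> real N * K + 2 * real (card F)" for N
    proof -
      have "real N * S = (\<Sum>n<N. S)" by simp
      also have "\<dots> \<le> (\<Sum>n<N. K + (\<Sum>e\<in>F. a n e - a (Suc n) e))" by (intro sum_mono step)
      also have "\<dots> = real N * K + (\<Sum>e\<in>F. \<Sum>n<N. a n e - a (Suc n) e)"
        by (simp add: sum.distrib sum.swap[of _ F])
      also have "(\<Sum>e\<in>F. \<Sum>n<N. a n e - a (Suc n) e) = (\<Sum>e\<in>F. a 0 e - a N e)"
        by (intro sum.cong refl sum_lessThan_telescope')
      also have "\<dots> \<le> (\<Sum>e\<in>F. 2)"
        using a1[of _ 0] a1[of _ N] by (intro sum_mono) (smt (verit))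
      finally show ?thesis by simp
    qed
    then have le: "S \<le> K + 2 * real (card F) / real (Suc N)" for N
      using \<open>\<And>N. real N * S \<le> real N * K + 2 * real (card F)\<close>[of "Suc N"]
      by (simp add: field_simps del: of_nat_Suc)
    have "(\<lambda>N. K + 2 * real (card F) / real (Suc N)) \<longlonglongrightarrow> K + 0"
      by (intro tendsto_add tendsto_const LIMSEQ_Suc[OF lim_const_over_n])
    then have "S \<le> K + 0" by (rule LIMSEQ_le_const) (use le in auto)
    then show ?thesis by (simp add: S_def)
  qed
  obtain E :: "'h set" where E: "hilbert_basis E" using hilbert_basis_exists by blast
  have "(\<lambda>e. Re (cinner e (P e))) summable_on E"
  proof (rule nonneg_bounded_partial_sums_imp_summable_on[where C=K])
    show "0 \<le> Re (cinner e (P e))" for e using \<open>positive_op P\<close> by (simp add: positive_op_def)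
    have "orthonormal F" if "F \<subseteq> E" for F proof -
      have "orthonormal E" using E unfolding hilbert_basis_def orthonormal_def by (rule conjunct1)
      then show ?thesis unfolding orthonormal_def using subsetD[OF that] by simp
    qed
    then show "\<forall>\<^sub>F F in finite_subsets_at_top E. (\<Sum>e\<in>F. Re (cinner e (P e))) \<le> K"
      using tr by (auto intro: eventually_finite_subsets_at_top_weakI)
  qed
  then show ?thesis unfolding trace_class_def using A abs E by blast
qed

text \<open>The absolute value scales by |c| and the basis is kept. This undoes the normalisation to
  a contraction and absorbs the constants of measures and Jacobians.\<close>

lemma trace_class_scale:
  fixes A :: "'h::complex_hilbert_space \<Rightarrow> 'h"
  assumes "trace_class A"
  shows "trace_class (\<lambda>x. c *\<^sub>C A x)"
proof -
  obtain P E where A: "bounded_op A" and P: "is_abs_op A P" and E: "hilbert_basis E"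
    and s: "(\<lambda>e. Re (cinner e (P e))) summable_on E"
    using assms unfolding trace_class_def by blast
  have opc: "bounded_op (\<lambda>x. d *\<^sub>C B x)" if B: "bounded_op B" for d and B :: "'h \<Rightarrow> 'h"
  proof -
    obtain K where K: "K > 0" "\<And>x. norm (B x) \<le> K * norm x" by (rule bounded_op_bound[OF B]) blast
    show ?thesis
    proof (rule bounded_opI[of _ "cmod d * K"])
      show "norm (d *\<^sub>C B x) \<le> cmod d * K * norm x" for x
        using mult_left_mono[OF K(2)[of x], of "cmod d"] by (simp add: norm_scaleC mult.assoc)
    qed (simp_all add: bounded_op_simps[OF B] scaleC_add_right scaleC_scaleC mult.commute)
  qed
  define Q where "Q x = complex_of_real (cmod c) *\<^sub>C P x" for x
  have Pp: "positive_op P" using P by (simp add: is_abs_op_def)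
  have "positive_op Q"
    using Pp opc[of P "complex_of_real (cmod c)"] unfolding positive_op_def Q_def by (simp add: cinner_scaleC_right)
  moreover have "cinner (Q x) (Q y) = cinner (c *\<^sub>C A x) (c *\<^sub>C A y)" for x y
    using P complex_norm_square[of c]
    by (simp add: Q_def is_abs_op_def cinner_scaleC_left cinner_scaleC_right power2_eq_square mult_ac) 
  ultimately have "is_abs_op (\<lambda>x. c *\<^sub>C A x) Q" unfolding is_abs_op_def by blast
  moreover have "(\<lambda>e. Re (cinner e (Q e))) summable_on E"
    using summable_on_cmult_right[OF s, of "cmod c"] by (simp add: Q_def cinner_scaleC_right)
  ultimately show ?thesis
    unfolding trace_class_def using opc[OF A] E by blast
qed

section \<open>Projective representations of a vector space\<close>

locale weyl_rep =
  fixes tau :: "'w::euclidean_space \<Rightarrow> 'w \<Rightarrow> real"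
    and W :: "'w \<Rightarrow> 'h::complex_hilbert_space \<Rightarrow> 'h"
  assumes tau_bilinear: "bilinear tau"
    and W_unitary: "\<And>x. unitary_op (W x)"
    and W_continuous: "\<And>\<phi>. continuous_on UNIV (\<lambda>x. W x \<phi>)"
    and W_mult: "\<And>x y \<phi>. W x (W y \<phi>) = cis (tau x y) *\<^sub>C W (x + y) \<phi>"
begin

text \<open>The commutation form: W x W y = cis (s x y) W y W x. In the application it is
  \<sigma>((T + T^sigma) x, y).\<close>

definition s :: "'w \<Rightarrow> 'w \<Rightarrow> real" where "s x y = tau x y - tau y x"

text \<open>The phase replaces the cocycle tau by s/2, its antisymmetric part. This makes U(-x) the
  adjoint of U(x) and hence integrals of U against real even functions symmetric.\<close>

definition U :: "'w \<Rightarrow> 'h \<Rightarrow> 'h" where "U x \<phi> = cis (tau x x / 2) *\<^sub>C W x \<phi>"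

sublocale tau: bounded_bilinear tau
  using tau_bilinear bilinear_conv_bounded_bilinear by blast

lemmas tau_simps = tau.add_left tau.add_right tau.diff_left tau.diff_right tau.minus_left tau.minus_right
  tau.scaleR_left tau.scaleR_right tau.zero_left tau.zero_right

lemma s_simps: "s (x + y) z = s x z + s y z" "s x (y + z) = s x y + s x z"
  "s (x - y) z = s x z - s y z" "s x (y - z) = s x y - s x z"
  "s (- x) y = - s x y" "s x (- y) = - s x y" "s (r *\<^sub>R x) y = r * s x y" "s x (r *\<^sub>R y) = r * s x y"
  "s x x = 0" "s 0 x = 0" "s x 0 = 0"
  by (simp_all add: s_def tau_simps algebra_simps)

lemma s_anti: "s x y = - s y x"
  by (simp add: s_def)

lemma s_continuous:
  "continuous_on A f \<Longrightarrow> continuous_on A g \<Longrightarrow> continuous_on A (\<lambda>x. s (f x) (g x))"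
  unfolding s_def by (intro continuous_intros tau.continuous_on)

lemma W_isometry: "cinner (W x \<phi>) (W x \<psi>) = cinner \<phi> \<psi>"
  using W_unitary by (simp add: unitary_op_def)

lemma W_norm: "norm (W x \<phi>) = norm \<phi>"
proof -
  have "complex_of_real ((norm (W x \<phi>))\<^sup>2) = complex_of_real ((norm \<phi>)\<^sup>2)"
    using W_isometry[of x \<phi> \<phi>] by (simp only: cinner_self)
  then have "(norm (W x \<phi>))\<^sup>2 = (norm \<phi>)\<^sup>2" by (simp only: of_real_eq_iff)
  then show ?thesis by (simp add: power2_eq_iff_nonneg)
qed

lemma W_op: "bounded_op (W x)"
  using W_unitary[of x] bounded_opI[of "W x" 1] 
  by (auto simp: unitary_op_def clinear_map_def linear_add W_norm)

lemmas W_simps = bounded_op_simps[OF W_op]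

lemma W_0: "W 0 \<phi> = \<phi>"
proof -
  \<comment> \<open>The relation at 0 makes the isometry \<open>W 0\<close> idempotent, and an
    isometric idempotent is the identity.\<close>
  have "W 0 (W 0 \<phi> - \<phi>) = 0" using W_mult[of 0 0 \<phi>] by (simp add: W_simps tau_simps scaleC_simps)
  then have "norm (W 0 \<phi> - \<phi>) = 0" using W_norm[of 0 "W 0 \<phi> - \<phi>"] by simp
  then show ?thesis by simp
qed

lemma W_inverse: "W x (cis (tau x x) *\<^sub>C W (- x) \<phi>) = \<phi>"
  by (simp add: W_simps W_mult tau_simps W_0 scaleC_scaleC scaleC_simps cis_mult)

lemma U_mult: "U x (U y \<phi>) = cis (s x y / 2) *\<^sub>C U (x + y) \<phi>"
proof -
  have "tau x x / 2 + tau y y / 2 + tau x y = s x y / 2 + tau (x + y) (x + y) / 2"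
    by (simp add: s_def tau_simps field_simps)
  then show ?thesis
    by (simp add: U_def W_simps W_mult scaleC_scaleC cis_mult add_ac)
qed

lemma U_0: "U 0 \<phi> = \<phi>"
  by (simp add: U_def tau_simps W_0 scaleC_simps)

lemma U_isometry: "cinner (U x \<phi>) (U x \<psi>) = cinner \<phi> \<psi>"
  by (simp add: U_def cinner_scaleC_left cinner_scaleC_right W_isometry cis_cnj cis_mult mult.assoc[symmetric])

lemma U_norm: "norm (U x \<phi>) = norm \<phi>"
  by (simp add: U_def norm_scaleC W_norm)

lemma U_op: "bounded_op (U x)"
  by (rule bounded_opI[of _ 1])
    (simp_all add: U_norm, simp_all add: U_def W_simps scaleC_add_right scaleC_scaleC mult.commute)

lemmas U_simps = bounded_op_simps[OF U_op]

lemma U_inverse: "U (- x) (U x \<phi>) = \<phi>"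
  by (simp add: U_mult s_simps U_0 scaleC_simps)

lemma U_adjoint: "cinner \<phi> (U x \<psi>) = cinner (U (- x) \<phi>) \<psi>"
  using U_isometry[of "- x" \<phi> "U x \<psi>"] by (simp add: U_inverse)

lemma W_coefficient_continuous: "continuous_on UNIV (\<lambda>x. cinner \<phi> (W x \<psi>))"
  by (intro cinner.continuous_on continuous_on_const W_continuous)

lemma U_coefficient_continuous: "continuous_on UNIV (\<lambda>x. cinner \<phi> (U x \<psi>))"
  unfolding U_def cinner_scaleC_right
  by (intro continuous_on_mult W_coefficient_continuous continuous_on_cis) (intro continuous_intros tau.continuous_on, simp)

lemma W_coefficient_le: "cmod (cinner \<phi> (W x \<psi>)) \<le> norm \<phi> * norm \<psi>"
  using cmod_cinner_le[of \<phi> "W x \<psi>"] by (simp add: W_norm)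

lemma U_coefficient_le: "cmod (cinner \<phi> (U x \<psi>)) \<le> norm \<phi> * norm \<psi>"
  using cmod_cinner_le[of \<phi> "U x \<psi>"] by (simp add: U_norm)

lemma U_coefficient_measurable[measurable]: "(\<lambda>x. cinner \<phi> (U x \<psi>)) \<in> borel_measurable borel"
  by (intro borel_measurable_continuous_onI U_coefficient_continuous)

lemma W_coefficient_measurable[measurable]: "(\<lambda>x. cinner \<phi> (W x \<psi>)) \<in> borel_measurable borel"
  by (intro borel_measurable_continuous_onI W_coefficient_continuous)

end

section \<open>Integrals of operator families against an integrable density\<close>

lemma integrable_mult_bounded:
  fixes f g :: "'a::euclidean_space \<Rightarrow> complex"
  assumes f: "integrable lborel f" and [measurable]: "g \<in> borel_measurable borel" and g: "\<And>x. norm (g x) \<le> C"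
  shows "integrable lborel (\<lambda>x. f x * g x)"
proof (rule Bochner_Integration.integrable_bound)
  show "integrable lborel (\<lambda>x. C * norm (f x))" using f by simp
  have [measurable]: "f \<in> borel_measurable borel" using f by auto
  show "(\<lambda>x. f x * g x) \<in> borel_measurable lborel" by measurable
  show "AE x in lborel. norm (f x * g x) \<le> norm (C * norm (f x))"
  proof (intro AE_I2)
    fix x
    have "norm (f x * g x) \<le> norm (f x) * C" unfolding norm_mult by (intro mult_left_mono g) simp
    also have "\<dots> \<le> norm (C * norm (f x))" by (simp add: mult.commute)
    finally show "norm (f x * g x) \<le> norm (C * norm (f x))" .
  qed
qed

lemma integral_mult_bounded_le:
  fixes f g :: "'a::euclidean_space \<Rightarrow> complex"
  assumes f: "integrable lborel f" and "g \<in> borel_measurable borel" and g: "\<And>x. norm (g x) \<le> C"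
  shows "norm (\<integral>x. f x * g x \<partial>lborel) \<le> C * (\<integral>x. norm (f x) \<partial>lborel)"
proof -
  have "norm (\<integral>x. f x * g x \<partial>lborel) \<le> (\<integral>x. norm (f x * g x) \<partial>lborel)" by (rule integral_norm_bound)
  also have "\<dots> \<le> (\<integral>x. C * norm (f x) \<partial>lborel)"
  proof (rule integral_mono)
    show "norm (f x * g x) \<le> C * norm (f x)" for x
      using mult_right_mono[OF g[of x], of "norm (f x)"] by (simp add: norm_mult mult.commute)
  qed (use f integrable_mult_bounded[OF assms] in auto)
  finally show ?thesis by simp
qed

lemma sesquilinear_integral:
  fixes V :: "'w::euclidean_space \<Rightarrow> 'h::complex_hilbert_space \<Rightarrow> 'h"
  assumes V: "\<And>x. bounded_op (V x)" "\<And>x \<psi>. norm (V x \<psi>) = norm \<psi>"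
    and meas: "\<And>\<phi> \<psi>. (\<lambda>x. cinner \<phi> (V x \<psi>)) \<in> borel_measurable borel"
    and f: "integrable lborel f"
  shows "sesquilinear (\<integral>x. norm (f x) \<partial>lborel) (\<lambda>\<phi> \<psi>. \<integral>x. f x * cinner \<phi> (V x \<psi>) \<partial>lborel)"
  unfolding sesquilinear_def
proof (intro conjI allI)
  fix x y z :: 'h and c :: complex
  have le: "cmod (cinner \<phi> (V x \<psi>)) \<le> norm \<phi> * norm \<psi>" for x \<phi> \<psi>
    using cmod_cinner_le[of \<phi> "V x \<psi>"] by (simp add: V)
  have i: "integrable lborel (\<lambda>x. f x * cinner \<phi> (V x \<psi>))" for \<phi> \<psi>
    by (rule integrable_mult_bounded[OF f meas le])
  show "0 \<le> (\<integral>x. norm (f x) \<partial>lborel)" by simp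
  show "(\<integral>t. f t * cinner (x + y) (V t z) \<partial>lborel)
      = (\<integral>t. f t * cinner x (V t z) \<partial>lborel) + (\<integral>t. f t * cinner y (V t z) \<partial>lborel)"
    by (subst Bochner_Integration.integral_add[OF i i, symmetric]) (simp add: cinner_add_left distrib_left)
  show "(\<integral>t. f t * cinner x (V t (y + z)) \<partial>lborel)
      = (\<integral>t. f t * cinner x (V t y) \<partial>lborel) + (\<integral>t. f t * cinner x (V t z) \<partial>lborel)"
    by (subst Bochner_Integration.integral_add[OF i i, symmetric])
      (simp add: bounded_op_simps[OF V(1)] cinner_add_right distrib_left)
  show "(\<integral>t. f t * cinner (c *\<^sub>C x) (V t y) \<partial>lborel) = cnj c * (\<integral>t. f t * cinner x (V t y) \<partial>lborel)"
    by (subst integral_mult_right_zero[symmetric]) (simp add: cinner_scaleC_left mult.left_commute)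
  show "(\<integral>t. f t * cinner x (V t (c *\<^sub>C y)) \<partial>lborel) = c * (\<integral>t. f t * cinner x (V t y) \<partial>lborel)"
    by (subst integral_mult_right_zero[symmetric])
      (simp add: bounded_op_simps[OF V(1)] cinner_scaleC_right mult.left_commute)
  show "cmod (\<integral>t. f t * cinner x (V t y) \<partial>lborel) \<le> (\<integral>x. norm (f x) \<partial>lborel) * norm x * norm y"
    using integral_mult_bounded_le[OF f meas le, of x y] by (simp only: mult_ac)
qed

text \<open>The domination has the form of a convolution: translation invariance makes the inner
  integral of v independent of the shift a x.\<close>

lemma integrable_pair_shear:
  fixes f :: "'a::euclidean_space \<Rightarrow> 'b::euclidean_space \<Rightarrow> 'c::{banach,second_countable_topology}"
  assumes u: "integrable lborel u" and v: "integrable lborel v"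
    and [measurable]: "(\<lambda>(x, y). f x y) \<in> borel_measurable (lborel \<Otimes>\<^sub>M lborel)"
    and le: "\<And>x y. norm (f x y) \<le> u x * v (y + a x)"
  shows "integrable (lborel \<Otimes>\<^sub>M lborel) (\<lambda>(x, y). f x y)"
proof -
  have va: "integrable lborel (\<lambda>y. u x * v (y + a x))" for x
    using v by (intro integrable_mult_right) (simp add: lborel_translate(1))
  have fi: "integrable lborel (f x)" for x
    by (rule Bochner_Integration.integrable_bound[OF va[of x]])
      (auto intro!: AE_I2 order_trans[OF le])
  show ?thesis
  proof (rule lborel_pair.Fubini_integrable)
    show "integrable lborel (\<lambda>x. \<integral>y. norm (case (x, y) of (x, y) \<Rightarrow> f x y) \<partial>lborel)"
    proof (rule Bochner_Integration.integrable_bound[OF integrable_mult_left[OF u, of "\<integral>y. v y \<partial>lborel"]])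
      show "AE x in lborel. norm (\<integral>y. norm (case (x, y) of (x, y) \<Rightarrow> f x y) \<partial>lborel) \<le> norm (u x * (\<integral>y. v y \<partial>lborel))"
      proof (intro AE_I2)
        fix x
        have "(\<integral>y. norm (f x y) \<partial>lborel) \<le> (\<integral>y. u x * v (y + a x) \<partial>lborel)"
          using fi va by (intro integral_mono) (auto intro: le)
        also have "\<dots> = u x * (\<integral>y. v y \<partial>lborel)" by (simp add: lborel_translate(2))
        finally show "norm (\<integral>y. norm (case (x, y) of (x, y) \<Rightarrow> f x y) \<partial>lborel) \<le> norm (u x * (\<integral>y. v y \<partial>lborel))"
          by simp
      qed
    qed measurable
  qed (use fi in auto)
qed

section \<open>The rank-one operator of the Gaussian\<close>

locale standard_weyl_rep = weyl_rep tau W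
  for tau :: "'w::euclidean_space \<Rightarrow> 'w \<Rightarrow> real" and W :: "'w \<Rightarrow> 'h::complex_hilbert_space \<Rightarrow> 'h" +
  fixes j :: "'w \<Rightarrow> 'w"
  assumes j_linear: "linear j" and j_norm: "\<And>x. norm (j x) = norm x"
    and s_eq: "\<And>x y. s x y = x \<bullet> j y"
    and irreducible: "irreducible_rep W"
begin

text \<open>The width is tied to the phase s/2 of \<open>U\<close> and to \<open>j\<close> being
  isometric: with the exponent 1/4 the twisted convolution in \<open>Q_sandwich\<close> reproduces
  the Gaussian.\<close>

definition h :: "'w \<Rightarrow> real" where "h x = exp (- (norm x)\<^sup>2 / 4)"

lemma h_integrable: "integrable lborel h" "integrable lborel (\<lambda>x. complex_of_real (h x))"
proof -
  show "integrable lborel h"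
    unfolding h_def using integrable_gaussian[of "1/4", where ?'a='w] by simp
  then show "integrable lborel (\<lambda>x. complex_of_real (h x))" by simp
qed

lemma h_measurable[measurable]: "h \<in> borel_measurable borel"
  unfolding h_def by measurable

lemma h_bounds: "0 < h x" "h x \<le> 1"
  by (auto simp: h_def)

lemma j_surj: obtains z where "j z = q"
proof -
  have "inj j" using j_norm by (subst linear_injective_0[OF j_linear]) (metis norm_eq_zero)
  then have "surj j" using linear_injective_imp_surjective[of j] j_linear by simp
  then show ?thesis using that by (metis surjD)
qed

text \<open>The integral of exp(-|x|^2/2), that is of the square of \<open>h\<close>; it is also the
  nonzero eigenvalue of \<open>Q\<close>.\<close>

definition gauss_const :: real where "gauss_const = sqrt (2 * pi) ^ DIM('w)"

lemma gauss_const_pos: "gauss_const > 0" by (simp add: gauss_const_def)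

lemma gaussian_operator:
  obtains Q where "bounded_op Q"
    "\<And>\<phi> \<psi>. cinner \<phi> (Q \<psi>) = (\<integral>x. complex_of_real (h x) * cinner \<phi> (U x \<psi>) \<partial>lborel)"
  by (rule sesquilinear_operator[OF sesquilinear_integral[OF U_op U_norm U_coefficient_measurable h_integrable(2)]])
    (rule that)

definition Q :: "'h \<Rightarrow> 'h" where
  "Q = (SOME Q. bounded_op Q \<and>
    (\<forall>\<phi> \<psi>. cinner \<phi> (Q \<psi>) = (\<integral>x. complex_of_real (h x) * cinner \<phi> (U x \<psi>) \<partial>lborel)))"

lemma Q_op: "bounded_op Q"
  and Q_eq: "cinner \<phi> (Q \<psi>) = (\<integral>x. complex_of_real (h x) * cinner \<phi> (U x \<psi>) \<partial>lborel)"
proof -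
  obtain Q0 where Q0: "bounded_op Q0"
    "\<And>\<phi> \<psi>. cinner \<phi> (Q0 \<psi>) = (\<integral>x. complex_of_real (h x) * cinner \<phi> (U x \<psi>) \<partial>lborel)"
    by (rule gaussian_operator) blast
  then have "\<exists>Q. bounded_op Q \<and> (\<forall>\<phi> \<psi>. cinner \<phi> (Q \<psi>) = (\<integral>x. complex_of_real (h x) * cinner \<phi> (U x \<psi>) \<partial>lborel))"
    by (intro exI[of _ Q0]) simp
  from someI_ex[OF this] have *: "bounded_op Q \<and> (\<forall>\<phi> \<psi>. cinner \<phi> (Q \<psi>) = (\<integral>x. complex_of_real (h x) * cinner \<phi> (U x \<psi>) \<partial>lborel))"
    unfolding Q_def .
  then show "bounded_op Q" by (rule conjunct1)
  show "cinner \<phi> (Q \<psi>) = (\<integral>x. complex_of_real (h x) * cinner \<phi> (U x \<psi>) \<partial>lborel)"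
    by (rule *[THEN conjunct2, rule_format])
qed

lemma Q_symmetric: "cinner (Q \<phi>) \<psi> = cinner \<phi> (Q \<psi>)"
proof -
  have "cinner (Q \<phi>) \<psi> = cnj (cinner \<psi> (Q \<phi>))" by (rule cinner_commute)
  also have "\<dots> = (\<integral>x. cnj (complex_of_real (h x) * cinner \<psi> (U x \<phi>)) \<partial>lborel)"
    unfolding Q_eq by (rule Bochner_Integration.integral_cnj[symmetric])
  also have "\<dots> = (\<integral>x. complex_of_real (h (- x)) * cinner \<phi> (U (- x) \<psi>) \<partial>lborel)"
  proof (rule Bochner_Integration.integral_cong[OF refl])
    fix x
    have "cnj (cinner \<psi> (U x \<phi>)) = cinner (U x \<phi>) \<psi>" by (rule cinner_commute[symmetric])
    also have "\<dots> = cinner \<phi> (U (- x) \<psi>)" using U_adjoint[of \<phi> "- x" \<psi>] by simp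
    finally show "cnj (complex_of_real (h x) * cinner \<psi> (U x \<phi>)) = complex_of_real (h (- x)) * cinner \<phi> (U (- x) \<psi>)"
      by (simp add: h_def)
  qed
  also have "\<dots> = (\<integral>x. complex_of_real (h x) * cinner \<phi> (U x \<psi>) \<partial>lborel)"
    by (rule lborel_reflect[of "\<lambda>x. complex_of_real (h x) * cinner \<phi> (U x \<psi>)"]) measurable
  finally show ?thesis by (simp add: Q_eq)
qed

text \<open>Conjugation by U(z) multiplies U(x) by the character cis (s z x). Since \<open>j\<close>
  is onto, every character of W arises, so integrals of U against \<open>h\<close> times a character
  are unitarily conjugate to \<open>Q\<close>.\<close>

lemma Q_conjugate:
  assumes "j z = - q"
  shows "cinner (U (- z) \<phi>) (Q (U (- z) \<psi>)) = (\<integral>x. complex_of_real (h x) * cis (x \<bullet> q) * cinner \<phi> (U x \<psi>) \<partial>lborel)"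
  unfolding Q_eq
proof (rule Bochner_Integration.integral_cong[OF refl])
  fix x
  have "s z x = x \<bullet> q" using s_anti[of z x] assms by (simp add: s_eq)
  then have "U z (U x (U (- z) \<psi>)) = cis (x \<bullet> q) *\<^sub>C U x \<psi>"
    using s_anti[of x z] by (simp add: U_mult U_simps s_simps scaleC_scaleC cis_mult)
  then show "complex_of_real (h x) * cinner (U (- z) \<phi>) (U x (U (- z) \<psi>))
      = complex_of_real (h x) * cis (x \<bullet> q) * cinner \<phi> (U x \<psi>)"
    using U_adjoint[of \<phi> z "U x (U (- z) \<psi>)"] by (simp add: cinner_scaleC_right)
qed

text \<open>The central computation of the Stone-von Neumann argument: Q U(z) Q is a multiple of Q.
  After collecting the coefficient of U(w), everything rests on the Gaussian integral
  \<open>inner2\<close>.\<close>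

lemma Q_sandwich:
  "cinner \<phi> (Q (U z (Q \<psi>))) = complex_of_real (gauss_const * h z) * cinner \<phi> (Q \<psi>)"
proof -
  define k where "k w = cinner \<phi> (U w \<psi>)" for w
  have [measurable]: "k \<in> borel_measurable borel" unfolding k_def by measurable
  have kb: "cmod (k w) \<le> norm \<phi> * norm \<psi>" for w unfolding k_def by (rule U_coefficient_le)
  have inner1: "cinner \<phi> (U x (U z (Q \<psi>)))
      = (\<integral>w. complex_of_real (h (w - x - z)) * cis (s x (z + w) / 2 + s z w / 2) * k w \<partial>lborel)" for x
  proof -
    have "cinner \<phi> (U x (U z (Q \<psi>))) = cinner (U (- z) (U (- x) \<phi>)) (Q \<psi>)"
      by (simp only: U_adjoint[of _ x] U_adjoint[of _ z])
    also have "\<dots> = (\<integral>y. complex_of_real (h y) * cinner (U (- z) (U (- x) \<phi>)) (U y \<psi>) \<partial>lborel)" by (rule Q_eq)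
    also have "\<dots> = (\<integral>w. complex_of_real (h (w + (- x - z))) * cinner (U (- z) (U (- x) \<phi>)) (U (w + (- x - z)) \<psi>) \<partial>lborel)"
      by (rule lborel_translate(2)[symmetric])
    also have "\<dots> = (\<integral>w. complex_of_real (h (w - x - z)) * cis (s x (z + w) / 2 + s z w / 2) * k w \<partial>lborel)"
    proof (rule Bochner_Integration.integral_cong[OF refl])
      fix w
      have ph: "s z (w + (- x - z)) / 2 + s x (z + (w + (- x - z))) / 2 = s x (z + w) / 2 + s z w / 2"
        using s_anti[of z x] by (simp add: s_simps field_simps)
      have "cinner (U (- z) (U (- x) \<phi>)) (U (w + (- x - z)) \<psi>) = cinner \<phi> (U x (U z (U (w + (- x - z)) \<psi>)))"
        by (simp only: U_adjoint[of _ x] U_adjoint[of _ z])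
      also have "U x (U z (U (w + (- x - z)) \<psi>)) = cis (s x (z + w) / 2 + s z w / 2) *\<^sub>C U w \<psi>"
        unfolding ph[symmetric] by (simp add: U_mult U_simps scaleC_scaleC cis_mult)
      finally show "complex_of_real (h (w + (- x - z))) * cinner (U (- z) (U (- x) \<phi>)) (U (w + (- x - z)) \<psi>)
          = complex_of_real (h (w - x - z)) * cis (s x (z + w) / 2 + s z w / 2) * k w"
        by (simp add: cinner_scaleC_right k_def algebra_simps)
    qed
    finally show ?thesis .
  qed
  have inner2: "(\<integral>x. complex_of_real (h x * h (w - x - z)) * cis (s x (z + w) / 2 + s z w / 2) \<partial>lborel)
      = complex_of_real (gauss_const * h z * h w)" for w
  proof -
    \<comment> \<open>The midpoint about which the product of the two Gaussians in x is symmetric;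
      after the shift the phase is linear in y and its constant part cancels.\<close>
    define m where "m = (1/2) *\<^sub>R (w - z)"
    have "(\<integral>x. complex_of_real (h x * h (w - x - z)) * cis (s x (z + w) / 2 + s z w / 2) \<partial>lborel)
        = (\<integral>y. complex_of_real (h (y + m) * h (w - (y + m) - z)) * cis (s (y + m) (z + w) / 2 + s z w / 2) \<partial>lborel)"
      by (rule lborel_translate(2)[symmetric])
    also have "\<dots> = (\<integral>y. complex_of_real (exp (- (norm m)\<^sup>2 / 2)) *
        (complex_of_real (exp (- (norm y)\<^sup>2 / 2)) * cis (y \<bullet> ((1/2) *\<^sub>R j (z + w)))) \<partial>lborel)"
    proof (rule Bochner_Integration.integral_cong[OF refl])
      fix y
      have wm: "w - (y + m) - z = m - y"
      proof -
        have "m + m = w - z" unfolding m_def scaleR_left_distrib[symmetric] by simp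
        moreover have "w - (y + m) - z = (w - z) - m - y" by simp
        ultimately show ?thesis by (metis add_diff_cancel_right')
      qed
      have "h (y + m) * h (m - y) = exp (- (norm m)\<^sup>2 / 2) * exp (- (norm y)\<^sup>2 / 2)"
      proof -
        have "(norm (y + m))\<^sup>2 + (norm (m - y))\<^sup>2 = 2 * (norm m)\<^sup>2 + 2 * (norm y)\<^sup>2"
          by (simp add: power2_norm_eq_inner inner_diff_left inner_diff_right inner_add_left inner_add_right inner_commute)
        then have "- (norm (y + m))\<^sup>2 / 4 + - (norm (m - y))\<^sup>2 / 4 = - (norm m)\<^sup>2 / 2 + - (norm y)\<^sup>2 / 2"
          by (simp add: field_simps)
        then show ?thesis unfolding h_def exp_add[symmetric] by simp
      qed
      moreover have "s (y + m) (z + w) / 2 + s z w / 2 = y \<bullet> ((1/2) *\<^sub>R j (z + w))"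
      proof -
        have "s m (z + w) = - s z w"
          using s_anti[of w z] by (simp add: m_def s_simps)
        then show ?thesis by (simp add: s_simps(1) s_eq[of y] diff_divide_distrib)
      qed
      ultimately show "complex_of_real (h (y + m) * h (w - (y + m) - z)) * cis (s (y + m) (z + w) / 2 + s z w / 2)
          = complex_of_real (exp (- (norm m)\<^sup>2 / 2)) *
            (complex_of_real (exp (- (norm y)\<^sup>2 / 2)) * cis (y \<bullet> ((1/2) *\<^sub>R j (z + w))))"
        unfolding wm by (simp only: mult.assoc[symmetric] of_real_mult[symmetric])
    qed
    also have "\<dots> = complex_of_real (exp (- (norm m)\<^sup>2 / 2)) *
        complex_of_real (sqrt (2 * pi) ^ DIM('w) * exp (- (norm ((1/2) *\<^sub>R j (z + w)))\<^sup>2 / 2))"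
      by (simp only: integral_mult_right_zero gaussian_euclidean(2))
    also have "\<dots> = complex_of_real (gauss_const * (exp (- (norm m)\<^sup>2 / 2) * exp (- (norm ((1/2) *\<^sub>R j (z + w)))\<^sup>2 / 2)))"
      by (simp only: gauss_const_def of_real_mult mult_ac)
    \<comment> \<open>The parallelogram law combines |w - z|^2/8 from the shift with |z + w|^2/8
      from the Fourier transform; \<open>j_norm\<close> is what makes the two match.\<close>
    also have "exp (- (norm m)\<^sup>2 / 2) * exp (- (norm ((1/2) *\<^sub>R j (z + w)))\<^sup>2 / 2) = h z * h w"
    proof -
      have "(norm (w - z))\<^sup>2 + (norm (z + w))\<^sup>2 = 2 * (norm z)\<^sup>2 + 2 * (norm w)\<^sup>2"
        by (simp add: power2_norm_eq_inner inner_diff_left inner_diff_right inner_add_left inner_add_right inner_commute)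
      then have "- (norm m)\<^sup>2 / 2 + - (norm ((1/2) *\<^sub>R j (z + w)))\<^sup>2 / 2 = - (norm z)\<^sup>2 / 4 + - (norm w)\<^sup>2 / 4"
      proof -
        have "(norm m)\<^sup>2 = (norm (w - z))\<^sup>2 / 4" "(norm ((1/2) *\<^sub>R j (z + w)))\<^sup>2 = (norm (z + w))\<^sup>2 / 4"
          unfolding m_def norm_scaleR j_norm by (simp_all add: power_mult_distrib power_divide)
        then show ?thesis using \<open>(norm (w - z))\<^sup>2 + (norm (z + w))\<^sup>2 = 2 * (norm z)\<^sup>2 + 2 * (norm w)\<^sup>2\<close>
          by (simp add: field_simps)
      qed
      then show ?thesis unfolding h_def exp_add[symmetric] by simp
    qed
    finally show ?thesis by (simp add: mult.assoc)
  qed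
  have "cinner \<phi> (Q (U z (Q \<psi>))) = (\<integral>x. (\<integral>w. complex_of_real (h x) *
      (complex_of_real (h (w - x - z)) * cis (s x (z + w) / 2 + s z w / 2) * k w) \<partial>lborel) \<partial>lborel)"
    unfolding Q_eq[of \<phi> "U z (Q \<psi>)"] inner1 by (simp only: integral_mult_right_zero)
  also have "\<dots> = (\<integral>w. (\<integral>x. complex_of_real (h x) *
      (complex_of_real (h (w - x - z)) * cis (s x (z + w) / 2 + s z w / 2) * k w) \<partial>lborel) \<partial>lborel)"
  proof (rule lborel_pair.Fubini_integral[symmetric], rule integrable_pair_shear)
    show "integrable lborel (\<lambda>x. (norm \<phi> * norm \<psi>) * h x)" "integrable lborel h"
      using h_integrable by auto
    show "norm (complex_of_real (h x) * (complex_of_real (h (w - x - z)) * cis (s x (z + w) / 2 + s z w / 2) * k w))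
        \<le> (norm \<phi> * norm \<psi>) * h x * h (w + (- x - z))" for x w
    proof -
      have "norm (complex_of_real (h x) * (complex_of_real (h (w - x - z)) * cis (s x (z + w) / 2 + s z w / 2) * k w))
          = (h x * h (w - x - z)) * cmod (k w)"
        using h_bounds(1)[of x] h_bounds(1)[of "w - x - z"] by (simp add: norm_mult)
      also have "\<dots> \<le> (h x * h (w - x - z)) * (norm \<phi> * norm \<psi>)"
        using h_bounds(1)[of x] h_bounds(1)[of "w - x - z"] by (intro mult_left_mono kb) simp
      moreover have "w + (- x - z) = w - x - z" by simp
      ultimately show ?thesis by (simp only: mult_ac)
    qed
    show "(\<lambda>(x, w). complex_of_real (h x) * (complex_of_real (h (w - x - z)) * cis (s x (z + w) / 2 + s z w / 2) * k w))
        \<in> borel_measurable (lborel \<Otimes>\<^sub>M lborel)"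
    proof -
      have kc: "continuous_on UNIV k" unfolding k_def by (rule U_coefficient_continuous)
      have "continuous_on UNIV (\<lambda>p. complex_of_real (h (fst p)) * (complex_of_real (h (snd p - fst p - z))
          * cis (s (fst p) (z + snd p) / 2 + s z (snd p) / 2) * k (snd p)))"
        unfolding h_def by (intro continuous_intros s_continuous continuous_on_compose2[OF kc]) auto
      then show ?thesis unfolding lborel_prod case_prod_beta
        by (simp add: borel_measurable_continuous_onI)
    qed
  qed
  also have "\<dots> = (\<integral>w. complex_of_real (gauss_const * h z) * (complex_of_real (h w) * k w) \<partial>lborel)"
  proof (rule Bochner_Integration.integral_cong[OF refl])
    fix w
    have "(\<integral>x. complex_of_real (h x) * (complex_of_real (h (w - x - z)) * cis (s x (z + w) / 2 + s z w / 2) * k w) \<partial>lborel)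
        = (\<integral>x. complex_of_real (h x * h (w - x - z)) * cis (s x (z + w) / 2 + s z w / 2) * k w \<partial>lborel)"
      by (simp only: of_real_mult mult.assoc)
    also have "\<dots> = complex_of_real (gauss_const * h z * h w) * k w"
      by (simp only: integral_mult_left_zero inner2)
    finally show "(\<integral>x. complex_of_real (h x) * (complex_of_real (h (w - x - z)) * cis (s x (z + w) / 2 + s z w / 2) * k w) \<partial>lborel)
        = complex_of_real (gauss_const * h z) * (complex_of_real (h w) * k w)"
      by (simp only: of_real_mult mult.assoc)
  qed
  also have "\<dots> = complex_of_real (gauss_const * h z) * cinner \<phi> (Q \<psi>)"
    by (simp only: integral_mult_right_zero k_def Q_eq)
  finally show ?thesis .
qed

text \<open>If \<open>Q\<close> vanished, so would its conjugates, which are the Fourier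
  coefficients of h(x) <\<phi>, U(x) \<psi>>. By inversion this function would vanish at 0, where
  its value is <\<phi>, \<psi>>, and the Hilbert space would be trivial.\<close>

lemma Q_nonzero: "\<exists>\<psi>. Q \<psi> \<noteq> 0"
proof (rule ccontr)
  assume "\<not> (\<exists>\<psi>. Q \<psi> \<noteq> 0)"
  then have Q0: "Q \<psi> = 0" for \<psi> by blast
  have "cinner \<phi> \<psi> = 0" for \<phi> \<psi> :: 'h
  proof -
    define f where "f x = complex_of_real (h x) * cinner \<phi> (U x \<psi>)" for x
    have "ft f q = 0" for q
    proof -
      obtain z where z: "j z = - (- q)" using j_surj[of q] by auto
      have "(\<integral>x. complex_of_real (h x) * cis (x \<bullet> (- q)) * cinner \<phi> (U x \<psi>) \<partial>lborel) = 0"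
        using Q_conjugate[OF z, of \<phi> \<psi>] by (simp add: Q0 cinner.zero_right)
      then show ?thesis by (simp add: ft_def f_def inner_commute mult_ac)
    qed
    then have ft0: "ft f = (\<lambda>q. 0)" by auto
    have "(\<integral>q. cis (q \<bullet> 0) * ft f q \<partial>lborel) = complex_of_real ((2 * pi) ^ DIM('w)) * f 0"
    proof (rule fourier_inversion)
      show "continuous_on UNIV f" unfolding f_def h_def
        by (intro continuous_intros U_coefficient_continuous) simp
      show "norm (f x) \<le> norm \<phi> * norm \<psi>" for x
        using mult_mono[OF h_bounds(2)[of x] U_coefficient_le[of \<phi> x \<psi>]] h_bounds(1)[of x]
        by (simp add: f_def norm_mult)
      show "integrable lborel f" unfolding f_def
        by (rule integrable_mult_bounded[OF h_integrable(2) _ U_coefficient_le]) measurable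
    qed (simp add: ft0)
    then have "f 0 = 0" by (simp add: ft0)
    then show ?thesis using h_bounds(1)[of 0] by (simp add: f_def U_0)
  qed
  then have "\<psi> = 0" for \<psi> :: 'h using cinner_self[of \<psi>] by simp
  then show False using irreducible by (auto simp: irreducible_rep_def)
qed

text \<open>\<open>Q_sandwich\<close> shows that \<open>Q\<close> maps the orbit of a vector \<psi>0
  in its range into the line of \<psi>0. Vectors whose orbit has this property form a closed
  invariant subspace, which irreducibility makes everything; symmetry of \<open>Q\<close> then
  determines the coefficient.\<close>

lemma Q_rank_one:
  obtains \<psi>0 where "norm \<psi>0 = 1" "\<And>\<psi>. Q \<psi> = (complex_of_real gauss_const * cinner \<psi>0 \<psi>) *\<^sub>C \<psi>0"
proof -
  obtain \<psi>1 where nz: "Q \<psi>1 \<noteq> 0" using Q_nonzero by blast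
  define \<psi>0 where "\<psi>0 = (1 / norm (Q \<psi>1)) *\<^sub>R Q \<psi>1"
  have n0: "norm \<psi>0 = 1" using nz by (simp add: \<psi>0_def)
  have QQ: "Q (U z (Q \<psi>)) = complex_of_real (gauss_const * h z) *\<^sub>C Q \<psi>" for z \<psi>
    by (rule cinner_ext) (simp only: Q_sandwich cinner_scaleC_right)
  have QU: "Q (U z \<psi>0) = complex_of_real (gauss_const * h z) *\<^sub>C \<psi>0" for z
    by (simp only: \<psi>0_def bounded_op_simps[OF Q_op] U_simps QQ scaleC_simps)
  have Qp0: "Q \<psi>0 = complex_of_real gauss_const *\<^sub>C \<psi>0"
    using QU[of 0] by (simp add: U_0 h_def)
  have c00: "cinner \<psi>0 \<psi>0 = 1" by (simp add: cinner_self n0)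
  \<comment> \<open>Being mapped into the line of \<psi>0 is stated as an equation between
    continuous maps of x, so that closedness is immediate.\<close>
  define N where "N = {x. \<forall>z. Q (U z x) = cinner \<psi>0 (Q (U z x)) *\<^sub>C \<psi>0}"
  have memN: "x \<in> N" if "\<And>z. Q (U z x) = c z *\<^sub>C \<psi>0" for x c
    unfolding N_def mem_Collect_eq that cinner_scaleC_right c00 by simp
  have NQ: "Q (U z x) = cinner \<psi>0 (Q (U z x)) *\<^sub>C \<psi>0" if "x \<in> N" for x z
    using that unfolding N_def by blast
  have contQU: "continuous_on UNIV (\<lambda>x. Q (U z x))" for z
    using Q_op U_op[of z] unfolding bounded_op_def
    by (intro linear_continuous_on bounded_linear_compose[of Q "U z"]) auto
  have contsc: "continuous_on UNIV (\<lambda>c. c *\<^sub>C \<psi>0)"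
    by (intro linear_continuous_on bounded_linear_intro[of _ "norm \<psi>0"])
      (auto simp: scaleC_add_left norm_scaleC scaleC_of_real[symmetric] scaleC_scaleC scaleR_conv_of_real)
  have "closed_csubspace N"
    unfolding closed_csubspace_def
  proof (intro conjI ballI allI)
    show sc: "c *\<^sub>C x \<in> N" if "x \<in> N" for c x
      by (rule memN[of _ "\<lambda>z. c * cinner \<psi>0 (Q (U z x))"])
        (simp only: U_simps bounded_op_simps[OF Q_op] scaleC_scaleC[symmetric] NQ[OF that, symmetric])
    have "0 \<in> N"
      by (rule memN[of _ "\<lambda>z. 0"]) (metis U_simps(3) bounded_op_simps(3)[OF Q_op] scaleC_of_real scaleR_zero_left of_real_0)
    moreover have "x + y \<in> N" if "x \<in> N" "y \<in> N" for x y
      by (rule memN[of _ "\<lambda>z. cinner \<psi>0 (Q (U z x)) + cinner \<psi>0 (Q (U z y))"])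
        (simp only: U_simps bounded_op_simps[OF Q_op] scaleC_add_left NQ[OF that(1), symmetric] NQ[OF that(2), symmetric])
    moreover have "r *\<^sub>R x \<in> N" if "x \<in> N" for r x
      using sc[OF that, of "complex_of_real r"] by (simp only: scaleC_of_real)
    ultimately show "subspace N" unfolding subspace_def by blast
    show "closed N"
      unfolding N_def
      by (intro closed_Collect_all closed_Collect_eq contQU continuous_on_compose2[OF contsc] cinner.continuous_on continuous_on_const) simp
  qed
  moreover have "W y ` N \<subseteq> N" for y
  proof
    fix x' assume "x' \<in> W y ` N"
    then obtain x where x: "x \<in> N" "x' = W y x" by blast
    have "U z (W y x) = (cis (- tau y y / 2) * cis (s z y / 2)) *\<^sub>C U (z + y) x" for z
    proof -
      have "W y x = cis (- tau y y / 2) *\<^sub>C U y x" by (simp add: U_def scaleC_scaleC cis_mult scaleC_simps)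
      then show ?thesis by (simp add: U_simps U_mult scaleC_scaleC)
    qed
    then have "Q (U z x') = ((cis (- tau y y / 2) * cis (s z y / 2)) * cinner \<psi>0 (Q (U (z + y) x))) *\<^sub>C \<psi>0" for z
      unfolding x(2) scaleC_scaleC[symmetric] NQ[OF x(1), symmetric] by (simp only: bounded_op_simps[OF Q_op] scaleC_scaleC)
    then show "x' \<in> N" by (rule memN)
  qed
  moreover have "\<psi>0 \<in> N"
    by (rule memN[OF QU])
  then have "N \<noteq> {0}" using n0 by auto
  ultimately have N: "N = UNIV"
    using irreducible unfolding irreducible_rep_def by blast
  have "Q \<psi> = (complex_of_real gauss_const * cinner \<psi>0 \<psi>) *\<^sub>C \<psi>0" for \<psi>
  proof -
    have "\<psi> \<in> N" using N by simp
    then have "Q (U 0 \<psi>) = cinner \<psi>0 (Q (U 0 \<psi>)) *\<^sub>C \<psi>0" by (rule NQ)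
    moreover have "cinner \<psi>0 (Q \<psi>) = complex_of_real gauss_const * cinner \<psi>0 \<psi>"
      using Q_symmetric[of \<psi>0 \<psi>] by (simp add: Qp0 cinner_scaleC_left)
    ultimately show ?thesis by (simp add: U_0)
  qed
  with n0 show ?thesis by (rule that)
qed

end

section \<open>Integrated operators of trace class\<close>

lemma smooth_translate:
  fixes b :: "'a::euclidean_space \<Rightarrow> complex"
  shows "smooth b \<Longrightarrow> smooth (\<lambda>x. b (x + p))"
  using smooth_affine[OF linear_ident, of UNIV b p] by (simp add: smooth_def)

lemma bounded_derivs_translate:
  fixes b :: "'a::euclidean_space \<Rightarrow> complex"
  assumes b: "b \<in> weighted (\<lambda>x. 1)"
  shows "(\<lambda>x. b (x + p)) \<in> weighted (\<lambda>x. 1)"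
proof -
  obtain C where C: "\<And>vs x. norm (iter_deriv vs b x) \<le> C vs * 1" by (rule weighted_bounds[OF b]) blast
  then have "norm (iter_deriv vs (\<lambda>x. b (x + p)) x) \<le> C vs * 1" for vs x
    by (simp add: iter_deriv_affine[OF linear_ident])
  then show ?thesis using b smooth_translate[of b p] unfolding weighted_def by blast
qed

lemma weighted_integrable:
  fixes b :: "'a::euclidean_space \<Rightarrow> complex"
  assumes b: "b \<in> weighted w" and w: "integrable lborel w"
  shows "integrable lborel b"
proof -
  obtain C where C: "\<And>vs x. norm (iter_deriv vs b x) \<le> C vs * w x" by (rule weighted_bounds[OF b]) blast
  have "continuous_on UNIV b" using smooth_continuous[of b "[]"] b by (simp add: weighted_def)
  then have [measurable]: "b \<in> borel_measurable borel" by (rule borel_measurable_continuous_onI)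
  show ?thesis
    by (rule Bochner_Integration.integrable_bound[OF integrable_mult_right[OF w, of "C []"]])
      (use C[of "[]"] in \<open>auto intro: order_trans[OF _ abs_ge_self]\<close>)
qed

context standard_weyl_rep
begin

text \<open>Expand u into characters by inversion. A character times \<open>h\<close> integrates to
  a conjugate of \<open>Q\<close>, which is rank one with range spanned by a unit vector U(z)
  \<psi>0, and Cauchy-Schwarz bounds its pairing with two Bessel families. Families indexed by I
  rather than orthonormal sets are used because they stay admissible under unitaries.\<close>

lemma wiener_bound:
  assumes u: "u \<in> schwartz" and I: "finite I" and K: "K \<ge> 0"
    and e: "\<And>z. (\<Sum>i\<in>I. (cmod (cinner (e i) z))\<^sup>2) \<le> (norm z)\<^sup>2"
    and y: "\<And>z. (\<Sum>i\<in>I. (cmod (cinner (y i) z))\<^sup>2) \<le> (K * norm z)\<^sup>2"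
  shows "cmod (\<integral>x. u x * (complex_of_real (h x) * (\<Sum>i\<in>I. cinner (y i) (U x (e i)))) \<partial>lborel)
    \<le> gauss_const * K / (2 * pi) ^ DIM('w) * (\<integral>q. cmod (ft u q) \<partial>lborel)"
proof -
  define k where "k x = (\<Sum>i\<in>I. cinner (y i) (U x (e i)))" for x
  define J where "J q = (\<integral>x. cis (q \<bullet> x) * (complex_of_real (h x) * k x) \<partial>lborel)" for q
  have [measurable]: "k \<in> borel_measurable borel" unfolding k_def by measurable
  have [measurable]: "u \<in> borel_measurable borel" by (rule schwartz_measurable[OF u])
  have [measurable]: "J \<in> borel_measurable borel" unfolding J_def by measurable
  have kb: "cmod (k x) \<le> (\<Sum>i\<in>I. norm (y i) * norm (e i))" for x
    unfolding k_def by (intro order_trans[OF norm_sum] sum_mono U_coefficient_le)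
  have hk: "integrable lborel (\<lambda>x. complex_of_real (h x) * k x)"
    by (rule integrable_mult_bounded[OF h_integrable(2) _ kb]) measurable
  obtain \<psi>0 where p0: "norm \<psi>0 = 1" "\<And>\<psi>. Q \<psi> = (complex_of_real gauss_const * cinner \<psi>0 \<psi>) *\<^sub>C \<psi>0"
    by (rule Q_rank_one) blast
  have J_le: "cmod (J q) \<le> gauss_const * K" for q
  proof -
    obtain z where z: "j z = - q" by (rule j_surj)
    have i: "integrable lborel (\<lambda>x. complex_of_real (h x) * cis (x \<bullet> q) * cinner (y i) (U x (e i)))" for i
    proof -
      have "integrable lborel (\<lambda>x. complex_of_real (h x) * (cis (x \<bullet> q) * cinner (y i) (U x (e i))))"
        by (rule integrable_mult_bounded[OF h_integrable(2), of _ "norm (y i) * norm (e i)"])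
          (auto simp: norm_mult U_coefficient_le)
      then show ?thesis by (simp add: mult.assoc)
    qed
    have "J q = (\<integral>x. (\<Sum>i\<in>I. complex_of_real (h x) * cis (x \<bullet> q) * cinner (y i) (U x (e i))) \<partial>lborel)"
      unfolding J_def k_def by (simp only: sum_distrib_left inner_commute[of q] mult_ac)
    also have "\<dots> = (\<Sum>i\<in>I. cinner (U (- z) (y i)) (Q (U (- z) (e i))))"
      unfolding Q_conjugate[OF z] by (rule Bochner_Integration.integral_sum) (rule i)
    also have "\<dots> = (\<Sum>i\<in>I. complex_of_real gauss_const * (cinner (U z \<psi>0) (e i) * cinner (y i) (U z \<psi>0)))"
    proof (rule sum.cong[OF refl])
      fix i
      have "cinner \<psi>0 (U (- z) (e i)) = cinner (U z \<psi>0) (e i)" using U_adjoint[of \<psi>0 "- z" "e i"] by simp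
      moreover have "cinner (U (- z) (y i)) \<psi>0 = cinner (y i) (U z \<psi>0)" using U_adjoint[of "y i" z \<psi>0] by simp
      ultimately show "cinner (U (- z) (y i)) (Q (U (- z) (e i)))
          = complex_of_real gauss_const * (cinner (U z \<psi>0) (e i) * cinner (y i) (U z \<psi>0))"
        by (simp add: p0(2) cinner_scaleC_right)
    qed
    also have "cmod \<dots> \<le> gauss_const * (\<Sum>i\<in>I. cmod (cinner (e i) (U z \<psi>0)) * cmod (cinner (y i) (U z \<psi>0)))"
    proof -
      have c: "cmod (cinner (U z \<psi>0) (e i)) = cmod (cinner (e i) (U z \<psi>0))" for i
        by (subst cinner_commute) simp
      have "cmod (\<Sum>i\<in>I. complex_of_real gauss_const * (cinner (U z \<psi>0) (e i) * cinner (y i) (U z \<psi>0)))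
          = gauss_const * cmod (\<Sum>i\<in>I. cinner (U z \<psi>0) (e i) * cinner (y i) (U z \<psi>0))"
        using gauss_const_pos by (simp add: sum_distrib_left[symmetric] norm_mult)
      also have "\<dots> \<le> gauss_const * (\<Sum>i\<in>I. cmod (cinner (U z \<psi>0) (e i) * cinner (y i) (U z \<psi>0)))"
        using gauss_const_pos by (intro mult_left_mono norm_sum) simp
      finally show ?thesis by (simp only: norm_mult c)
    qed
    also have "\<dots> \<le> gauss_const * K"
    proof (rule mult_left_mono)
      have "(\<Sum>i\<in>I. cmod (cinner (e i) (U z \<psi>0)) * cmod (cinner (y i) (U z \<psi>0)))\<^sup>2
          \<le> (\<Sum>i\<in>I. (cmod (cinner (e i) (U z \<psi>0)))\<^sup>2) * (\<Sum>i\<in>I. (cmod (cinner (y i) (U z \<psi>0)))\<^sup>2)"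
        by (rule Cauchy_Schwarz_ineq_sum)
      also have "\<dots> \<le> (norm (U z \<psi>0))\<^sup>2 * (K * norm (U z \<psi>0))\<^sup>2"
        by (intro mult_mono e y sum_nonneg) auto
      also have "\<dots> = K\<^sup>2" by (simp only: U_norm p0(1)) simp
      finally show "(\<Sum>i\<in>I. cmod (cinner (e i) (U z \<psi>0)) * cmod (cinner (y i) (U z \<psi>0))) \<le> K"
        by (rule power2_le_imp_le) (rule K)
    qed (use gauss_const_pos in simp)
    finally show ?thesis .
  qed
  have pw: "(0::real) < (2 * pi) ^ DIM('w)" by simp
  have "complex_of_real ((2 * pi) ^ DIM('w)) * (\<integral>x. u x * (complex_of_real (h x) * k x) \<partial>lborel)
      = (\<integral>x. (\<integral>q. (cis (q \<bullet> x) * ft u q) * (complex_of_real (h x) * k x) \<partial>lborel) \<partial>lborel)"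
  proof -
    have "(\<integral>q. (cis (q \<bullet> x) * ft u q) * (complex_of_real (h x) * k x) \<partial>lborel)
        = complex_of_real ((2 * pi) ^ DIM('w)) * (u x * (complex_of_real (h x) * k x))" for x
      unfolding integral_mult_left_zero schwartz_inversion[OF u] by (rule mult.assoc)
    then show ?thesis by (simp only: integral_mult_right_zero)
  qed
  also have "\<dots> = (\<integral>q. (\<integral>x. (cis (q \<bullet> x) * ft u q) * (complex_of_real (h x) * k x) \<partial>lborel) \<partial>lborel)"
  proof (rule lborel_pair.Fubini_integral, rule integrable_pair_bound)
    show "integrable lborel (\<lambda>q. cmod (ft u q))" "integrable lborel (\<lambda>x. cmod (complex_of_real (h x) * k x))"
      using ft_integrable[OF u] hk by (auto intro: integrable_norm)
  qed (auto simp: norm_mult)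
  also have "\<dots> = (\<integral>q. ft u q * J q \<partial>lborel)"
  proof (rule Bochner_Integration.integral_cong[OF refl])
    fix q
    have "(\<integral>x. (cis (q \<bullet> x) * ft u q) * (complex_of_real (h x) * k x) \<partial>lborel)
        = (\<integral>x. ft u q * (cis (q \<bullet> x) * (complex_of_real (h x) * k x)) \<partial>lborel)"
      by (simp only: mult_ac)
    then show "(\<integral>x. (cis (q \<bullet> x) * ft u q) * (complex_of_real (h x) * k x) \<partial>lborel) = ft u q * J q"
      by (simp only: J_def integral_mult_right_zero)
  qed
  finally have "cmod (complex_of_real ((2 * pi) ^ DIM('w)) * (\<integral>x. u x * (complex_of_real (h x) * k x) \<partial>lborel))
      = cmod (\<integral>q. ft u q * J q \<partial>lborel)" by (rule arg_cong)
  then have "(2 * pi) ^ DIM('w) * cmod (\<integral>x. u x * (complex_of_real (h x) * k x) \<partial>lborel)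
      = cmod (\<integral>q. ft u q * J q \<partial>lborel)"
    by (simp only: norm_mult norm_of_real abs_of_pos[OF pw])
  also have "\<dots> \<le> (gauss_const * K) * (\<integral>q. cmod (ft u q) \<partial>lborel)"
    by (rule integral_mult_bounded_le[OF ft_integrable[OF u] _ J_le]) measurable
  finally show ?thesis
    using pw unfolding k_def by (simp add: field_simps)
qed

text \<open>The splitting \<open>p = \<alpha> + (p - \<alpha>)\<close> is chosen so that all phases depending on \<open>x\<close> cancel. This is where
  nondegeneracy of the commutation form enters for a general \<open>tau\<close>.\<close>

lemma translation_splitting:
  obtains \<alpha> c where "cmod c = 1" "\<And>x \<phi>. W (x + p) \<phi> = c *\<^sub>C W \<alpha> (W x (W (p - \<alpha>) \<phi>))"
proof -
  \<comment> \<open>The vector \<alpha> is determined by s x \<alpha> = tau x p for all x, which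
    gives tau x (p - \<alpha>) = - tau \<alpha> x.\<close>
  have "linear (\<lambda>x. tau x p)" by (simp add: linear_iff tau_simps)
  then obtain u where u: "\<And>x. tau x p = x \<bullet> u" by (rule linear_functional_inner) blast
  obtain \<alpha> where \<alpha>: "j \<alpha> = u" by (rule j_surj)
  have W: "W (x + p) \<phi> = cis (- tau \<alpha> (p - \<alpha>)) *\<^sub>C W \<alpha> (W x (W (p - \<alpha>) \<phi>))" for x \<phi>
  proof -
    have "tau x p = tau x \<alpha> - tau \<alpha> x" using s_eq[of x \<alpha>] by (simp add: \<alpha> u s_def)
    then have "- tau \<alpha> (p - \<alpha>) + (tau x (p - \<alpha>) + tau \<alpha> (x + (p - \<alpha>))) = 0"
      by (simp add: tau_simps)
    moreover have "W \<alpha> (W x (W (p - \<alpha>) \<phi>)) = cis (tau x (p - \<alpha>) + tau \<alpha> (x + (p - \<alpha>))) *\<^sub>C W (x + p) \<phi>"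
      by (simp add: W_mult W_simps scaleC_scaleC cis_mult)
    ultimately show ?thesis by (simp only: scaleC_scaleC cis_mult cis_zero scaleC_simps)
  qed
  show ?thesis by (rule that[OF _ W]) simp
qed

text \<open>The two unitaries of \<open>translation_splitting\<close> are moved into the families e
  and y, preserving their Bessel bounds. One factor \<open>h\<close> joins the phase between
  \<open>W\<close> and \<open>U\<close> to form the chirp inside the Schwartz function u; the other
  is the one in \<open>wiener_bound\<close>.\<close>

lemma translated_trace_bound:
  assumes b1: "b \<in> weighted (\<lambda>x. 1)" and I: "finite I" and K: "K \<ge> 0"
    and e: "\<And>z. (\<Sum>i\<in>I. (cmod (cinner (e i) z))\<^sup>2) \<le> (norm z)\<^sup>2"
    and y: "\<And>z. (\<Sum>i\<in>I. (cmod (cinner (y i) z))\<^sup>2) \<le> (K * norm z)\<^sup>2"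
  shows "cmod (\<integral>x. b (x + p) * (\<Sum>i\<in>I. cinner (y i) (W (x + p) (e i))) * complex_of_real ((h x)\<^sup>2) \<partial>lborel)
    \<le> gauss_const * K / (2 * pi) ^ DIM('w)
      * (\<integral>q. cmod (ft (\<lambda>x. b (x + p) * gaussian_chirp (\<lambda>x y. - tau x y / 2) x) q) \<partial>lborel)"
proof -
  obtain \<alpha> c where c: "cmod c = 1" "\<And>x \<phi>. W (x + p) \<phi> = c *\<^sub>C W \<alpha> (W x (W (p - \<alpha>) \<phi>))"
    by (rule translation_splitting) blast
  define e' where "e' i = W (p - \<alpha>) (e i)" for i
  define y' where "y' i = cis (tau \<alpha> \<alpha>) *\<^sub>C W (- \<alpha>) (y i)" for i
  define u where "u x = b (x + p) * gaussian_chirp (\<lambda>x y. - tau x y / 2) x" for x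
  have y'W: "cinner (y' i) z = cinner (y i) (W \<alpha> z)" for i z
    using W_isometry[of \<alpha> "y' i" z] by (simp only: y'_def W_inverse)
  have "b (x + p) * (\<Sum>i\<in>I. cinner (y i) (W (x + p) (e i))) * complex_of_real ((h x)\<^sup>2)
      = c * (u x * (complex_of_real (h x) * (\<Sum>i\<in>I. cinner (y' i) (U x (e' i)))))" for x
  proof -
    have "cinner (y i) (W (x + p) (e i)) = c * (cis (- tau x x / 2) * cinner (y' i) (U x (e' i)))" for i
    proof -
      have "W x (e' i) = cis (- tau x x / 2) *\<^sub>C U x (e' i)"
        by (simp add: U_def scaleC_scaleC cis_mult scaleC_simps)
      then have "cinner (y' i) (W x (e' i)) = cis (- tau x x / 2) * cinner (y' i) (U x (e' i))"
        by (simp add: cinner_scaleC_right)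
      then show ?thesis by (simp add: c(2) cinner_scaleC_right y'W e'_def)
    qed
    then have "(\<Sum>i\<in>I. cinner (y i) (W (x + p) (e i))) = c * (cis (- tau x x / 2) * (\<Sum>i\<in>I. cinner (y' i) (U x (e' i))))"
      by (simp only: sum_distrib_left)
    moreover have "gaussian_chirp (\<lambda>x y. - tau x y / 2) x = complex_of_real (h x) * cis (- tau x x / 2)"
      by (simp add: gaussian_chirp_def h_def)
    ultimately show ?thesis by (simp only: u_def of_real_power of_real_mult power2_eq_square mult_ac)
  qed
  then have "cmod (\<integral>x. b (x + p) * (\<Sum>i\<in>I. cinner (y i) (W (x + p) (e i))) * complex_of_real ((h x)\<^sup>2) \<partial>lborel)
      = cmod (\<integral>x. u x * (complex_of_real (h x) * (\<Sum>i\<in>I. cinner (y' i) (U x (e' i)))) \<partial>lborel)"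
    by (simp only: integral_mult_right_zero norm_mult c(1) mult_1_left)
  also have "\<dots> \<le> gauss_const * K / (2 * pi) ^ DIM('w) * (\<integral>q. cmod (ft u q) \<partial>lborel)"
  proof (rule wiener_bound[OF _ I K])
    have "bilinear (\<lambda>x y. - tau x y / 2)"
      by (simp add: bilinear_def linear_iff tau_simps field_simps)
    moreover have "(\<lambda>x. b (x + p)) \<in> weighted (\<lambda>x. 1)"
      by (rule bounded_derivs_translate[OF b1])
    ultimately show "u \<in> schwartz"
      unfolding u_def by (intro schwartz_mult_bounded gaussian_chirp_schwartz)
    show "(\<Sum>i\<in>I. (cmod (cinner (e' i) z))\<^sup>2) \<le> (norm z)\<^sup>2" for z
    proof -
      define z' where "z' = cis (tau (p - \<alpha>) (p - \<alpha>)) *\<^sub>C W (- (p - \<alpha>)) z"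
      have "cinner (e' i) z = cinner (e i) z'" for i
        using W_isometry[of "p - \<alpha>" "e i" z'] by (simp only: z'_def W_inverse e'_def)
      moreover have "norm z' = norm z" by (simp add: z'_def norm_scaleC W_norm)
      ultimately show ?thesis using e[of z'] by simp
    qed
    show "(\<Sum>i\<in>I. (cmod (cinner (y' i) z))\<^sup>2) \<le> (K * norm z)\<^sup>2" for z
      using y[of "W \<alpha> z"] by (simp add: y'W W_norm)
  qed
  finally show ?thesis unfolding u_def .
qed

text \<open>Derivatives of the localised symbol are bounded by w(x + p) times the decay of the
  chirp. The bound \<open>m\<close> is thus a multiple of a convolution of two integrable functions,
  which is why it is integrable in p.\<close>

lemma translated_sobolev_bound:
  assumes b: "b \<in> weighted w" and b1: "b \<in> weighted (\<lambda>x. 1)" and w: "integrable lborel w"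
    and B: "bilinear (B :: 'w \<Rightarrow> 'w \<Rightarrow> real)"
  obtains m where "integrable lborel m"
    "\<And>p. (\<integral>q. cmod (ft (\<lambda>x. b (x + p) * gaussian_chirp B x) q) \<partial>lborel) \<le> m p"
proof -
  define n where "n = DIM('w) + 1"
  define g where "g x = 1 / (1 + norm x) ^ n" for x :: 'w
  have gi: "integrable lborel g" unfolding g_def n_def by (rule integrable_inverse_power_norm)
  have g1: "0 \<le> g x" "g x \<le> 1" for x by (auto simp: g_def divide_le_eq_1 add_pos_nonneg)
  have [measurable]: "w \<in> borel_measurable borel" "g \<in> borel_measurable borel" using w gi by auto
  have gs: "gaussian_chirp B \<in> schwartz" by (rule gaussian_chirp_schwartz[OF B])
  obtain Cb where Cb: "\<And>vs x. norm (iter_deriv vs b x) \<le> Cb vs * w x" by (rule weighted_bounds[OF b]) blast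
  have "gaussian_chirp B \<in> weighted g" using gs unfolding g_def by (simp add: schwartz_iff_weighted)
  then obtain Cg where Cg: "\<And>vs x. norm (iter_deriv vs (gaussian_chirp B) x) \<le> Cg vs * g x"
    by (rule weighted_bounds) blast
  have lin: "linear (\<lambda>x::'w. x)" by (rule linear_ident)
  define C where "C vs = (\<Sum>q\<leftarrow>splits vs. Cb (fst q) * Cg (snd q))" for vs
  define C' where "C' = C [] + (\<Sum>b\<in>Basis. C (replicate n b))"
  define M where "M p = (\<integral>x. g x * w (p + x) \<partial>lborel)" for p
  define u where "u p x = b (x + p) * gaussian_chirp B x" for p x
  have sb: "smooth (\<lambda>x. b (x + p))" for p
    using b by (intro smooth_translate) (simp add: weighted_def)
  have us: "u p \<in> schwartz" for p
    unfolding u_def by (intro schwartz_mult_bounded gs bounded_derivs_translate b1)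
  have du: "norm (iter_deriv vs (u p) x) \<le> C vs * (g x * w (p + x))" for vs p x
  proof -
    have "u p = (\<lambda>x. b (x + p) * gaussian_chirp B x)" by (rule ext) (rule u_def)
    moreover have "norm (iter_deriv vs (\<lambda>x. b (x + p) * gaussian_chirp B x) x) \<le> C vs * (w (x + p) * g x)"
      unfolding C_def
      by (rule norm_iter_deriv_mult_le[OF sb schwartz_smooth[OF gs]])
        (use Cb[of _ "x + p"] Cg[of _ x] in \<open>simp_all add: iter_deriv_affine[OF lin]\<close>)
    ultimately show ?thesis by (simp only: mult_ac add_ac)
  qed
  have pi: "integrable (lborel \<Otimes>\<^sub>M lborel) (\<lambda>(x, p). g x * w (p + x))"
    by (rule integrable_pair_shear[where a="\<lambda>x. x", OF gi integrable_norm[OF w]])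
      (use g1 in \<open>auto simp: abs_mult\<close>)
  have Mi: "integrable lborel M" unfolding M_def by (rule lborel_pair.integrable_snd[OF pi])
  have gw: "integrable lborel (\<lambda>x. g x * w (p + x))" for p
  proof (rule Bochner_Integration.integrable_bound)
    show "integrable lborel (\<lambda>x. w (x + p))" using w by (simp add: lborel_translate(1))
    show "AE x in lborel. norm (g x * w (p + x)) \<le> norm (w (x + p))"
      using g1 by (intro AE_I2) (simp add: abs_mult add.commute mult_left_le_one_le)
  qed measurable
  have nrm: "(\<integral>x. norm (iter_deriv vs (u p) x) \<partial>lborel) \<le> C vs * M p" for vs p
  proof -
    have "(\<integral>x. norm (iter_deriv vs (u p) x) \<partial>lborel) \<le> (\<integral>x. C vs * (g x * w (p + x)) \<partial>lborel)"
      using us by (intro integral_mono integrable_norm schwartz_integrable schwartz_iter_deriv integrable_mult_right gw du)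
    then show ?thesis by (simp add: M_def)
  qed
  have sob: "sobolev_norm (u p) \<le> C' * M p" for p
    unfolding sobolev_norm_def C'_def n_def[symmetric] distrib_right sum_distrib_right
    using nrm[of "[]" p] by (intro add_mono sum_mono nrm) simp
  define c where "c = real n ^ n * (\<integral>q. g q \<partial>lborel)"
  have c0: "c \<ge> 0" unfolding c_def using g1 by (intro mult_nonneg_nonneg integral_nonneg_AE) auto
  have fb: "(\<integral>q. cmod (ft (u p) q) \<partial>lborel) \<le> c * (C' * M p)" for p
  proof -
    have "(\<integral>q. cmod (ft (u p) q) \<partial>lborel) \<le> (\<integral>q. real n ^ n * sobolev_norm (u p) * g q \<partial>lborel)"
      using norm_ft_decay[OF us[of p]] unfolding n_def g_def
      by (intro integral_mono integrable_norm ft_integrable us integrable_mult_right integrable_inverse_power_norm) simp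
    also have "\<dots> = c * sobolev_norm (u p)" by (simp add: c_def)
    also have "\<dots> \<le> c * (C' * M p)" by (intro mult_left_mono sob c0)
    finally show ?thesis .
  qed
  show ?thesis
  proof (rule that)
    show "integrable lborel (\<lambda>p. c * (C' * M p))" using Mi by simp
    show "(\<integral>q. cmod (ft (\<lambda>x. b (x + p) * gaussian_chirp B x) q) \<partial>lborel) \<le> c * (C' * M p)" for p
      using fb[of p] unfolding u_def .
  qed
qed

text \<open>The integral of h(p - x)^2 over p is \<open>gauss_const\<close> for every x, which
  permits inserting this factor and exchanging the integrals. For fixed p, translating x by p gives
  the situation of \<open>translated_trace_bound\<close>.\<close>

lemma trace_bound:
  assumes b: "b \<in> weighted w" and b1: "b \<in> weighted (\<lambda>x. 1)" and w: "integrable lborel w"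
  obtains K where "\<And>F y. finite F \<Longrightarrow> orthonormal F \<Longrightarrow>
      (\<And>z. (\<Sum>e\<in>F. (cmod (cinner (y e) z))\<^sup>2) \<le> (2 * norm z)\<^sup>2) \<Longrightarrow>
      cmod (\<integral>x. b x * (\<Sum>e\<in>F. cinner (y e) (W x e)) \<partial>lborel) \<le> K"
proof -
  have "bilinear (\<lambda>x y. - tau x y / 2)"
    by (simp add: bilinear_def linear_iff tau_simps field_simps)
  then obtain m where m: "integrable lborel m"
    "\<And>p. (\<integral>q. cmod (ft (\<lambda>x. b (x + p) * gaussian_chirp (\<lambda>x y. - tau x y / 2) x) q) \<partial>lborel) \<le> m p"
    by (rule translated_sobolev_bound[OF b b1 w]) blast
  have bi: "integrable lborel b" by (rule weighted_integrable[OF b w])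
  have bc: "continuous_on UNIV b" using smooth_continuous[of b "[]"] b by (simp add: weighted_def)
  define H where "H = (\<integral>p. complex_of_real ((h p)\<^sup>2) \<partial>lborel)"
  have h2: "complex_of_real ((h p)\<^sup>2) = complex_of_real (exp (- (norm p)\<^sup>2 / 2)) * cis (p \<bullet> 0)" for p
    by (simp add: h_def power2_eq_square exp_add[symmetric])
  have H: "H = complex_of_real gauss_const"
    unfolding H_def h2 gaussian_euclidean(2) by (simp add: gauss_const_def)
  \<comment> \<open>The factor 2 is the Bessel constant of the families y, coming from the bound 2
    in \<open>trace_class_contractionI\<close>.\<close>
  define c where "c = gauss_const * 2 / (2 * pi) ^ DIM('w)"
  have c0: "c \<ge> 0" using gauss_const_pos by (simp add: c_def)
  show ?thesis
  proof (rule that)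
    fix F :: "'h set" and y :: "'h \<Rightarrow> 'h"
    assume F: "finite F" "orthonormal F" and y: "\<And>z. (\<Sum>e\<in>F. (cmod (cinner (y e) z))\<^sup>2) \<le> (2 * norm z)\<^sup>2"
    define k where "k x = (\<Sum>e\<in>F. cinner (y e) (W x e))" for x
    have kc: "continuous_on UNIV k" unfolding k_def by (intro continuous_on_sum W_coefficient_continuous)
    define kb where "kb = (\<Sum>e\<in>F. norm (y e) * norm e)"
    have kb: "cmod (k x) \<le> kb" for x
      unfolding k_def kb_def by (intro order_trans[OF norm_sum] sum_mono W_coefficient_le)
    define f where "f x p = b x * k x * complex_of_real ((h (p - x))\<^sup>2)" for x p
    have fi: "integrable (lborel \<Otimes>\<^sub>M lborel) (\<lambda>(x, p). f x p)"
    proof (rule integrable_pair_shear[where a="\<lambda>x. - x"])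
      show "integrable lborel (\<lambda>x. kb * cmod (b x))" using bi by simp
      show "integrable lborel h" by (rule h_integrable(1))
      show "norm (f x p) \<le> kb * cmod (b x) * h (p + - x)" for x p
      proof -
        have "norm (f x p) = (cmod (k x) * cmod (b x)) * (h (p - x))\<^sup>2"
          by (simp add: f_def norm_mult norm_power)
        also have "\<dots> \<le> (kb * cmod (b x)) * h (p - x)"
        proof (intro mult_mono)
          show "(h (p - x))\<^sup>2 \<le> h (p - x)"
            using mult_left_mono[OF h_bounds(2)[of "p - x"], of "h (p - x)"] h_bounds(1)[of "p - x"]
            by (simp add: power2_eq_square)
          show "cmod (k x) \<le> kb" by (rule kb)
        qed (use order_trans[OF norm_ge_zero kb] in auto)
        finally show ?thesis by simp
      qed
      have "continuous_on UNIV (\<lambda>q. b (fst q) * k (fst q) * complex_of_real ((h (snd q - fst q))\<^sup>2))"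
        unfolding h_def
        by (intro continuous_intros continuous_on_compose2[OF bc] continuous_on_compose2[OF kc]) auto
      then show "(\<lambda>(x, p). f x p) \<in> borel_measurable (lborel \<Otimes>\<^sub>M lborel)"
        unfolding lborel_prod case_prod_beta f_def by (simp add: borel_measurable_continuous_onI)
    qed
    have "complex_of_real gauss_const * (\<integral>x. b x * k x \<partial>lborel) = (\<integral>x. (\<integral>p. f x p \<partial>lborel) \<partial>lborel)"
    proof -
      have "(\<integral>p. f x p \<partial>lborel) = b x * k x * H" for x
        unfolding f_def H_def integral_mult_right_zero
        using lborel_translate(2)[of "\<lambda>p. complex_of_real ((h p)\<^sup>2)" "- x"] by simp
      then show ?thesis by (simp add: H mult.commute)
    qed
    also have "\<dots> = (\<integral>p. (\<integral>x. f x p \<partial>lborel) \<partial>lborel)"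
      by (rule lborel_pair.Fubini_integral[OF fi, symmetric])
    finally have eq: "complex_of_real gauss_const * (\<integral>x. b x * k x \<partial>lborel) = (\<integral>p. (\<integral>x. f x p \<partial>lborel) \<partial>lborel)" .
    have fp: "cmod (\<integral>x. f x p \<partial>lborel) \<le> c * m p" for p
    proof -
      have "(\<integral>x. f x p \<partial>lborel) = (\<integral>x. f (x + p) p \<partial>lborel)" by (rule lborel_translate(2)[symmetric])
      also have "\<dots> = (\<integral>x. b (x + p) * k (x + p) * complex_of_real ((h x)\<^sup>2) \<partial>lborel)"
        by (simp add: f_def h_def)
      finally have "cmod (\<integral>x. f x p \<partial>lborel) \<le> c * (\<integral>q. cmod (ft (\<lambda>x. b (x + p) * gaussian_chirp (\<lambda>x y. - tau x y / 2) x) q) \<partial>lborel)"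
        unfolding c_def k_def using translated_trace_bound[OF b1 F(1) _ bessel[OF F] y, of p] by simp
      also have "\<dots> \<le> c * m p" by (intro mult_left_mono m c0)
      finally show ?thesis .
    qed
    have "gauss_const * cmod (\<integral>x. b x * k x \<partial>lborel) = cmod (\<integral>p. (\<integral>x. f x p \<partial>lborel) \<partial>lborel)"
      using gauss_const_pos arg_cong[OF eq, of cmod] by (simp add: norm_mult)
    also have "\<dots> \<le> (\<integral>p. cmod (\<integral>x. f x p \<partial>lborel) \<partial>lborel)" by (rule integral_norm_bound)
    also have "\<dots> \<le> (\<integral>p. c * m p \<partial>lborel)"
      by (intro integral_mono fp integrable_norm lborel_pair.integrable_snd[OF fi] integrable_mult_right m)
    finally have "cmod (\<integral>x. b x * k x \<partial>lborel) \<le> (\<integral>p. c * m p \<partial>lborel) / gauss_const"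
      using gauss_const_pos by (simp add: field_simps)
    then show "cmod (\<integral>x. b x * (\<Sum>e\<in>F. cinner (y e) (W x e)) \<partial>lborel) \<le> (\<integral>p. c * m p \<partial>lborel) / gauss_const"
      unfolding k_def .
  qed
qed

theorem integrated_trace_class:
  assumes b: "b \<in> weighted w" and b1: "b \<in> weighted (\<lambda>x. 1)" and w: "integrable lborel w"
  obtains A where "trace_class A" "\<And>\<phi> \<psi>. cinner \<phi> (A \<psi>) = (\<integral>x. b x * cinner \<phi> (W x \<psi>) \<partial>lborel)"
proof -
  obtain K where K: "\<And>F y. finite F \<Longrightarrow> orthonormal F \<Longrightarrow>
      (\<And>z. (\<Sum>e\<in>F. (cmod (cinner (y e) z))\<^sup>2) \<le> (2 * norm z)\<^sup>2) \<Longrightarrow>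
      cmod (\<integral>x. b x * (\<Sum>e\<in>F. cinner (y e) (W x e)) \<partial>lborel) \<le> K"
    by (rule trace_bound[OF assms]) blast
  have bi: "integrable lborel b" by (rule weighted_integrable[OF b w])
  have ci: "integrable lborel (\<lambda>x. b x * cinner \<phi> (W x \<psi>))" for \<phi> \<psi>
    by (rule integrable_mult_bounded[OF bi _ W_coefficient_le]) measurable
  define N where "N = (\<integral>x. norm (b x) \<partial>lborel)"
  have N: "N \<ge> 0" unfolding N_def by (rule integral_nonneg_AE) simp
  obtain A where A: "bounded_op A" "\<And>x. norm (A x) \<le> N * norm x"
    "\<And>\<phi> \<psi>. cinner \<phi> (A \<psi>) = (\<integral>x. b x * cinner \<phi> (W x \<psi>) \<partial>lborel)"
    unfolding N_def
    by (rule sesquilinear_operator[OF sesquilinear_integral[OF W_op W_norm W_coefficient_measurable bi]]) blast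
  \<comment> \<open>Scaling by d makes the operator a contraction, as
    \<open>trace_class_contractionI\<close> demands; adding 1 keeps the denominator positive when N
    = 0.\<close>
  define d where "d = 1 / (1 + N)"
  have d: "d > 0" "d * N \<le> 1" using N by (auto simp: d_def)
  define A' where "A' x = complex_of_real d *\<^sub>C A x" for x
  have "trace_class A'"
  proof (rule trace_class_contractionI)
    show le: "norm (A' x) \<le> norm x" for x
    proof -
      have "norm (A' x) \<le> d * (N * norm x)"
        unfolding A'_def norm_scaleC using d(1) by (simp add: A(2) mult_left_mono)
      also have "\<dots> \<le> norm x" using mult_right_mono[OF d(2), of "norm x"] by (simp add: mult.assoc)
      finally show ?thesis .
    qed
    show "bounded_op A'"
      by (rule bounded_opI[of _ 1])
        (use le in \<open>simp_all add: A'_def bounded_op_simps[OF A(1)] scaleC_add_right scaleC_scaleC mult.commute\<close>)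
    fix F :: "'h set" and y :: "'h \<Rightarrow> 'h"
    assume F: "finite F" "orthonormal F" and y: "\<And>z. (\<Sum>e\<in>F. (cmod (cinner (y e) z))\<^sup>2) \<le> (2 * norm z)\<^sup>2"
    have "(\<Sum>e\<in>F. cinner (y e) (A' e)) = complex_of_real d * (\<Sum>e\<in>F. \<integral>x. b x * cinner (y e) (W x e) \<partial>lborel)"
      by (simp add: A'_def cinner_scaleC_right A(3) sum_distrib_left)
    also have "(\<Sum>e\<in>F. \<integral>x. b x * cinner (y e) (W x e) \<partial>lborel) = (\<integral>x. b x * (\<Sum>e\<in>F. cinner (y e) (W x e)) \<partial>lborel)"
      unfolding sum_distrib_left by (rule Bochner_Integration.integral_sum[symmetric]) (rule ci)
    finally show "cmod (\<Sum>e\<in>F. cinner (y e) (A' e)) \<le> d * K"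
      using K[OF F y] d(1) by (simp add: norm_mult mult_left_mono)
  qed
  then have "trace_class (\<lambda>x. complex_of_real (1 / d) *\<^sub>C A' x)" by (rule trace_class_scale)
  moreover have "(\<lambda>x. complex_of_real (1 / d) *\<^sub>C A' x) = A"
    using d(1) by (simp add: A'_def scaleC_scaleC scaleC_simps flip: of_real_mult)
  ultimately have "trace_class A" by simp
  then show ?thesis using A(3) by (rule that)
qed

end

lemma weighted_linear:
  fixes L :: "'a::euclidean_space \<Rightarrow> 'a"
  assumes L: "linear L" and b: "b \<in> weighted v"
  shows "(\<lambda>x. b (L x)) \<in> weighted (\<lambda>x. v (L x))"
proof -
  obtain C where C: "\<And>vs x. norm (iter_deriv vs b x) \<le> C vs * v x" by (rule weighted_bounds[OF b]) blast
  have "norm (iter_deriv vs (\<lambda>x. b (L x + 0)) x) \<le> C (map L vs) * v (L x)" for vs x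
    unfolding iter_deriv_affine[OF L] using C[of "map L vs" "L x"] by simp
  moreover have "smooth (\<lambda>x. b (L x + 0))"
    using b by (intro smooth_affine[OF L, of UNIV]) (auto simp: weighted_def smooth_def)
  ultimately show ?thesis unfolding weighted_def add_0_right by blast
qed

section \<open>Symplectic bases\<close>

text \<open>A Darboux system up to signs, encoded by the involution that pairs conjugate vectors.
  Squaring the pairing avoids choosing which member of a pair is a position and which a
  momentum.\<close>

definition symplectic_system :: "('a::euclidean_space \<Rightarrow> 'a \<Rightarrow> real) \<Rightarrow> 'a set \<Rightarrow> ('a \<Rightarrow> 'a) \<Rightarrow> bool" where
  "symplectic_system s B \<tau> \<longleftrightarrow> finite B \<and> (\<forall>e\<in>B. \<tau> e \<in> B \<and> \<tau> (\<tau> e) = e \<and> (s e (\<tau> e))\<^sup>2 = 1 \<and>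
    (\<forall>f\<in>B. f \<noteq> \<tau> e \<longrightarrow> s e f = 0))"

context
  fixes s :: "'a::euclidean_space \<Rightarrow> 'a \<Rightarrow> real"
  assumes bil: "bilinear s" and anti: "\<And>x y. s x y = - s y x"
    and nd: "\<And>x. (\<And>y. s x y = 0) \<Longrightarrow> x = 0"
begin

interpretation s: bounded_bilinear s
  using bil bilinear_conv_bounded_bilinear by blast

lemma symplectic_system_sum:
  assumes B: "symplectic_system s B \<tau>" and f: "f \<in> B"
  shows "(\<Sum>e\<in>B. c e * s f e) = c (\<tau> f) * s f (\<tau> f)"
proof -
  have "(\<Sum>e\<in>B. c e * s f e) = (\<Sum>e\<in>B. if e = \<tau> f then c e * s f e else 0)"
    using B f unfolding symplectic_system_def by (intro sum.cong) auto
  also have "\<dots> = c (\<tau> f) * s f (\<tau> f)"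
    using B f unfolding symplectic_system_def by simp
  finally show ?thesis .
qed

lemma symplectic_system_independent:
  assumes B: "symplectic_system s B \<tau>"
  shows "independent B"
proof -
  have fin: "finite B" using B by (simp add: symplectic_system_def)
  show ?thesis
    unfolding independent_explicit_finite_subsets
  proof (intro allI impI ballI)
    fix S c e assume S: "S \<subseteq> B" "finite S" "(\<Sum>v\<in>S. c v *\<^sub>R v) = 0" and e: "e \<in> S"
    define d where "d v = (if v \<in> S then c v else 0)" for v
    have "(\<Sum>v\<in>B. d v *\<^sub>R v) = (\<Sum>v\<in>S. c v *\<^sub>R v)"
      using S(1) fin by (intro sum.mono_neutral_cong_right) (auto simp: d_def)
    with S(3) have d0: "(\<Sum>v\<in>B. d v *\<^sub>R v) = 0" by simp
    have te: "\<tau> e \<in> B" "\<tau> (\<tau> e) = e" using B e S(1) by (auto simp: symplectic_system_def)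
    have "s (\<tau> e) (\<Sum>v\<in>B. d v *\<^sub>R v) = d (\<tau> (\<tau> e)) * s (\<tau> e) (\<tau> (\<tau> e))"
      using symplectic_system_sum[OF B te(1), of d] by (simp add: s.sum_right s.scaleR_right)
    then have "d e * s (\<tau> e) e = 0" using d0 te by (simp add: s.zero_right)
    moreover have "s (\<tau> e) e \<noteq> 0" using B te unfolding symplectic_system_def by force
    ultimately show "c e = 0" using e by (simp add: d_def)
  qed
qed

text \<open>The form restricted to the span of the system is nondegenerate, so each vector has a
  component in that span whose removal leaves a vector annihilated by the system.\<close>

lemma symplectic_system_project:
  assumes B: "symplectic_system s B \<tau>"
  obtains z where "x - z \<in> span B" "\<And>f. f \<in> B \<Longrightarrow> s f z = 0"
proof -
  define c where "c e = s (\<tau> e) x / s (\<tau> e) e" for e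
  define z where "z = x - (\<Sum>e\<in>B. c e *\<^sub>R e)"
  have "x - z \<in> span B" unfolding z_def by (simp add: span_sum span_scale span_base)
  moreover have "s f z = 0" if f: "f \<in> B" for f
  proof -
    have t: "\<tau> f \<in> B" "\<tau> (\<tau> f) = f" "s f (\<tau> f) \<noteq> 0" using B f by (auto simp: symplectic_system_def)
    have "s f z = s f x - c (\<tau> f) * s f (\<tau> f)"
      using symplectic_system_sum[OF B f, of c] by (simp add: z_def s.diff_right s.sum_right s.scaleR_right)
    also have "\<dots> = 0" using t by (simp add: c_def)
    finally show ?thesis .
  qed
  ultimately show ?thesis by (rule that)
qed

lemma symplectic_system_extend:
  assumes B: "symplectic_system s B \<tau>" and "span B \<noteq> UNIV"
  obtains B' \<tau>' where "symplectic_system s B' \<tau>'" "card B' > card B"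
proof -
  obtain x0 where x0: "x0 \<notin> span B" using assms(2) by blast
  obtain x where x: "x0 - x \<in> span B" "\<And>f. f \<in> B \<Longrightarrow> s f x = 0"
    by (rule symplectic_system_project[OF B]) blast
  have "x \<noteq> 0" using x(1) x0 by auto
  then obtain y0 where y0: "s x y0 \<noteq> 0" using nd by blast
  obtain y1 where y1: "y0 - y1 \<in> span B" "\<And>f. f \<in> B \<Longrightarrow> s f y1 = 0"
    by (rule symplectic_system_project[OF B]) blast
  have "s x v = 0" if "v \<in> span B" for v
    using that
  proof (induction rule: span_induct_alt)
    case (step c e v)
    then show ?case using x(2)[of e] anti[of x e] by (simp add: s.add_right s.scaleR_right)
  qed (simp add: s.zero_right)
  \<comment> \<open>Since x annihilates the span of B, projecting y0 does not change its pairing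
    with x.\<close>
  from this[OF y1(1)] have "s x y1 \<noteq> 0" using y0 by (simp add: s.diff_right)
  define y where "y = (1 / s x y1) *\<^sub>R y1"
  have y: "s x y = 1" "\<And>f. f \<in> B \<Longrightarrow> s f y = 0"
    using \<open>s x y1 \<noteq> 0\<close> y1(2) by (auto simp: y_def s.scaleR_right)
  have xx: "s z z = 0" for z using anti[of z z] by simp
  have yx: "s y x = - 1" using anti[of y x] y(1) by simp
  have self: "e \<noteq> x" "e \<noteq> y" if "e \<in> B" for e
  proof -
    have "\<tau> e \<in> B" "(s e (\<tau> e))\<^sup>2 = 1" using B that by (auto simp: symplectic_system_def)
    then show "e \<noteq> x" "e \<noteq> y" using x(2)[of "\<tau> e"] y(2)[of "\<tau> e"] anti[of e "\<tau> e"] by auto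
  qed
  have "x \<noteq> y" using y(1) xx[of x] by auto
  define \<tau>' where "\<tau>' = \<tau>(x := y, y := x)"
  have "symplectic_system s (insert x (insert y B)) \<tau>'"
  proof -
    have t: "\<tau>' x = y" "\<tau>' y = x" "\<And>e. e \<in> B \<Longrightarrow> \<tau>' e = \<tau> e"
      using \<open>x \<noteq> y\<close> self by (auto simp: \<tau>'_def)
    have Bt: "\<And>e. e \<in> B \<Longrightarrow> \<tau> e \<in> B \<and> \<tau> (\<tau> e) = e \<and> (s e (\<tau> e))\<^sup>2 = 1"
      "\<And>e f. e \<in> B \<Longrightarrow> f \<in> B \<Longrightarrow> f \<noteq> \<tau> e \<Longrightarrow> s e f = 0" "finite B"
      using B by (auto simp: symplectic_system_def)
    have xf: "s x f = 0" "s y f = 0" if "f \<in> B" for f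
      using x(2)[OF that] y(2)[OF that] anti[of x f] anti[of y f] by auto
    show ?thesis
      unfolding symplectic_system_def
      using Bt t xf x(2) y xx yx by auto
  qed
  moreover have "card (insert x (insert y B)) > card B"
    using B self \<open>x \<noteq> y\<close> by (subst card_insert_disjoint; auto simp: symplectic_system_def)+
  ultimately show ?thesis by (rule that)
qed

text \<open>Extension starts from the empty system. Symplectic systems are linearly independent, so
  their size is at most DIM and the extension stops at a spanning one.\<close>

lemma symplectic_basis_exists:
  obtains B \<tau> where "symplectic_system s B \<tau>" "span B = UNIV"
proof -
  have "\<exists>B' \<tau>'. symplectic_system s B' \<tau>' \<and> span B' = UNIV" if "symplectic_system s B \<tau>" for B \<tau>
    using that
  proof (induction "DIM('a) - card B" arbitrary: B \<tau> rule: less_induct)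
    case less
    show ?case
    proof (cases "span B = UNIV")
      case False
      obtain B' \<tau>' where B': "symplectic_system s B' \<tau>'" "card B' > card B"
        by (rule symplectic_system_extend[OF less.prems False])
      have "card B' \<le> DIM('a)"
        using independent_bound[OF symplectic_system_independent[OF B'(1)]] by simp
      then have "DIM('a) - card B' < DIM('a) - card B" using B'(2) by linarith
      from less.hyps[OF this B'(1)] show ?thesis .
    qed (use less.prems in blast)
  qed
  moreover have "symplectic_system s {} (\<lambda>x. x)" by (simp add: symplectic_system_def)
  ultimately show ?thesis using that by blast
qed

text \<open>\<open>M\<close> sends the standard basis to a symplectic one. In these coordinates the
  form is given by a signed permutation of the basis, hence by an isometry \<open>j\<close>.\<close>

lemma symplectic_normal_form:
  obtains M j :: "'a \<Rightarrow> 'a" where "linear M" "bij M" "linear j" "\<And>x. norm (j x) = norm x" "\<And>x y. s (M x) (M y) = x \<bullet> j y"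
proof -
  obtain B \<tau> where B: "symplectic_system s B \<tau>" and sp: "span B = UNIV"
    by (rule symplectic_basis_exists)
  have fin: "finite B" using B by (simp add: symplectic_system_def)
  have "card B = DIM('a)"
    using dim_span_eq_card_independent[OF symplectic_system_independent[OF B]] sp by simp
  then obtain \<beta> where \<beta>: "bij_betw \<beta> (Basis :: 'a set) B"
    using finite_same_card_bij[OF finite_Basis fin] by auto
  have \<beta>B: "\<beta> b \<in> B" if "b \<in> Basis" for b using \<beta> that by (auto simp: bij_betw_def)
  define M where "M x = (\<Sum>b\<in>Basis. (x \<bullet> b) *\<^sub>R \<beta> b)" for x
  have M: "linear M"
    by (rule linearI) (simp_all add: M_def inner_add_left scaleR_add_left sum.distrib scaleR_sum_right)
  have Mb: "M b = \<beta> b" if "b \<in> Basis" for b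
    unfolding M_def using that by (simp add: inner_Basis if_distrib[of "\<lambda>c. c *\<^sub>R _"] cong: if_cong)
  have "B \<subseteq> range M"
    using \<beta> Mb unfolding bij_betw_def by (metis image_subset_iff rangeI)
  then have "surj M" using sp span_minimal[of B "range M"] linear_subspace_image[OF M subspace_UNIV] by auto
  then have "bij M" using linear_surjective_imp_injective[OF M] by (simp add: bij_def)
  define j where "j y = (\<Sum>b\<in>Basis. s (\<beta> b) (M y) *\<^sub>R b)" for y
  have j: "linear j"
    by (rule linearI) (simp_all add: j_def linear_add[OF M] linear_scale[OF M] s.add_right s.scaleR_right
        scaleR_add_left sum.distrib scaleR_sum_right)
  have eq: "s (M x) (M y) = x \<bullet> j y" for x y
    by (subst M_def) (simp add: j_def s.sum_left s.scaleR_left inner_sum_right mult.commute)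
  \<comment> \<open>The permutation of the standard basis induced by the pairing of conjugate
    vectors.\<close>
  define \<pi> where "\<pi> b = inv_into Basis \<beta> (\<tau> (\<beta> b))" for b
  have \<tau>: "bij_betw \<tau> B B"
    by (rule bij_betw_byWitness[of _ \<tau>]) (use B in \<open>auto simp: symplectic_system_def\<close>)
  have \<pi>: "bij_betw \<pi> Basis Basis"
  proof -
    have "bij_betw (inv_into Basis \<beta> \<circ> (\<tau> \<circ> \<beta>)) Basis Basis"
      by (rule bij_betw_trans[OF bij_betw_trans[OF \<beta> \<tau>] bij_betw_inv_into[OF \<beta>]])
    moreover have "\<pi> = inv_into Basis \<beta> \<circ> (\<tau> \<circ> \<beta>)" by (simp add: fun_eq_iff \<pi>_def)
    ultimately show ?thesis by simp
  qed
  have coord: "(s (\<beta> b) (M y))\<^sup>2 = (y \<bullet> \<pi> b)\<^sup>2" if b: "b \<in> Basis" for b y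
  proof -
    have t: "\<tau> (\<beta> b) \<in> B" "(s (\<beta> b) (\<tau> (\<beta> b)))\<^sup>2 = 1" using B \<beta>B[OF b] by (auto simp: symplectic_system_def)
    have "s (\<beta> b) (M y) = (\<Sum>c\<in>Basis. (y \<bullet> c) * s (\<beta> b) (\<beta> c))"
      by (simp add: M_def s.sum_right s.scaleR_right)
    also have "\<dots> = (\<Sum>e\<in>B. (y \<bullet> inv_into Basis \<beta> e) * s (\<beta> b) e)"
    proof -
      have "(\<Sum>c\<in>Basis. (y \<bullet> inv_into Basis \<beta> (\<beta> c)) * s (\<beta> b) (\<beta> c))
          = (\<Sum>e\<in>B. (y \<bullet> inv_into Basis \<beta> e) * s (\<beta> b) e)"
        by (rule sum.reindex_bij_betw[OF \<beta>])
      then show ?thesis by (simp add: bij_betw_inv_into_left[OF \<beta>] cong: sum.cong)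
    qed
    also have "\<dots> = (y \<bullet> \<pi> b) * s (\<beta> b) (\<tau> (\<beta> b))"
      unfolding \<pi>_def by (rule symplectic_system_sum[OF B \<beta>B[OF b]])
    finally show ?thesis using t(2) by (simp add: power_mult_distrib)
  qed
  have nrm: "(norm x)\<^sup>2 = (\<Sum>b\<in>Basis. (x \<bullet> b)\<^sup>2)" for x :: 'a
    by (subst power2_norm_eq_inner, subst euclidean_inner) (simp add: power2_eq_square)
  have jn: "norm (j y) = norm y" for y
  proof -
    have "(norm (j y))\<^sup>2 = (\<Sum>b\<in>Basis. (s (\<beta> b) (M y))\<^sup>2)"
      unfolding nrm by (intro sum.cong refl) (simp add: j_def)
    also have "\<dots> = (\<Sum>b\<in>Basis. (y \<bullet> \<pi> b)\<^sup>2)" by (rule sum.cong[OF refl coord])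
    also have "\<dots> = (\<Sum>b\<in>Basis. (y \<bullet> b)\<^sup>2)" by (rule sum.reindex_bij_betw[OF \<pi>])
    finally show ?thesis by (simp only: nrm[symmetric] power2_eq_iff_nonneg norm_ge_zero)
  qed
  show ?thesis by (rule that[OF M \<open>bij M\<close> j jn eq])
qed

end

section \<open>Matrix coefficients of smooth vectors\<close>

lemma smooth_add:
  fixes f g :: "'a::euclidean_space \<Rightarrow> 'b::real_normed_vector"
  assumes f: "smooth f" and g: "smooth g"
  shows "smooth (\<lambda>x. f x + g x)"
  by (rule smoothI(1)[of "\<lambda>vs x. iter_deriv vs f x + iter_deriv vs g x"])
    (auto intro!: continuous_intros smooth_continuous f g has_vector_derivative_add smooth_line0 simp del: iter_deriv.simps(2))

lemma smooth_bounded_linear: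
  fixes f :: "'a::euclidean_space \<Rightarrow> 'b::real_normed_vector"
  assumes f: "smooth f" and T: "bounded_linear T"
  shows "smooth (\<lambda>x. T (f x))"
  by (rule smoothI(1)[of "\<lambda>vs x. T (iter_deriv vs f x)"])
    (auto intro!: bounded_linear.continuous_on[OF T] smooth_continuous f bounded_linear.has_vector_derivative[OF T] smooth_line0
      simp del: iter_deriv.simps(2))

text \<open>Functions of the form f + l g are stable under differentiation: l has constant
  derivative, and the extra term l(v) g is absorbed into f.\<close>

lemma smooth_add_linear_mult:
  fixes f g :: "'a::euclidean_space \<Rightarrow> 'b::real_normed_vector"
  assumes f: "smooth f" and g: "smooth g" and l: "linear l"
  shows "smooth (\<lambda>x. f x + l x *\<^sub>R g x)"
proof (rule closed_family_derivs(1))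
  define G where "G = {(\<lambda>x. f x + l x *\<^sub>R g x) | f g :: 'a \<Rightarrow> 'b. smooth f \<and> smooth g}"
  show "(\<lambda>x. f x + l x *\<^sub>R g x) \<in> G" using f g by (auto simp: G_def)
  fix q assume "q \<in> G"
  then obtain f g where q: "q = (\<lambda>x. f x + l x *\<^sub>R g x)" and f: "smooth f" and g: "smooth g"
    by (auto simp: G_def)
  have lc: "continuous_on UNIV l" using l by (simp add: linear_continuous_on linear_conv_bounded_linear)
  show "continuous_on UNIV q"
    unfolding q using smooth_continuous[OF f, of "[]"] smooth_continuous[OF g, of "[]"] lc
    by (auto intro!: continuous_intros)
  fix v
  let ?f' = "\<lambda>x. iter_deriv [v] f x + l v *\<^sub>R g x"
  have "smooth ?f'"
    using smooth_iter_deriv[OF f, of "[v]"] smooth_bounded_linear[OF g bounded_linear_scaleR_right, of "l v"]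
    by (rule smooth_add)
  then have "(\<lambda>x. ?f' x + l x *\<^sub>R iter_deriv [v] g x) \<in> G"
    using smooth_iter_deriv[OF g, of "[v]"] unfolding G_def mem_Collect_eq
    by (intro exI[of _ ?f'] exI[of _ "iter_deriv [v] g"] conjI refl)
  moreover have "((\<lambda>s. q (x + s *\<^sub>R v)) has_vector_derivative (?f' x + l x *\<^sub>R iter_deriv [v] g x)) (at 0)" for x
  proof -
    have "((\<lambda>s. l x + s * l v) has_real_derivative l v) (at 0)"
      by (auto intro!: derivative_eq_intros)
    then have dl: "((\<lambda>s. l (x + s *\<^sub>R v)) has_real_derivative l v) (at 0)"
      by (simp add: linear_add[OF l] linear_scale[OF l])
    have "((\<lambda>s. f (x + s *\<^sub>R v) + l (x + s *\<^sub>R v) *\<^sub>R g (x + s *\<^sub>R v)) has_vector_derivative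
        iter_deriv [v] f x + (l (x + 0 *\<^sub>R v) *\<^sub>R iter_deriv [v] g x + l v *\<^sub>R g (x + 0 *\<^sub>R v))) (at 0)"
      using smooth_line0[OF f, of "[]" x v] smooth_line0[OF g, of "[]" x v]
      by (intro has_vector_derivative_add has_vector_derivative_scaleR dl) simp_all
    then show ?thesis by (simp add: q add_ac)
  qed
  ultimately show "\<exists>q'\<in>G. \<forall>x. ((\<lambda>s. q (x + s *\<^sub>R v)) has_vector_derivative q' x) (at 0)"
    by (intro bexI[of _ "\<lambda>x. ?f' x + l x *\<^sub>R iter_deriv [v] g x"] allI)
qed

interpretation scaleC: bounded_bilinear "scaleC :: complex \<Rightarrow> 'h::complex_hilbert_space \<Rightarrow> 'h"
proof
  show "\<exists>K. \<forall>a (b::'h). norm (a *\<^sub>C b) \<le> norm a * norm b * K"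
    by (intro exI[of _ 1]) (simp add: norm_scaleC)
  show "(r *\<^sub>R a) *\<^sub>C b = r *\<^sub>R a *\<^sub>C (b::'h)" for r a b
    by (simp add: scaleC_of_real[symmetric] scaleC_scaleC scaleR_conv_of_real)
qed (simp_all add: scaleC_add_left scaleC_add_right scaleC_simps)

lemma cis_quadratic_derivative:
  "((\<lambda>t. cis (t * a + t\<^sup>2 * b)) has_vector_derivative \<i> * complex_of_real a) (at 0)"
proof -
  have "((\<lambda>t. cis (t * a + t\<^sup>2 * b)) has_vector_derivative
      (a + 0) *\<^sub>R (\<i> * cis (0 * a + 0\<^sup>2 * b))) (at 0)"
    unfolding has_vector_derivative_def
    by (rule has_derivative_eq_rhs, rule has_derivative_cis, (rule derivative_intros)+) (auto simp: fun_eq_iff)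
  then show ?thesis by (simp add: scaleR_conv_of_real mult.commute)
qed

section \<open>Generators acting on smooth vectors\<close>

context weyl_rep
begin

text \<open>On smooth vectors this is i times the field operator in the direction \<eta>; the
  quadratic phase in the definition of the field has no first-order term.\<close>

definition gen :: "'w \<Rightarrow> 'h \<Rightarrow> 'h" where "gen \<eta> \<psi> = dir_deriv \<eta> (\<lambda>\<xi>. W \<xi> \<psi>) 0"

lemma smooth_vectorsD: "\<psi> \<in> smooth_vectors W \<Longrightarrow> smooth (\<lambda>\<xi>. W \<xi> \<psi>)"
  by (simp add: smooth_vectors_def smooth_def)

lemma W_bounded_linear: "bounded_linear (W x)"
  using W_op by (simp add: bounded_op_def)

lemma gen_derivative0:
  assumes "\<psi> \<in> smooth_vectors W"
  shows "((\<lambda>t. W (t *\<^sub>R \<eta>) \<psi>) has_vector_derivative gen \<eta> \<psi>) (at 0)"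
  using smooth_line0[OF smooth_vectorsD[OF assms], of "[]" 0 \<eta>] by (simp add: gen_def)

lemma gen_derivative:
  assumes "\<psi> \<in> smooth_vectors W"
  shows "((\<lambda>t. W (\<xi> + t *\<^sub>R \<eta>) \<psi>) has_vector_derivative
    W \<xi> (gen \<eta> \<psi>) + (- \<i> * complex_of_real (tau \<xi> \<eta>)) *\<^sub>C W \<xi> \<psi>) (at 0)"
proof -
  have "W (\<xi> + t *\<^sub>R \<eta>) \<psi> = cis (t * (- tau \<xi> \<eta>) + t\<^sup>2 * 0) *\<^sub>C W \<xi> (W (t *\<^sub>R \<eta>) \<psi>)" for t
    by (simp add: W_mult scaleC_scaleC cis_mult tau_simps scaleC_simps)
  moreover have "((\<lambda>t. cis (t * (- tau \<xi> \<eta>) + t\<^sup>2 * 0) *\<^sub>C W \<xi> (W (t *\<^sub>R \<eta>) \<psi>)) has_vector_derivative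
      cis (0 * (- tau \<xi> \<eta>) + 0\<^sup>2 * 0) *\<^sub>C W \<xi> (gen \<eta> \<psi>) + (\<i> * complex_of_real (- tau \<xi> \<eta>)) *\<^sub>C W \<xi> (W (0 *\<^sub>R \<eta>) \<psi>)) (at 0)"
    by (intro scaleC.has_vector_derivative cis_quadratic_derivative
        bounded_linear.has_vector_derivative[OF W_bounded_linear] gen_derivative0 assms)
  ultimately show ?thesis by (simp add: scaleC_simps W_0)
qed

text \<open>Solving \<open>gen_derivative\<close> for the orbit of \<open>gen \<eta> \<psi>\<close>
  leaves a derivative of the orbit of \<psi> plus a linear function times that orbit, the form
  covered by \<open>smooth_add_linear_mult\<close>.\<close>

lemma gen_smooth:
  assumes "\<psi> \<in> smooth_vectors W"
  shows "gen \<eta> \<psi> \<in> smooth_vectors W"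
proof -
  have lin: "linear (\<lambda>\<xi>. tau \<xi> \<eta>)" by (simp add: linear_iff tau_simps)
  have "smooth (\<lambda>\<xi>. iter_deriv [\<eta>] (\<lambda>\<xi>. W \<xi> \<psi>) \<xi> + tau \<xi> \<eta> *\<^sub>R (\<i> *\<^sub>C W \<xi> \<psi>))"
    by (rule smooth_add_linear_mult[OF smooth_iter_deriv[OF smooth_vectorsD[OF assms]]
          smooth_bounded_linear[OF smooth_vectorsD[OF assms] scaleC.bounded_linear_right] lin])
  moreover have "W \<xi> (gen \<eta> \<psi>) = iter_deriv [\<eta>] (\<lambda>\<xi>. W \<xi> \<psi>) \<xi> + tau \<xi> \<eta> *\<^sub>R (\<i> *\<^sub>C W \<xi> \<psi>)" for \<xi>
  proof -
    have "iter_deriv [\<eta>] (\<lambda>\<xi>. W \<xi> \<psi>) \<xi> = W \<xi> (gen \<eta> \<psi>) + (- \<i> * complex_of_real (tau \<xi> \<eta>)) *\<^sub>C W \<xi> \<psi>"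
      by (simp add: dir_deriv_eq[OF gen_derivative[OF assms]])
    moreover have "tau \<xi> \<eta> *\<^sub>R (\<i> *\<^sub>C W \<xi> \<psi>) = (\<i> * complex_of_real (tau \<xi> \<eta>)) *\<^sub>C W \<xi> \<psi>"
      by (simp add: scaleC_of_real[symmetric] scaleC_scaleC mult.commute)
    ultimately show ?thesis by (simp add: scaleC.minus_left)
  qed
  ultimately show ?thesis by (simp add: smooth_vectors_def smooth_def)
qed

text \<open>Moving W(t \<eta>) from \<psi> past W(\<xi>) to \<phi> costs a phase with first-order
  term t s(\<xi>, \<eta>); differentiate at t = 0. A linear factor in \<xi> is thereby traded for
  generators on the two vectors, with -\<eta> on the left because of the adjoint.\<close>

lemma gen_commutator:
  assumes "\<phi> \<in> smooth_vectors W" "\<psi> \<in> smooth_vectors W"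
  shows "\<i> * complex_of_real (s \<xi> \<eta>) * cinner \<phi> (W \<xi> \<psi>)
    = cinner \<phi> (W \<xi> (gen \<eta> \<psi>)) - cinner (gen (- \<eta>) \<phi>) (W \<xi> \<psi>)"
proof -
  have eq: "cinner \<phi> (W \<xi> (W (t *\<^sub>R \<eta>) \<psi>))
      = cis (t * s \<xi> \<eta> + t\<^sup>2 * (- tau \<eta> \<eta>)) * cinner (W (t *\<^sub>R (- \<eta>)) \<phi>) (W \<xi> \<psi>)" for t
  proof -
    have "cinner \<phi> (W (t *\<^sub>R \<eta>) \<theta>) = cis (- (t\<^sup>2 * tau \<eta> \<eta>)) * cinner (W (t *\<^sub>R (- \<eta>)) \<phi>) \<theta>" for \<theta>
    proof -
      have "cinner \<phi> (W (t *\<^sub>R \<eta>) \<theta>) = cinner (cis (tau (t *\<^sub>R \<eta>) (t *\<^sub>R \<eta>)) *\<^sub>C W (- (t *\<^sub>R \<eta>)) \<phi>) \<theta>"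
        using W_isometry[of "t *\<^sub>R \<eta>" "cis (tau (t *\<^sub>R \<eta>) (t *\<^sub>R \<eta>)) *\<^sub>C W (- (t *\<^sub>R \<eta>)) \<phi>" \<theta>]
        by (simp only: W_inverse)
      then show ?thesis by (simp add: cinner_scaleC_left cis_cnj tau_simps power2_eq_square mult.assoc)
    qed
    moreover have "W \<xi> (W (t *\<^sub>R \<eta>) \<psi>) = cis (t * s \<xi> \<eta>) *\<^sub>C W (t *\<^sub>R \<eta>) (W \<xi> \<psi>)"
      by (simp add: W_mult scaleC_scaleC cis_mult s_def tau_simps add.commute right_diff_distrib)
    ultimately show ?thesis by (simp add: cinner_scaleC_right cis_mult mult.assoc[symmetric])
  qed
  have d1: "((\<lambda>t. cinner \<phi> (W \<xi> (W (t *\<^sub>R \<eta>) \<psi>))) has_vector_derivative cinner \<phi> (W \<xi> (gen \<eta> \<psi>))) (at 0)"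
    by (intro bounded_linear.has_vector_derivative[OF cinner.bounded_linear_right]
        bounded_linear.has_vector_derivative[OF W_bounded_linear] gen_derivative0 assms)
  have d2: "((\<lambda>t. cis (t * s \<xi> \<eta> + t\<^sup>2 * (- tau \<eta> \<eta>)) * cinner (W (t *\<^sub>R (- \<eta>)) \<phi>) (W \<xi> \<psi>)) has_vector_derivative
      cis (0 * s \<xi> \<eta> + 0\<^sup>2 * (- tau \<eta> \<eta>)) * cinner (gen (- \<eta>) \<phi>) (W \<xi> \<psi>)
      + (\<i> * complex_of_real (s \<xi> \<eta>)) * cinner (W (0 *\<^sub>R (- \<eta>)) \<phi>) (W \<xi> \<psi>)) (at 0)"
    by (intro has_vector_derivative_mult cis_quadratic_derivative
        bounded_linear.has_vector_derivative[OF cinner.bounded_linear_left] gen_derivative0 assms)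
  from vector_derivative_unique_at[OF d1[unfolded eq] d2] show ?thesis
    by (simp add: W_0)
qed

inductive_set coeffs :: "('w \<Rightarrow> complex) set" where
  base: "\<phi> \<in> smooth_vectors W \<Longrightarrow> \<psi> \<in> smooth_vectors W \<Longrightarrow> (\<lambda>\<xi>. c * cnj (cinner \<phi> (W \<xi> \<psi>))) \<in> coeffs"
| add: "p \<in> coeffs \<Longrightarrow> q \<in> coeffs \<Longrightarrow> (\<lambda>\<xi>. p \<xi> + q \<xi>) \<in> coeffs"

lemma coeffs_mult_s: "p \<in> coeffs \<Longrightarrow> (\<lambda>\<xi>. complex_of_real (s \<xi> \<eta>) * p \<xi>) \<in> coeffs"
proof (induction rule: coeffs.induct)
  case (base \<phi> \<psi> c)
  have "complex_of_real (s \<xi> \<eta>) * (c * cnj (cinner \<phi> (W \<xi> \<psi>)))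
      = (\<i> * c) * cnj (cinner \<phi> (W \<xi> (gen \<eta> \<psi>))) + (- \<i> * c) * cnj (cinner (gen (- \<eta>) \<phi>) (W \<xi> \<psi>))" for \<xi>
  proof -
    have "cnj (\<i> * complex_of_real (s \<xi> \<eta>) * cinner \<phi> (W \<xi> \<psi>))
      = cnj (cinner \<phi> (W \<xi> (gen \<eta> \<psi>)) - cinner (gen (- \<eta>) \<phi>) (W \<xi> \<psi>))"
      by (simp only: gen_commutator[OF base])
    then have "(\<i> * c) * (- \<i> * complex_of_real (s \<xi> \<eta>) * cnj (cinner \<phi> (W \<xi> \<psi>)))
      = (\<i> * c) * (cnj (cinner \<phi> (W \<xi> (gen \<eta> \<psi>))) - cnj (cinner (gen (- \<eta>) \<phi>) (W \<xi> \<psi>)))"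
      by simp
    then show ?thesis by (simp add: algebra_simps)
  qed
  moreover have "(\<lambda>\<xi>. (\<i> * c) * cnj (cinner \<phi> (W \<xi> (gen \<eta> \<psi>))) + (- \<i> * c) * cnj (cinner (gen (- \<eta>) \<phi>) (W \<xi> \<psi>))) \<in> coeffs"
    by (intro coeffs.intros gen_smooth base)
  ultimately show ?case by (simp only:)
next
  case (add p q)
  from coeffs.add[OF add.IH] show ?case by (simp only: distrib_left)
qed

lemma coeffs_continuous: "p \<in> coeffs \<Longrightarrow> continuous_on UNIV p"
  by (induction rule: coeffs.induct) (auto intro!: continuous_intros W_coefficient_continuous)

lemma coeffs_bounded: "p \<in> coeffs \<Longrightarrow> \<exists>C. \<forall>\<xi>. cmod (p \<xi>) \<le> C"
proof (induction rule: coeffs.induct)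
  case (base \<phi> \<psi> c)
  show ?case
    by (rule exI[of _ "cmod c * (norm \<phi> * norm \<psi>)"]) (simp add: norm_mult mult_left_mono W_coefficient_le)
next
  case (add p q)
  then obtain C D where "\<And>\<xi>. cmod (p \<xi>) \<le> C" "\<And>\<xi>. cmod (q \<xi>) \<le> D" by blast
  then show ?case by (intro exI[of _ "C + D"]) (auto intro: order_trans[OF norm_triangle_ineq add_mono])
qed

end

section \<open>Representations with nondegenerate commutation form\<close>

locale nondegenerate_weyl_rep = weyl_rep tau W
  for tau :: "'w::euclidean_space \<Rightarrow> 'w \<Rightarrow> real" and W :: "'w \<Rightarrow> 'h::complex_hilbert_space \<Rightarrow> 'h" +
  assumes nondegenerate: "\<And>x. (\<And>y. s x y = 0) \<Longrightarrow> x = 0"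
begin

lemma s_bilinear: "bilinear s"
  by (simp add: bilinear_def linear_iff s_simps)

text \<open>This is how nondegeneracy enters the decay of coefficients: every coordinate function is
  of the form s(\<xi>, \<eta>), a factor that generators can absorb.\<close>

lemma linear_functional_s:
  assumes "linear l"
  obtains \<eta> where "\<And>\<xi>. l \<xi> = s \<xi> \<eta>"
proof -
  obtain u where u: "\<And>\<xi>. l \<xi> = \<xi> \<bullet> u" by (rule linear_functional_inner[OF assms]) blast
  obtain L where L: "linear L" "bij L" "\<And>x y. s x y = L x \<bullet> y"
    by (rule symplectic_form_representation[OF s_bilinear nondegenerate]; blast)
  obtain \<eta> where "L \<eta> = - u" using L(2) by (metis bij_pointE)
  then have "l \<xi> = s \<xi> \<eta>" for \<xi> using s_anti[of \<xi> \<eta>] by (simp add: L(3) u inner_commute)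
  then show ?thesis by (rule that)
qed

lemma coeffs_mult_linear:
  assumes "p \<in> coeffs" "linear l"
  shows "(\<lambda>\<xi>. complex_of_real (l \<xi>) * p \<xi>) \<in> coeffs"
proof -
  obtain \<eta> where "\<And>\<xi>. l \<xi> = s \<xi> \<eta>" by (rule linear_functional_s[OF assms(2)]) blast
  then show ?thesis using coeffs_mult_s[OF assms(1)] by simp
qed

lemma coeffs_derivative:
  "p \<in> coeffs \<Longrightarrow> \<exists>p'\<in>coeffs. \<forall>\<xi>. ((\<lambda>t. p (\<xi> + t *\<^sub>R \<eta>)) has_vector_derivative p' \<xi>) (at 0)"
proof (induction rule: coeffs.induct)
  case (base \<phi> \<psi> c)
  have lin: "linear (\<lambda>\<xi>. tau \<xi> \<eta>)" by (simp add: linear_iff tau_simps)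
  let ?p' = "\<lambda>\<xi>. c * cnj (cinner \<phi> (W \<xi> (gen \<eta> \<psi>))) + complex_of_real (tau \<xi> \<eta>) * ((\<i> * c) * cnj (cinner \<phi> (W \<xi> \<psi>)))"
  have "?p' \<in> coeffs"
    by (intro coeffs.add coeffs_mult_linear[OF _ lin] coeffs.base gen_smooth base)
  moreover have "((\<lambda>t. c * cnj (cinner \<phi> (W (\<xi> + t *\<^sub>R \<eta>) \<psi>))) has_vector_derivative ?p' \<xi>) (at 0)" for \<xi>
  proof -
    have "((\<lambda>t. c * cnj (cinner \<phi> (W (\<xi> + t *\<^sub>R \<eta>) \<psi>))) has_vector_derivative
        c * cnj (cinner \<phi> (W \<xi> (gen \<eta> \<psi>) + (- \<i> * complex_of_real (tau \<xi> \<eta>)) *\<^sub>C W \<xi> \<psi>))) (at 0)"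
      by (intro has_vector_derivative_mult_right bounded_linear.has_vector_derivative[OF bounded_linear_cnj]
          bounded_linear.has_vector_derivative[OF cinner.bounded_linear_right] gen_derivative base)
    then show ?thesis by (simp add: cinner_add_right cinner.minus_right cinner_scaleC_right algebra_simps)
  qed
  ultimately show ?case by (intro bexI[of _ ?p'] allI)
next
  case (add p q)
  then obtain p' q' where *: "p' \<in> coeffs" "q' \<in> coeffs"
    "\<And>\<xi>. ((\<lambda>t. p (\<xi> + t *\<^sub>R \<eta>)) has_vector_derivative p' \<xi>) (at 0)"
    "\<And>\<xi>. ((\<lambda>t. q (\<xi> + t *\<^sub>R \<eta>)) has_vector_derivative q' \<xi>) (at 0)" by blast
  then show ?case
    by (intro bexI[OF _ coeffs.add[OF *(1,2)]]) (auto intro!: has_vector_derivative_add)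
qed

text \<open>Gives meaning to the defining pairing of \<open>Op\<close>, whose argument is such a
  function. The class \<open>coeffs\<close> consists of bounded functions and is stable under
  derivatives and coordinate factors.\<close>

lemma coefficient_schwartz:
  assumes "\<phi> \<in> smooth_vectors W" "\<psi> \<in> smooth_vectors W"
  shows "(\<lambda>\<xi>. cnj (cinner \<phi> (W \<xi> \<psi>))) \<in> schwartz"
proof -
  have "coeffs \<subseteq> schwartz"
  proof (rule schwartz_closed_family)
    show "(\<lambda>x. complex_of_real (x \<bullet> b) * f x) \<in> coeffs" if "f \<in> coeffs" for f and b :: 'w
      by (rule coeffs_mult_linear[OF that]) (simp add: linear_iff inner_add_left)
  qed (auto intro: coeffs_continuous coeffs_bounded coeffs_derivative)
  moreover have "(\<lambda>\<xi>. cnj (cinner \<phi> (W \<xi> \<psi>))) \<in> coeffs"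
    using coeffs.base[OF assms, of 1] by simp
  ultimately show ?thesis by blast
qed

text \<open>Composition with the map M of \<open>symplectic_normal_form\<close> gives a
  representation in standard form. Since M is onto, both have the same invariant subspaces; the
  symbol stays weighted, and the factor 1/k undoes the Jacobian.\<close>

theorem integrated_trace_class:
  assumes irr: "irreducible_rep W"
    and b: "b \<in> weighted w" and b1: "b \<in> weighted (\<lambda>x. 1)" and w: "integrable lborel w"
  obtains A where "trace_class A" "\<And>\<phi> \<psi>. cinner \<phi> (A \<psi>) = (\<integral>x. b x * cinner \<phi> (W x \<psi>) \<partial>lborel)"
proof -
  obtain M j :: "'w \<Rightarrow> 'w" where M: "linear M" "bij M" and j: "linear j" "\<And>x. norm (j x) = norm x"
    and sM: "\<And>x y. s (M x) (M y) = x \<bullet> j y"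
  proof (rule symplectic_normal_form[OF s_bilinear s_anti])
    show "x = 0" if "\<And>y. s x y = 0" for x using that by (rule nondegenerate)
    fix M j :: "'w \<Rightarrow> 'w"
    assume *: "linear M" "bij M" "linear j" "\<And>x. norm (j x) = norm x" "\<And>x y. s (M x) (M y) = x \<bullet> j y"
    show thesis by (rule that[OF *])
  qed
  define tau' where "tau' x y = tau (M x) (M y)" for x y
  define W' where "W' x = W (M x)" for x
  have Mc: "continuous_on UNIV M" by (intro linear_continuous_on linear_conv_bounded_linear[THEN iffD1] M(1))
  interpret W': weyl_rep tau' W'
  proof
    show "bilinear tau'"
      by (simp add: bilinear_def linear_iff tau'_def linear_add[OF M(1)] linear_scale[OF M(1)] tau_simps)
    show "unitary_op (W' x)" for x unfolding W'_def by (rule W_unitary)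
    show "continuous_on UNIV (\<lambda>x. W' x \<phi>)" for \<phi>
      unfolding W'_def by (rule continuous_on_compose2[OF W_continuous Mc]) simp
    show "W' x (W' y \<phi>) = cis (tau' x y) *\<^sub>C W' (x + y) \<phi>" for x y \<phi>
      by (simp add: W'_def tau'_def W_mult linear_add[OF M(1)])
  qed
  interpret standard_weyl_rep tau' W' j
  proof (intro standard_weyl_rep.intro standard_weyl_rep_axioms.intro W'.weyl_rep_axioms)
    show "W'.s x y = x \<bullet> j y" for x y
      using sM[of x y] by (simp add: W'.s_def tau'_def s_def)
    show "irreducible_rep W'"
      unfolding irreducible_rep_def
    proof (intro conjI allI impI)
      show "(UNIV :: 'h set) \<noteq> {0}" using irr by (simp add: irreducible_rep_def)
      fix N assume N: "closed_csubspace N \<and> (\<forall>\<xi>. W' \<xi> ` N \<subseteq> N)"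
      have "W \<xi> ` N \<subseteq> N" for \<xi>
      proof -
        obtain x where "\<xi> = M x" using M(2) by (metis bij_pointE)
        then show ?thesis using N by (simp add: W'_def)
      qed
      with N irr show "N = {0} \<or> N = UNIV" by (simp add: irreducible_rep_def)
    qed
    show "linear j" by (rule j(1))
    show "norm (j x) = norm x" for x by (rule j(2))
  qed
  obtain k where k: "k > 0" "\<And>f::'w \<Rightarrow> complex. f \<in> borel_measurable borel \<Longrightarrow>
      (\<integral>x. f (M x) \<partial>lborel) = k *\<^sub>R (\<integral>x. f x \<partial>lborel)"
    by (rule lborel_linear_substitution[OF M, where ?'b=complex]) blast
  have bc: "continuous_on UNIV b" using smooth_continuous[of b "[]"] b by (simp add: weighted_def)
  obtain A where A: "trace_class A"
    "\<And>\<phi> \<psi>. cinner \<phi> (A \<psi>) = (\<integral>x. b (M x) * cinner \<phi> (W' x \<psi>) \<partial>lborel)"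
    by (rule integrated_trace_class[OF weighted_linear[OF M(1) b] weighted_linear[OF M(1) b1] integrable_linear_substitution[OF M w]]) blast
  show ?thesis
  proof (rule that)
    show "trace_class (\<lambda>x. complex_of_real (1 / k) *\<^sub>C A x)" by (rule trace_class_scale[OF A(1)])
    fix \<phi> \<psi>
    have [measurable]: "b \<in> borel_measurable borel" using bc by (rule borel_measurable_continuous_onI)
    have "(\<integral>x. b (M x) * cinner \<phi> (W (M x) \<psi>) \<partial>lborel) = k *\<^sub>R (\<integral>x. b x * cinner \<phi> (W x \<psi>) \<partial>lborel)"
      by (rule k(2)[of "\<lambda>x. b x * cinner \<phi> (W x \<psi>)"]) measurable
    then show "cinner \<phi> (complex_of_real (1 / k) *\<^sub>C A \<psi>) = (\<integral>x. b x * cinner \<phi> (W x \<psi>) \<partial>lborel)"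
      using k(1) by (simp add: cinner_scaleC_right A(2) W'_def scaleR_conv_of_real)
  qed
qed

end

section \<open>Products of integrals over orthogonal subspaces\<close>

text \<open>Both functions live on all coordinates but ignore one block, which \<open>fm\<close> and
  \<open>gm\<close> express through \<open>merge\<close>; splitting the product measure along
  \<open>merge\<close> then separates the integrals.\<close>

lemma product_two_blocks:
  fixes f g :: "('a \<Rightarrow> real) \<Rightarrow> complex"
  assumes J: "finite J" and K: "finite K" and JK: "J \<inter> K = {}"
    and f: "integrable (\<Pi>\<^sub>M b\<in>J. lborel) f" and g: "integrable (\<Pi>\<^sub>M b\<in>K. lborel) g"
    and f': "f \<in> borel_measurable (\<Pi>\<^sub>M b\<in>J \<union> K. lborel)" and g': "g \<in> borel_measurable (\<Pi>\<^sub>M b\<in>J \<union> K. lborel)"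
    and fm: "\<And>x y. f (merge J K (x, y)) = f x" and gm: "\<And>x y. g (merge J K (x, y)) = g y"
  shows "integrable (\<Pi>\<^sub>M b\<in>J \<union> K. lborel) (\<lambda>\<omega>. f \<omega> * g \<omega>)"
    and "(\<integral>\<omega>. f \<omega> * g \<omega> \<partial>(\<Pi>\<^sub>M b\<in>J \<union> K. lborel))
      = (\<integral>\<omega>. f \<omega> \<partial>(\<Pi>\<^sub>M b\<in>J. lborel)) * (\<integral>\<omega>. g \<omega> \<partial>(\<Pi>\<^sub>M b\<in>K. lborel))"
proof -
  interpret product_sigma_finite "\<lambda>_::'a. lborel :: real measure" ..
  interpret J: finite_product_sigma_finite "\<lambda>_::'a. lborel :: real measure" J by standard fact
  interpret K: finite_product_sigma_finite "\<lambda>_::'a. lborel :: real measure" K by standard fact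
  interpret P: pair_sigma_finite "\<Pi>\<^sub>M b\<in>J. lborel :: real measure" "\<Pi>\<^sub>M b\<in>K. lborel :: real measure" ..
  let ?P = "(\<Pi>\<^sub>M b\<in>J. lborel) \<Otimes>\<^sub>M (\<Pi>\<^sub>M b\<in>K. lborel) :: (('a \<Rightarrow> real) \<times> ('a \<Rightarrow> real)) measure"
  have [measurable]: "f \<in> borel_measurable (\<Pi>\<^sub>M b\<in>J. lborel)" "g \<in> borel_measurable (\<Pi>\<^sub>M b\<in>K. lborel)"
    using f g by auto
  have pi: "integrable ?P (\<lambda>(x, y). f x * g y)"
  proof (rule P.Fubini_integrable)
    show "(\<lambda>(x, y). f x * g y) \<in> borel_measurable ?P" by measurable
    show "integrable (\<Pi>\<^sub>M b\<in>J. lborel) (\<lambda>x. \<integral>y. norm (case (x, y) of (x, y) \<Rightarrow> f x * g y) \<partial>(\<Pi>\<^sub>M b\<in>K. lborel))"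
      using f by (simp add: norm_mult)
    show "AE x in (\<Pi>\<^sub>M b\<in>J. lborel). integrable (\<Pi>\<^sub>M b\<in>K. lborel) (\<lambda>y. case (x, y) of (x, y) \<Rightarrow> f x * g y)"
      using g by simp
  qed
  have meas: "(\<lambda>\<omega>. f \<omega> * g \<omega>) \<in> borel_measurable (\<Pi>\<^sub>M b\<in>J \<union> K. lborel)"
    using f' g' by (rule borel_measurable_times)
  have eq: "(\<lambda>q. f (merge J K q) * g (merge J K q)) = (\<lambda>(x, y). f x * g y)"
    by (auto simp: fun_eq_iff fm gm)
  show "integrable (\<Pi>\<^sub>M b\<in>J \<union> K. lborel) (\<lambda>\<omega>. f \<omega> * g \<omega>)"
    by (subst distr_merge[OF JK J K, symmetric], subst integrable_distr_eq[OF measurable_merge meas])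
      (simp only: eq pi)
  have "(\<integral>\<omega>. f \<omega> * g \<omega> \<partial>(\<Pi>\<^sub>M b\<in>J \<union> K. lborel)) = (\<integral>q. f (merge J K q) * g (merge J K q) \<partial>?P)"
    by (subst distr_merge[OF JK J K, symmetric], subst integral_distr[OF measurable_merge meas]) (rule refl)
  also have "\<dots> = (\<integral>x. (\<integral>y. f x * g y \<partial>(\<Pi>\<^sub>M b\<in>K. lborel)) \<partial>(\<Pi>\<^sub>M b\<in>J. lborel))"
    unfolding eq by (rule P.integral_fst[OF pi, symmetric])
  also have "\<dots> = (\<integral>\<omega>. f \<omega> \<partial>(\<Pi>\<^sub>M b\<in>J. lborel)) * (\<integral>\<omega>. g \<omega> \<partial>(\<Pi>\<^sub>M b\<in>K. lborel))"
    by simp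
  finally show "(\<integral>\<omega>. f \<omega> * g \<omega> \<partial>(\<Pi>\<^sub>M b\<in>J \<union> K. lborel))
      = (\<integral>\<omega>. f \<omega> \<partial>(\<Pi>\<^sub>M b\<in>J. lborel)) * (\<integral>\<omega>. g \<omega> \<partial>(\<Pi>\<^sub>M b\<in>K. lborel))" .
qed

lemma measurable_combination:
  fixes F :: "'a::euclidean_space \<Rightarrow> complex"
  assumes "finite K" "J \<subseteq> K" "F \<in> borel_measurable borel"
  shows "(\<lambda>\<omega>. F (\<Sum>e\<in>J. \<omega> e *\<^sub>R e)) \<in> borel_measurable (\<Pi>\<^sub>M b\<in>K. lborel)"
proof (rule measurable_compose[OF _ assms(3)])
  have "(\<lambda>\<omega>. \<omega> e) \<in> borel_measurable (\<Pi>\<^sub>M b\<in>K. lborel)" if "e \<in> J" for e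
    using measurable_component_singleton[of e K "\<lambda>_. lborel"] that assms(2) by auto
  then show "(\<lambda>\<omega>. \<Sum>e\<in>J. \<omega> e *\<^sub>R e) \<in> borel_measurable (\<Pi>\<^sub>M b\<in>K. lborel)"
    by (intro borel_measurable_sum borel_measurable_scaleR) auto
qed

lemma product_blocks:
  fixes F :: "'i \<Rightarrow> 'a::euclidean_space \<Rightarrow> complex"
  assumes "finite I" and "\<And>i. i \<in> I \<Longrightarrow> finite (B i)" and "disjoint_family_on B I"
    and "\<And>i. i \<in> I \<Longrightarrow> F i \<in> borel_measurable borel"
    and "\<And>i. i \<in> I \<Longrightarrow> integrable (\<Pi>\<^sub>M b\<in>B i. lborel) (\<lambda>\<omega>. F i (\<Sum>e\<in>B i. \<omega> e *\<^sub>R e))"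
  shows "integrable (\<Pi>\<^sub>M b\<in>(\<Union>i\<in>I. B i). lborel) (\<lambda>\<omega>. \<Prod>i\<in>I. F i (\<Sum>e\<in>B i. \<omega> e *\<^sub>R e)) \<and>
    (\<integral>\<omega>. (\<Prod>i\<in>I. F i (\<Sum>e\<in>B i. \<omega> e *\<^sub>R e)) \<partial>(\<Pi>\<^sub>M b\<in>(\<Union>i\<in>I. B i). lborel))
      = (\<Prod>i\<in>I. \<integral>\<omega>. F i (\<Sum>e\<in>B i. \<omega> e *\<^sub>R e) \<partial>(\<Pi>\<^sub>M b\<in>B i. lborel))"
  using assms
proof (induction I)
  case empty
  interpret product_sigma_finite "\<lambda>_::'a. lborel :: real measure" ..
  show ?case
    using product_integrable_prod[of "{}" "\<lambda>_ _. 1::complex"] product_integral_prod[of "{}" "\<lambda>_ _. 1::complex"] by simp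
next
  case (insert i I)
  let ?K = "\<Union>i\<in>I. B i"
  let ?f = "\<lambda>\<omega>. F i (\<Sum>e\<in>B i. \<omega> e *\<^sub>R e)" and ?g = "\<lambda>\<omega>. \<Prod>i\<in>I. F i (\<Sum>e\<in>B i. \<omega> e *\<^sub>R e)"
  have IH: "integrable (\<Pi>\<^sub>M b\<in>?K. lborel) ?g"
    "(\<integral>\<omega>. ?g \<omega> \<partial>(\<Pi>\<^sub>M b\<in>?K. lborel)) = (\<Prod>i\<in>I. \<integral>\<omega>. F i (\<Sum>e\<in>B i. \<omega> e *\<^sub>R e) \<partial>(\<Pi>\<^sub>M b\<in>B i. lborel))"
    using insert.IH insert.prems by (auto simp: disjoint_family_on_def)
  have disj: "B i \<inter> ?K = {}" using insert.prems(2) insert.hyps(2) by (auto simp: disjoint_family_on_def)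
  have fin: "finite (B i)" "finite ?K" using insert by auto
  have m1: "merge (B i) ?K (x, y) e = x e" if "e \<in> B i" for x y :: "'a \<Rightarrow> real" and e
    using that by (simp add: merge_def)
  have m2: "merge (B i) ?K (x, y) e = y e" if "k \<in> I" "e \<in> B k" for x y :: "'a \<Rightarrow> real" and e k
    using that disj by (auto simp: merge_def)
  have U: "B i \<union> ?K = (\<Union>i\<in>insert i I. B i)" by simp
  have gm: "?g \<in> borel_measurable (\<Pi>\<^sub>M b\<in>B i \<union> ?K. lborel)"
    by (intro borel_measurable_prod measurable_combination) (use fin insert.prems in auto)
  have fm: "?f \<in> borel_measurable (\<Pi>\<^sub>M b\<in>B i \<union> ?K. lborel)"
    by (intro measurable_combination) (use fin insert.prems in auto)
  note two = product_two_blocks[OF fin disj insert.prems(4)[OF insertI1] IH(1) fm gm]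
  have "integrable (\<Pi>\<^sub>M b\<in>B i \<union> ?K. lborel) (\<lambda>\<omega>. ?f \<omega> * ?g \<omega>)"
    by (rule two(1)) (simp_all add: m1 m2 cong: sum.cong prod.cong)
  moreover have "(\<integral>\<omega>. ?f \<omega> * ?g \<omega> \<partial>(\<Pi>\<^sub>M b\<in>B i \<union> ?K. lborel))
      = (\<integral>\<omega>. ?f \<omega> \<partial>(\<Pi>\<^sub>M b\<in>B i. lborel)) * (\<integral>\<omega>. ?g \<omega> \<partial>(\<Pi>\<^sub>M b\<in>?K. lborel))"
    by (rule two(2)) (simp_all add: m1 m2 cong: sum.cong prod.cong)
  ultimately show ?case
    unfolding U using insert.hyps IH(2) by (simp only: prod.insert) simp
qed

text \<open>In the application B is orthonormal for \<open>g0\<close> and not for the inner product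
  of the type, so the product measure in its coordinates has to be compared with
  \<open>lborel\<close> through the change of basis.\<close>

lemma lborel_basis:
  fixes B :: "'a::euclidean_space set"
  assumes \<beta>: "bij_betw \<beta> (Basis :: 'a set) B"
  shows "distr (\<Pi>\<^sub>M b\<in>B. lborel) borel (\<lambda>\<omega>. \<Sum>e\<in>B. \<omega> e *\<^sub>R e)
    = distr lborel borel (\<lambda>x. \<Sum>b\<in>Basis. (x \<bullet> b) *\<^sub>R \<beta> b)"
proof -
  interpret product_sigma_finite "\<lambda>_::'a. lborel :: real measure" ..
  have fin: "finite B" by (rule bij_betw_finite[OF \<beta>, THEN iffD1, OF finite_Basis])
  have \<beta>B: "\<beta> b \<in> B" if "b \<in> Basis" for b by (rule bij_betw_apply[OF \<beta> that])
  define \<gamma> where "\<gamma> = inv_into Basis \<beta>"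
  have \<gamma>: "\<gamma> e \<in> Basis" "\<beta> (\<gamma> e) = e" if "e \<in> B" for e
  proof -
    have "e \<in> \<beta> ` Basis" using that bij_betw_imp_surj_on[OF \<beta>] by simp
    then show "\<gamma> e \<in> Basis" unfolding \<gamma>_def by (rule inv_into_into)
    show "\<beta> (\<gamma> e) = e" unfolding \<gamma>_def by (rule bij_betw_inv_into_right[OF \<beta> that])
  qed
  have \<gamma>\<beta>: "\<gamma> (\<beta> b) = b" if "b \<in> Basis" for b
    unfolding \<gamma>_def using that by (rule bij_betw_inv_into_left[OF \<beta>])
  \<comment> \<open>Relabelling of coordinates along \<beta>, which carries the product measure
    indexed by \<open>Basis\<close> to the one indexed by B.\<close>
  define R where "R = (\<lambda>\<omega> :: 'a \<Rightarrow> real. \<lambda>e\<in>B. \<omega> (\<gamma> e))"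
  have R: "R \<in> measurable (\<Pi>\<^sub>M b\<in>Basis. lborel) (\<Pi>\<^sub>M b\<in>B. lborel)"
    unfolding R_def by (intro measurable_restrict measurable_component_singleton \<gamma>)
  have eq: "distr (\<Pi>\<^sub>M b\<in>Basis. lborel) (\<Pi>\<^sub>M b\<in>B. lborel) R = (\<Pi>\<^sub>M b\<in>B. lborel)"
  proof (rule PiM_eqI[OF fin])
    fix A :: "'a \<Rightarrow> real set" assume A: "\<And>i. i \<in> B \<Longrightarrow> A i \<in> sets lborel"
    have "emeasure (distr (\<Pi>\<^sub>M b\<in>Basis. lborel) (\<Pi>\<^sub>M b\<in>B. lborel) R) (Pi\<^sub>E B A)
        = emeasure (\<Pi>\<^sub>M b\<in>Basis. lborel) (R -` Pi\<^sub>E B A \<inter> space (\<Pi>\<^sub>M b\<in>Basis. lborel))"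
      using A by (intro emeasure_distr R sets_PiM_I_finite fin) auto
    also have "R -` Pi\<^sub>E B A \<inter> space (\<Pi>\<^sub>M b\<in>Basis. lborel) = Pi\<^sub>E Basis (\<lambda>b. A (\<beta> b))"
    proof (intro set_eqI iffI)
      fix \<omega> assume "\<omega> \<in> R -` Pi\<^sub>E B A \<inter> space (\<Pi>\<^sub>M b\<in>Basis. lborel)"
      then have *: "R \<omega> \<in> Pi\<^sub>E B A" "\<omega> \<in> extensional Basis" by (auto simp: space_PiM PiE_def)
      have "\<omega> b \<in> A (\<beta> b)" if "b \<in> Basis" for b
        using PiE_mem[OF *(1) \<beta>B[OF that]] \<beta>B[OF that] by (simp add: R_def \<gamma>\<beta>[OF that])
      with *(2) show "\<omega> \<in> Pi\<^sub>E Basis (\<lambda>b. A (\<beta> b))" by (auto simp: PiE_def)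
    next
      fix \<omega> assume w: "\<omega> \<in> Pi\<^sub>E Basis (\<lambda>b. A (\<beta> b))"
      have "\<omega> (\<gamma> e) \<in> A e" if "e \<in> B" for e
        using PiE_mem[OF w \<gamma>(1)[OF that]] \<gamma>(2)[OF that] by simp
      then show "\<omega> \<in> R -` Pi\<^sub>E B A \<inter> space (\<Pi>\<^sub>M b\<in>Basis. lborel)"
        using w by (auto simp: R_def space_PiM PiE_def)
    qed
    also have "emeasure (\<Pi>\<^sub>M b\<in>Basis. lborel) (Pi\<^sub>E Basis (\<lambda>b. A (\<beta> b))) = (\<Prod>b\<in>Basis. emeasure lborel (A (\<beta> b)))"
      using A \<beta>B by (intro emeasure_PiM) auto
    also have "\<dots> = (\<Prod>e\<in>B. emeasure lborel (A e))" by (rule prod.reindex_bij_betw[OF \<beta>])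
    finally show "emeasure (distr (\<Pi>\<^sub>M b\<in>Basis. lborel) (\<Pi>\<^sub>M b\<in>B. lborel) R) (Pi\<^sub>E B A) = (\<Prod>e\<in>B. emeasure lborel (A e))" .
  qed simp
  define M where "M x = (\<Sum>b\<in>Basis. (x \<bullet> b) *\<^sub>R \<beta> b)" for x :: 'a
  have Mm: "M \<in> borel_measurable borel"
    unfolding M_def by (intro borel_measurable_continuous_onI continuous_intros)
  have c1: "(\<lambda>\<omega>. \<Sum>e\<in>B. \<omega> e *\<^sub>R e) \<in> borel_measurable (\<Pi>\<^sub>M b\<in>B. (lborel :: real measure))"
    by (intro borel_measurable_sum borel_measurable_scaleR) (use measurable_component_singleton[of _ B "\<lambda>_. lborel"] in auto)
  have c2: "(\<lambda>\<omega>. \<Sum>b\<in>Basis. \<omega> b *\<^sub>R b) \<in> borel_measurable (\<Pi>\<^sub>M b\<in>(Basis :: 'a set). (lborel :: real measure))"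
    by measurable
  have "distr (\<Pi>\<^sub>M b\<in>B. lborel) borel (\<lambda>\<omega>. \<Sum>e\<in>B. \<omega> e *\<^sub>R e)
      = distr (\<Pi>\<^sub>M b\<in>Basis. lborel) borel ((\<lambda>\<omega>. \<Sum>e\<in>B. \<omega> e *\<^sub>R e) \<circ> R)"
    by (subst eq[symmetric], rule distr_distr[OF c1 R])
  also have "(\<lambda>\<omega>. \<Sum>e\<in>B. \<omega> e *\<^sub>R e) \<circ> R = M \<circ> (\<lambda>\<omega>. \<Sum>b\<in>Basis. \<omega> b *\<^sub>R b)"
  proof
    fix \<omega> :: "'a \<Rightarrow> real"
    have "(\<Sum>e\<in>B. R \<omega> e *\<^sub>R e) = (\<Sum>b\<in>Basis. R \<omega> (\<beta> b) *\<^sub>R \<beta> b)"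
      by (rule sum.reindex_bij_betw[OF \<beta>, symmetric])
    also have "\<dots> = (\<Sum>b\<in>Basis. \<omega> b *\<^sub>R \<beta> b)"
      by (intro sum.cong refl) (simp add: R_def \<beta>B \<gamma>\<beta>)
    finally show "((\<lambda>\<omega>. \<Sum>e\<in>B. \<omega> e *\<^sub>R e) \<circ> R) \<omega> = (M \<circ> (\<lambda>\<omega>. \<Sum>b\<in>Basis. \<omega> b *\<^sub>R b)) \<omega>"
      by (simp add: M_def)
  qed
  also have "distr (\<Pi>\<^sub>M b\<in>Basis. lborel) borel \<dots> = distr (distr (\<Pi>\<^sub>M b\<in>Basis. lborel) borel (\<lambda>\<omega>. \<Sum>b\<in>Basis. \<omega> b *\<^sub>R b)) borel M"
    by (rule distr_distr[OF Mm c2, symmetric])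
  finally show ?thesis unfolding M_def by (simp only: lborel_eq[symmetric])
qed

section \<open>Orthonormal bases for an inner product\<close>

context
  fixes g :: "'a::euclidean_space \<Rightarrow> 'a \<Rightarrow> real"
  assumes ip: "inner_product g"
begin

interpretation g: bounded_bilinear g
  using ip bilinear_conv_bounded_bilinear by (auto simp: inner_product_def)

lemma g_sym: "g x y = g y x" and g_pos: "x \<noteq> 0 \<Longrightarrow> g x x > 0"
  using ip by (auto simp: inner_product_def)

definition g_orthonormal :: "'a set \<Rightarrow> bool" where
  "g_orthonormal B \<longleftrightarrow> (\<forall>b\<in>B. \<forall>c\<in>B. g b c = (if b = c then 1 else 0))"

lemma g_orthonormal_sum:
  assumes "finite B" "g_orthonormal B" "b \<in> B"
  shows "g (\<Sum>e\<in>B. c e *\<^sub>R e) b = c b"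
proof -
  have "g (\<Sum>e\<in>B. c e *\<^sub>R e) b = (\<Sum>e\<in>B. if e = b then c e else 0)"
    unfolding g.sum_left g.scaleR_left using assms(2,3) by (intro sum.cong) (auto simp: g_orthonormal_def)
  then show ?thesis using assms by simp
qed

lemma g_orthonormal_independent:
  assumes B: "g_orthonormal B"
  shows "independent B"
  unfolding independent_explicit_finite_subsets
proof (intro allI impI ballI)
  fix S c e assume S: "S \<subseteq> B" "finite S" "(\<Sum>v\<in>S. c v *\<^sub>R v) = 0" and e: "e \<in> S"
  have "g_orthonormal S" using B S(1) unfolding g_orthonormal_def by blast
  from g_orthonormal_sum[OF S(2) this e, of c] show "c e = 0" by (simp add: S(3) g.zero_left)
qed

lemma g_orthonormal_expand:
  assumes B: "g_orthonormal B" and x: "x \<in> span B"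
  shows "x = (\<Sum>e\<in>B. g x e *\<^sub>R e)"
proof -
  have fin: "finite B" using independent_bound[OF g_orthonormal_independent[OF B]] by simp
  obtain c where c: "x = (\<Sum>e\<in>B. c e *\<^sub>R e)" using x span_finite[OF fin] by auto
  have "g x e = c e" if "e \<in> B" for e unfolding c by (rule g_orthonormal_sum[OF fin B that])
  then show ?thesis by (subst c) simp
qed

text \<open>Gram-Schmidt steps are repeated while the span is smaller than V; the induction runs on
  the number of missing vectors. The lemma validates the choice by \<open>SOME\<close> in
  \<open>euclid_integral\<close>.\<close>

lemma orthonormal_basis_exists:
  assumes V: "subspace V"
  shows "\<exists>B. orthonormal_basis g V B"
proof -
  have "\<exists>B'. B' \<subseteq> V \<and> g_orthonormal B' \<and> span B' = V" if "B \<subseteq> V" "g_orthonormal B" for B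
    using that
  proof (induction "DIM('a) - card B" arbitrary: B rule: less_induct)
    case less
    show ?case
    proof (cases "span B = V")
      case False
      have fin: "finite B" using independent_bound[OF g_orthonormal_independent[OF less.prems(2)]] by simp
      have "span B \<subseteq> V" using less.prems(1) V by (simp add: span_minimal)
      with False obtain x where x: "x \<in> V" "x \<notin> span B" by blast
      define y where "y = x - (\<Sum>e\<in>B. g x e *\<^sub>R e)"
      have yV: "y \<in> V" unfolding y_def
        using x(1) less.prems(1) V by (intro subspace_diff subspace_sum subspace_scale) auto
      have "(\<Sum>e\<in>B. g x e *\<^sub>R e) \<in> span B" by (intro span_sum span_scale span_base)
      then have "y \<noteq> 0" using x(2) by (auto simp: y_def)
      have yb: "g y b = 0" if "b \<in> B" for b
        using g_orthonormal_sum[OF fin less.prems(2) that, of "g x"] by (simp add: y_def g.diff_left)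
      define u where "u = (1 / sqrt (g y y)) *\<^sub>R y"
      have uu: "g u u = 1" using g_pos[OF \<open>y \<noteq> 0\<close>] by (simp add: u_def g.scaleR_left g.scaleR_right)
      have ub: "g u b = 0" "g b u = 0" if "b \<in> B" for b
        using yb[OF that] g_sym[of b u] by (simp_all add: u_def g.scaleR_left)
      have "u \<notin> B" using ub uu by force
      have o: "g_orthonormal (insert u B)"
        using less.prems(2) uu ub \<open>u \<notin> B\<close> unfolding g_orthonormal_def by auto
      have sub: "insert u B \<subseteq> V" using yV less.prems(1) V by (auto simp: u_def subspace_scale)
      have "card (insert u B) \<le> DIM('a)" using independent_bound[OF g_orthonormal_independent[OF o]] by simp
      then have "DIM('a) - card (insert u B) < DIM('a) - card B" using \<open>u \<notin> B\<close> fin by simp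
      from less.hyps[OF this sub o] show ?thesis .
    qed (use less.prems in blast)
  qed
  from this[of "{}"] show ?thesis
    unfolding orthonormal_basis_def g_orthonormal_def by auto
qed

lemma orthonormal_basis_properties:
  assumes "orthonormal_basis g V B"
  shows "g_orthonormal B" "finite B" "B \<subseteq> V" "span B = V" "card B = dim V"
proof -
  show o: "g_orthonormal B" "B \<subseteq> V" "span B = V" using assms by (auto simp: orthonormal_basis_def g_orthonormal_def)
  have i: "independent B" by (rule g_orthonormal_independent[OF o(1)])
  then show "finite B" using independent_bound by blast
  show "card B = dim V" using dim_span_eq_card_independent[OF i] o(3) by simp
qed

end

section \<open>The symbol as a symplectic Fourier transform\<close>

lemma cis_sum: "finite I \<Longrightarrow> cis (\<Sum>i\<in>I. f i) = (\<Prod>i\<in>I. cis (f i))"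
  by (induction rule: finite_induct) (simp_all flip: cis_mult)

lemma weighted_mono:
  assumes b: "b \<in> weighted w" and le: "\<And>x. 0 \<le> w x" "\<And>x. w x \<le> v x"
  shows "b \<in> weighted v"
proof -
  obtain C where C: "\<And>vs x. norm (iter_deriv vs b x) \<le> C vs * w x" by (rule weighted_bounds[OF b]) blast
  have "norm (iter_deriv vs b x) \<le> \<bar>C vs\<bar> * v x" for vs x
    using C[of vs x] mult_right_mono[OF abs_ge_self[of "C vs"] le(1)[of x]] mult_left_mono[OF le(2)[of x], of "\<bar>C vs\<bar>"]
    by linarith
  then show ?thesis using b unfolding weighted_def by blast
qed

lemma symbol_class_pullback:
  fixes L :: "'a::euclidean_space \<Rightarrow> 'a"
  assumes a: "a \<in> symbol_class g V (- t)" and L: "linear L" "\<And>x. L x \<in> V" and pos: "\<And>x. 0 \<le> g x x"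
  shows "(\<lambda>x. a (L x)) \<in> weighted (\<lambda>x. (1 + g (L x) (L x)) powr (- t / 2))"
proof -
  have "smooth (\<lambda>x. a (L x + 0))"
    using a L by (intro smooth_affine[OF L(1), of V]) (auto simp: symbol_class_def)
  moreover have "\<exists>C. \<forall>x. norm (iter_deriv vs (\<lambda>x. a (L x + 0)) x) \<le> C * (1 + g (L x) (L x)) powr (- t / 2)" for vs
  proof -
    have "set (map L vs) \<subseteq> V" using L(2) by auto
    then obtain C where C: "C > 0" "\<And>x. x \<in> V \<Longrightarrow>
        norm (iter_deriv (map L vs) a x) \<le> C * sqrt (1 + g x x) powr (- t - real (length (map L vs)))"
      using a unfolding symbol_class_def by blast
    have "norm (iter_deriv vs (\<lambda>x. a (L x + 0)) x) \<le> C * (1 + g (L x) (L x)) powr (- t / 2)" for x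
    proof -
      have q: "1 \<le> 1 + g (L x) (L x)" using pos[of "L x"] by simp
      have "norm (iter_deriv vs (\<lambda>x. a (L x + 0)) x) \<le> C * sqrt (1 + g (L x) (L x)) powr (- t - real (length (map L vs)))"
        unfolding iter_deriv_affine[OF L(1)] by (simp only: add_0_right) (rule C(2)[OF L(2)])
      \<comment> \<open>The extra decay gained by differentiation is discarded here, since one
        weight has to serve all derivatives.\<close>
      also have "\<dots> \<le> C * sqrt (1 + g (L x) (L x)) powr (- t)"
        using q C(1) by (intro mult_left_mono powr_mono) (auto simp: real_le_rsqrt)
      also have "sqrt (1 + g (L x) (L x)) powr (- t) = (1 + g (L x) (L x)) powr (- t / 2)"
        using q by (simp add: powr_half_sqrt[symmetric] powr_powr)
      finally show ?thesis .
    qed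
    then show ?thesis by blast
  qed
  ultimately show ?thesis by (simp add: weighted_def)
qed

text \<open>All block kernels are merged into the one kernel cis (-\<sigma> \<xi> \<eta>). A
  reflection E equalises the signs of the transforms, J turns \<open>g0\<close> into \<sigma>, and
  the substitution by E J preserves weighted bounds and integrability because it is a linear
  bijection.\<close>

lemma tensor_fourier_representation:
  fixes \<sigma> g0 :: "'w::euclidean_space \<Rightarrow> 'w \<Rightarrow> real"
    and V :: "nat \<Rightarrow> 'w set" and a :: "nat \<Rightarrow> 'w \<Rightarrow> complex"
  assumes \<sigma>: "symplectic_form \<sigma>"
    and comp: "compatible_inner_product \<sigma> g0"
    and dec: "orthogonal_decomposition g0 l V"
    and t: "\<And>i. i \<in> {1..l} \<Longrightarrow> t i > real (dim (V i))"
    and a: "\<And>i. i \<in> {1..l} \<Longrightarrow> a i \<in> symbol_class g0 (V i) (- t i)"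
    and Fdag: "\<And>i. i \<in> {1..l} \<Longrightarrow> Fdag i = fourier g0 (V i) \<or> Fdag i = inv_fourier g0 (V i)"
    and g: "\<And>x. (\<And>i. i \<in> {1..l} \<Longrightarrow> x i \<in> V i) \<Longrightarrow>
            g (\<Sum>i=1..l. x i) = (\<Prod>i=1..l. Fdag i (a i) (x i))"
  obtains b w K where "b \<in> weighted w" "b \<in> weighted (\<lambda>x. 1)" "integrable lborel w"
    "\<And>\<xi>. g \<xi> = K * (\<integral>\<eta>. cis (- \<sigma> \<xi> \<eta>) * b \<eta> \<partial>lborel)"
proof -
  let ?I = "{1..l}"
  have ip: "inner_product g0" using comp by (simp add: compatible_inner_product_def)
  interpret g: bounded_bilinear g0
    using ip bilinear_conv_bounded_bilinear by (auto simp: inner_product_def)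
  have gpos: "0 \<le> g0 x x" for x
    using g_pos[OF ip, of x] by (cases "x = 0") (auto simp: g.zero_left)
  obtain J where J: "linear J" "\<And>v. J (J v) = - v" "\<And>v w. g0 v w = \<sigma> v (J w)"
    using comp unfolding compatible_inner_product_def by blast
  have \<sigma>bil: "bilinear \<sigma>" using \<sigma> by (simp add: symplectic_form_def)
  interpret \<sigma>: bounded_bilinear \<sigma>
    using \<sigma>bil bilinear_conv_bounded_bilinear by blast
  have V: "subspace (V i)" if "i \<in> ?I" for i using dec that by (simp add: orthogonal_decomposition_def)
  have Vort: "g0 x y = 0" if "i \<in> ?I" "k \<in> ?I" "i \<noteq> k" "x \<in> V i" "y \<in> V k" for i k x y
    using dec that by (auto simp: orthogonal_decomposition_def)
  have Vsum: "\<exists>y. (\<forall>i\<in>?I. y i \<in> V i) \<and> x = (\<Sum>i=1..l. y i)" for x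
    using dec by (auto simp: orthogonal_decomposition_def)
  \<comment> \<open>The same choice as in \<open>euclid_integral\<close>, so that both Euclidean
    transforms unfold to integrals in these coordinates.\<close>
  define B where "B i = (SOME B. orthonormal_basis g0 (V i) B)" for i
  have Bo: "orthonormal_basis g0 (V i) (B i)" if "i \<in> ?I" for i
    unfolding B_def by (rule someI_ex[OF orthonormal_basis_exists[OF ip V[OF that]]])
  note Bp = orthonormal_basis_properties[OF ip Bo]
  define \<pi> where "\<pi> i y = (\<Sum>e\<in>B i. g0 y e *\<^sub>R e)" for i y
  have \<pi>lin: "linear (\<pi> i)" for i
    by (rule linearI) (simp_all add: \<pi>_def g.add_left g.scaleR_left scaleR_add_left sum.distrib scaleR_sum_right)
  have \<pi>V: "\<pi> i y \<in> V i" if "i \<in> ?I" for i y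
    unfolding \<pi>_def using Bp(3)[OF that] V[OF that] by (intro subspace_sum subspace_scale) auto
  have \<pi>id: "\<pi> i y = y" if "i \<in> ?I" "y \<in> V i" for i y
    unfolding \<pi>_def using g_orthonormal_expand[OF ip Bp(1)[OF that(1)], of y] Bp(4)[OF that(1)] that(2) by simp
  have \<pi>0: "\<pi> i y = 0" if "i \<in> ?I" "k \<in> ?I" "k \<noteq> i" "y \<in> V k" for i k y
    unfolding \<pi>_def using Vort[OF that(2,1,3,4)] Bp(3)[OF that(1)] by (intro sum.neutral) auto
  have \<pi>sum: "\<pi> i (\<Sum>k\<in>?I. x k) = x i" if "i \<in> ?I" "\<And>k. k \<in> ?I \<Longrightarrow> x k \<in> V k" for i x
  proof -
    have "\<pi> i (\<Sum>k\<in>?I. x k) = (\<Sum>k\<in>?I. if k = i then x i else 0)"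
      unfolding linear_sum[OF \<pi>lin] using that \<pi>id \<pi>0 by (intro sum.cong) auto
    then show ?thesis using that(1) by simp
  qed
  have sum\<pi>: "(\<Sum>i\<in>?I. \<pi> i y) = y" for y
  proof -
    obtain x where x: "\<forall>i\<in>?I. x i \<in> V i" "y = (\<Sum>i=1..l. x i)" using Vsum by blast
    show ?thesis unfolding x(2) by (intro sum.cong refl \<pi>sum) (use x(1) in auto)
  qed
  have g\<pi>: "g0 y (\<pi> i \<xi>) = g0 y \<xi>" if "i \<in> ?I" "y \<in> V i" for i y \<xi>
  proof -
    have "g0 y \<xi> = (\<Sum>k\<in>?I. g0 y (\<pi> k \<xi>))" by (subst sum\<pi>[symmetric]) (rule g.sum_right)
    also have "\<dots> = (\<Sum>k\<in>?I. if k = i then g0 y (\<pi> i \<xi>) else 0)"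
      using Vort[OF that(1) _ _ that(2) \<pi>V] by (intro sum.cong) auto
    finally show ?thesis using that(1) by simp
  qed
  \<comment> \<open>The sign in the kernel and, with \<open>c\<close>, the constant of the i-th
    transform; the two alternatives for \<open>Fdag\<close> then share the formula
    \<open>F_eq\<close>.\<close>
  define \<epsilon> where "\<epsilon> i = (if Fdag i = fourier g0 (V i) then - 1 else 1 :: real)" for i
  define c where "c i = (if Fdag i = fourier g0 (V i) then 1 else complex_of_real (1 / (2 * pi) ^ dim (V i)))" for i
  have \<epsilon>2: "\<epsilon> i * \<epsilon> i = 1" for i by (simp add: \<epsilon>_def)
  have F_eq: "Fdag i (a i) x = c i * (\<integral>\<omega>. cis (\<epsilon> i * g0 (\<Sum>e\<in>B i. \<omega> e *\<^sub>R e) x) * a i (\<Sum>e\<in>B i. \<omega> e *\<^sub>R e) \<partial>(\<Pi>\<^sub>M b\<in>B i. lborel))"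
    if "i \<in> ?I" for i x
    using Fdag[OF that] by (auto simp: \<epsilon>_def c_def fourier_def inv_fourier_def euclid_integral_def B_def[symmetric] Let_def)
  define BB where "BB = (\<Union>i\<in>?I. B i)"
  have disj: "disjoint_family_on B ?I"
    unfolding disjoint_family_on_def
  proof (intro ballI impI equals0I)
    fix i k e assume ik: "i \<in> ?I" "k \<in> ?I" "i \<noteq> k" and e: "e \<in> B i \<inter> B k"
    then have "g0 e e = 0" using Vort[OF ik] Bp(3)[OF ik(1)] Bp(3)[OF ik(2)] by blast
    moreover have "g0 e e = 1" using Bp(1)[OF ik(1)] e by (auto simp: g_orthonormal_def[OF ip])
    ultimately show False by simp
  qed
  have BBo: "g_orthonormal g0 BB"
    unfolding g_orthonormal_def[OF ip]
  proof (intro ballI)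
    fix d e assume "d \<in> BB" "e \<in> BB"
    then obtain i k where ik: "i \<in> ?I" "k \<in> ?I" "d \<in> B i" "e \<in> B k" by (auto simp: BB_def)
    show "g0 d e = (if d = e then 1 else 0)"
    proof (cases "i = k")
      case True
      then show ?thesis using Bp(1)[OF ik(1)] ik by (auto simp: g_orthonormal_def[OF ip])
    next
      case False
      then have "g0 d e = 0" using Vort[OF ik(1,2)] Bp(3)[OF ik(1)] Bp(3)[OF ik(2)] ik by blast
      moreover have "d \<noteq> e" using disjoint_family_onD[OF disj ik(1,2) False] ik(3,4) by auto
      ultimately show ?thesis by simp
    qed
  qed
  have BBfin: "finite BB" unfolding BB_def using Bp(2) by blast
  have "span BB = UNIV"
  proof -
    have "y \<in> span BB" for y
    proof -
      have "\<pi> i y \<in> span BB" if "i \<in> ?I" for i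
        unfolding \<pi>_def using that by (intro span_sum span_scale span_base) (auto simp: BB_def)
      then have "(\<Sum>i\<in>?I. \<pi> i y) \<in> span BB" by (rule span_sum)
      then show ?thesis by (simp only: sum\<pi>)
    qed
    then show ?thesis by blast
  qed
  then have "card BB = DIM('w)"
    using dim_span_eq_card_independent[OF g_orthonormal_independent[OF ip BBo]] by simp
  then obtain \<beta> where \<beta>: "bij_betw \<beta> (Basis :: 'w set) BB"
    using finite_same_card_bij[OF finite_Basis BBfin] by auto
  define M where "M x = (\<Sum>b\<in>Basis. (x \<bullet> b) *\<^sub>R \<beta> b)" for x
  have Mlin: "linear M"
    by (rule linearI) (simp_all add: M_def inner_add_left scaleR_add_left sum.distrib scaleR_sum_right)
  have "BB \<subseteq> range M"
  proof
    fix e assume "e \<in> BB"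
    then obtain b where b: "b \<in> Basis" "e = \<beta> b" using \<beta> by (auto simp: bij_betw_def)
    have "M b = (\<Sum>b'\<in>Basis. if b' = b then \<beta> b else 0)"
      unfolding M_def using b(1) by (intro sum.cong) (auto simp: inner_Basis)
    then have "M b = e" using b by simp
    then show "e \<in> range M" by blast
  qed
  then have "surj M"
    using \<open>span BB = UNIV\<close> span_minimal[of BB "range M"] linear_subspace_image[OF Mlin subspace_UNIV] by auto
  then have Mbij: "bij M" using linear_surjective_imp_injective[OF Mlin] by (simp add: bij_def)
  have Mmeas: "M \<in> borel_measurable borel"
    unfolding M_def by (intro borel_measurable_continuous_onI continuous_intros)
  \<comment> \<open>Fubini over the orthogonal blocks: each F i sees only the component in V i, and
    M transports the product measure along the joint orthonormal basis to
    \<open>lborel\<close>.\<close>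
  have blocks: "integrable lborel (\<lambda>x. \<Prod>i\<in>?I. F i (M x))"
    "(\<integral>x. (\<Prod>i\<in>?I. F i (M x)) \<partial>lborel) = (\<Prod>i\<in>?I. \<integral>\<omega>. F i (\<Sum>e\<in>B i. \<omega> e *\<^sub>R e) \<partial>(\<Pi>\<^sub>M b\<in>B i. lborel))"
    if Fm: "\<And>i. i \<in> ?I \<Longrightarrow> F i \<in> borel_measurable borel"
      and F\<pi>: "\<And>i y. i \<in> ?I \<Longrightarrow> F i (\<pi> i y) = F i y"
      and Fi: "\<And>i. i \<in> ?I \<Longrightarrow> integrable (\<Pi>\<^sub>M b\<in>B i. lborel) (\<lambda>\<omega>. F i (\<Sum>e\<in>B i. \<omega> e *\<^sub>R e))"
    for F :: "nat \<Rightarrow> 'w \<Rightarrow> complex"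
  proof -
    have \<pi>BB: "\<pi> i (\<Sum>e\<in>BB. \<omega> e *\<^sub>R e) = (\<Sum>e\<in>B i. \<omega> e *\<^sub>R e)" if i: "i \<in> ?I" for i and \<omega> :: "'w \<Rightarrow> real"
    proof -
      have "\<pi> i (\<Sum>e\<in>BB. \<omega> e *\<^sub>R e) = (\<Sum>e\<in>BB. \<omega> e *\<^sub>R \<pi> i e)"
        by (simp add: linear_sum[OF \<pi>lin] linear_scale[OF \<pi>lin])
      also have "\<dots> = (\<Sum>e\<in>B i. \<omega> e *\<^sub>R e)"
      proof (rule sum.mono_neutral_cong_right[OF BBfin])
        show "B i \<subseteq> BB" using i by (auto simp: BB_def)
        show "\<forall>e\<in>BB - B i. \<omega> e *\<^sub>R \<pi> i e = 0"
        proof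
          fix e assume "e \<in> BB - B i"
          then obtain k where k0: "k \<in> ?I" "e \<in> B k" "e \<notin> B i" unfolding BB_def by blast
          then have k: "k \<in> ?I" "e \<in> B k" "k \<noteq> i" by blast+
          then show "\<omega> e *\<^sub>R \<pi> i e = 0" using \<pi>0[OF i k(1,3) subsetD[OF Bp(3)[OF k(1)] k(2)]] by simp
        qed
        show "\<omega> e *\<^sub>R \<pi> i e = \<omega> e *\<^sub>R e" if "e \<in> B i" for e
          using \<pi>id[OF i subsetD[OF Bp(3)[OF i] that]] by simp
      qed
      finally show ?thesis .
    qed
    have eq: "(\<lambda>\<omega>. \<Prod>i\<in>?I. F i (\<Sum>e\<in>B i. \<omega> e *\<^sub>R e)) = (\<lambda>\<omega>. \<Prod>i\<in>?I. F i (\<Sum>e\<in>BB. \<omega> e *\<^sub>R e))"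
    proof (intro ext prod.cong refl)
      fix \<omega> i assume i: "i \<in> ?I"
      have "F i (\<Sum>e\<in>BB. \<omega> e *\<^sub>R e) = F i (\<pi> i (\<Sum>e\<in>BB. \<omega> e *\<^sub>R e))" by (rule F\<pi>[OF i, symmetric])
      then show "F i (\<Sum>e\<in>B i. \<omega> e *\<^sub>R e) = F i (\<Sum>e\<in>BB. \<omega> e *\<^sub>R e)" by (simp only: \<pi>BB[OF i])
    qed
    have pm: "(\<lambda>y. \<Prod>i\<in>?I. F i y) \<in> borel_measurable borel" using Fm by (rule borel_measurable_prod)
    have cm: "(\<lambda>\<omega>. \<Sum>e\<in>BB. \<omega> e *\<^sub>R e) \<in> borel_measurable (\<Pi>\<^sub>M b\<in>BB. (lborel :: real measure))"
      by (intro borel_measurable_sum borel_measurable_scaleR) (use measurable_component_singleton[of _ BB "\<lambda>_. lborel"] in auto)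
    have D: "distr (\<Pi>\<^sub>M b\<in>BB. lborel) borel (\<lambda>\<omega>. \<Sum>e\<in>BB. \<omega> e *\<^sub>R e) = distr lborel borel M"
      unfolding M_def by (rule lborel_basis[OF \<beta>])
    note pb = product_blocks[of ?I B F, OF _ Bp(2) disj Fm Fi, folded BB_def]
    have "integrable (distr (\<Pi>\<^sub>M b\<in>BB. lborel) borel (\<lambda>\<omega>. \<Sum>e\<in>BB. \<omega> e *\<^sub>R e)) (\<lambda>y. \<Prod>i\<in>?I. F i y)"
      using pb unfolding eq by (subst integrable_distr_eq[OF cm pm]) simp
    then show "integrable lborel (\<lambda>x. \<Prod>i\<in>?I. F i (M x))"
      unfolding D using Mmeas by (subst (asm) integrable_distr_eq[OF _ pm]) simp_all
    have "(\<integral>x. (\<Prod>i\<in>?I. F i (M x)) \<partial>lborel) = (\<integral>y. (\<Prod>i\<in>?I. F i y) \<partial>distr lborel borel M)"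
      using Mmeas by (subst integral_distr[OF _ pm]) simp_all
    also have "\<dots> = (\<integral>\<omega>. (\<Prod>i\<in>?I. F i (\<Sum>e\<in>BB. \<omega> e *\<^sub>R e)) \<partial>(\<Pi>\<^sub>M b\<in>BB. lborel))"
      unfolding D[symmetric] by (rule integral_distr[OF cm pm])
    also have "\<dots> = (\<Prod>i\<in>?I. \<integral>\<omega>. F i (\<Sum>e\<in>B i. \<omega> e *\<^sub>R e) \<partial>(\<Pi>\<^sub>M b\<in>B i. lborel))"
      using pb unfolding eq by simp
    finally show "(\<integral>x. (\<Prod>i\<in>?I. F i (M x)) \<partial>lborel) = (\<Prod>i\<in>?I. \<integral>\<omega>. F i (\<Sum>e\<in>B i. \<omega> e *\<^sub>R e) \<partial>(\<Pi>\<^sub>M b\<in>B i. lborel))" .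
  qed
  have gB: "g0 (\<Sum>e\<in>B i. \<omega> e *\<^sub>R e) (\<Sum>e\<in>B i. \<omega> e *\<^sub>R e) = (\<Sum>e\<in>B i. (\<omega> e)\<^sup>2)" if i: "i \<in> ?I" for i and \<omega> :: "'w \<Rightarrow> real"
  proof -
    have "g0 (\<Sum>e\<in>B i. \<omega> e *\<^sub>R e) (\<Sum>e\<in>B i. \<omega> e *\<^sub>R e) = (\<Sum>d\<in>B i. \<omega> d * g0 (\<Sum>e\<in>B i. \<omega> e *\<^sub>R e) d)"
      by (subst g.sum_right) (simp add: g.scaleR_right)
    also have "\<dots> = (\<Sum>d\<in>B i. (\<omega> d)\<^sup>2)"
      using g_orthonormal_sum[OF ip Bp(2)[OF i] Bp(1)[OF i]] by (intro sum.cong) (auto simp: power2_eq_square)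
    finally show ?thesis .
  qed
  have BV: "(\<Sum>e\<in>B i. \<omega> e *\<^sub>R e) \<in> V i" if "i \<in> ?I" for i and \<omega> :: "'w \<Rightarrow> real"
    using Bp(3)[OF that] V[OF that] by (intro subspace_sum subspace_scale) auto
  \<comment> \<open>In orthonormal coordinates of V i this is the radial weight of order -t i, so
    the assumption \<open>t i > dim (V i)\<close> makes it integrable over the block.\<close>
  define wt where "wt i y = (1 + g0 (\<pi> i y) (\<pi> i y)) powr (- t i / 2)" for i y
  have wt_int: "integrable (\<Pi>\<^sub>M b\<in>B i. lborel) (\<lambda>\<omega>. wt i (\<Sum>e\<in>B i. \<omega> e *\<^sub>R e))" if i: "i \<in> ?I" for i
    unfolding wt_def \<pi>id[OF i BV[OF i]] gB[OF i]
    using t[OF i] by (intro integrable_bracket_PiM Bp(2)[OF i]) (simp add: Bp(5)[OF i])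
  have \<pi>cont: "continuous_on UNIV (\<pi> i)" for i
    by (intro linear_continuous_on linear_conv_bounded_linear[THEN iffD1] \<pi>lin)
  have wt_cont: "continuous_on UNIV (wt i)" for i
  proof -
    have "1 + g0 (\<pi> i y) (\<pi> i y) \<noteq> 0" for y using gpos[of "\<pi> i y"] by linarith
    then show ?thesis unfolding wt_def by (intro continuous_intros g.continuous_on \<pi>cont) auto
  qed
  have wt_meas: "wt i \<in> borel_measurable borel" for i
    by (rule borel_measurable_continuous_onI[OF wt_cont])
  have wt01: "0 \<le> wt i y" "i \<in> ?I \<Longrightarrow> wt i y \<le> 1" for i y
  proof -
    show "0 \<le> wt i y" by (simp add: wt_def)
    assume "i \<in> ?I"
    then have "0 \<le> t i" using t[of i] by (meson less_imp_le of_nat_0_le_iff order_trans)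
    moreover have "1 \<le> 1 + g0 (\<pi> i y) (\<pi> i y)" using gpos by simp
    ultimately show "wt i y \<le> 1"
      unfolding wt_def using powr_mono[of "- t i / 2" 0 "1 + g0 (\<pi> i y) (\<pi> i y)"] by simp
  qed
  have apull: "(\<lambda>y. a i (\<pi> i y)) \<in> weighted (wt i)" if i: "i \<in> ?I" for i
    unfolding wt_def by (rule symbol_class_pullback[OF a[OF i] \<pi>lin \<pi>V[OF i] gpos])
  have a_meas: "(\<lambda>y. a i (\<pi> i y)) \<in> borel_measurable borel" if i: "i \<in> ?I" for i
    using apull[OF i] smooth_continuous[of "\<lambda>y. a i (\<pi> i y)" "[]"]
    by (intro borel_measurable_continuous_onI) (simp add: weighted_def)
  \<comment> \<open>The reflection acting on V i by the sign of its transform; it is an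
    involution.\<close>
  define E where "E y = (\<Sum>i\<in>?I. \<epsilon> i *\<^sub>R \<pi> i y)" for y
  have Elin: "linear E"
    by (rule linearI) (simp_all add: E_def linear_add[OF \<pi>lin] linear_scale[OF \<pi>lin] scaleR_add_right sum.distrib scaleR_sum_right mult.commute)
  have \<pi>E: "\<pi> i (E y) = \<epsilon> i *\<^sub>R \<pi> i y" if i: "i \<in> ?I" for i y
    unfolding E_def by (rule \<pi>sum[OF i]) (use \<pi>V V in \<open>auto simp: subspace_scale\<close>)
  have EE: "E (E y) = y" for y
  proof -
    have "E (E y) = (\<Sum>i\<in>?I. \<pi> i y)"
      unfolding E_def[of "E y"] by (intro sum.cong refl) (simp add: \<pi>E \<epsilon>2)
    then show ?thesis by (simp only: sum\<pi>)
  qed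
  define P where "P \<eta> = E (J \<eta>)" for \<eta>
  have Plin: "linear P" unfolding P_def using linear_compose[OF J(1) Elin] by (simp add: o_def)
  have Pbij: "bij P"
    by (rule o_bij[of "\<lambda>y. - J (E y)"]) (auto simp: fun_eq_iff P_def EE J(2) linear_neg[OF J(1)] linear_neg[OF Elin])
  \<comment> \<open>The substitution that replaces the orthonormal coordinates \<open>M x\<close> by
    \<open>P \<eta>\<close>.\<close>
  define N where "N = (\<lambda>\<eta>. inv M (P \<eta>))"
  have Nlin: "linear N"
  proof -
    have "linear (inv M)" using Mlin Mbij by (simp add: bij_is_inj inj_linear_imp_inv_linear)
    then show ?thesis unfolding N_def using linear_compose[OF Plin] by (simp add: o_def)
  qed
  have MN: "M (N \<eta>) = P \<eta>" for \<eta> unfolding N_def using Mbij by (simp add: bij_is_surj surj_f_inv_f)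
  have Nbij: "bij N"
    unfolding N_def using bij_comp[OF Pbij bij_imp_bij_inv[OF Mbij]] by (simp add: o_def)
  obtain k where k: "k > 0" "\<And>f::'w \<Rightarrow> complex. f \<in> borel_measurable borel \<Longrightarrow>
      (\<integral>x. f (N x) \<partial>lborel) = k *\<^sub>R (\<integral>x. f x \<partial>lborel)"
    by (rule lborel_linear_substitution[OF Nlin Nbij, where ?'b=complex]) blast
  define w where "w \<eta> = (\<Prod>i\<in>?I. wt i (P \<eta>))" for \<eta>
  define b where "b \<eta> = (\<Prod>i\<in>?I. a i (\<pi> i (P \<eta>)))" for \<eta>
  have bw: "b \<in> weighted w"
  proof -
    have "(\<lambda>\<eta>. a i (\<pi> i (P \<eta>))) \<in> weighted (\<lambda>\<eta>. wt i (P \<eta>))" if "i \<in> ?I" for i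
      by (rule weighted_linear[OF Plin apull[OF that]])
    then have "(\<lambda>\<eta>. \<Prod>i\<in>?I. a i (\<pi> i (P \<eta>))) \<in> weighted (\<lambda>\<eta>. \<Prod>i\<in>?I. wt i (P \<eta>))"
      by (intro weighted_prod) auto
    moreover have "b = (\<lambda>\<eta>. \<Prod>i\<in>?I. a i (\<pi> i (P \<eta>)))" "w = (\<lambda>\<eta>. \<Prod>i\<in>?I. wt i (P \<eta>))"
      by (simp_all add: fun_eq_iff b_def w_def)
    ultimately show ?thesis by simp
  qed
  have b1: "b \<in> weighted (\<lambda>x. 1)"
    by (rule weighted_mono[OF bw]) (auto simp: w_def wt01 intro!: prod_nonneg prod_le_1)
  have wi: "integrable lborel w"
  proof -
    have "integrable lborel (\<lambda>x. \<Prod>i\<in>?I. complex_of_real (wt i (M x)))"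
    proof (rule blocks(1)[of "\<lambda>i y. complex_of_real (wt i y)"])
      fix i assume i: "i \<in> ?I"
      show "(\<lambda>y. complex_of_real (wt i y)) \<in> borel_measurable borel" using wt_meas by measurable
      show "complex_of_real (wt i (\<pi> i y)) = complex_of_real (wt i y)" for y
        by (simp add: wt_def \<pi>id[OF i \<pi>V[OF i]])
      show "integrable (\<Pi>\<^sub>M b\<in>B i. lborel) (\<lambda>\<omega>. complex_of_real (wt i (\<Sum>e\<in>B i. \<omega> e *\<^sub>R e)))"
        using wt_int[OF i] by (rule integrable_of_real)
    qed
    from integrable_linear_substitution[OF Nlin Nbij this]
    have "integrable lborel (\<lambda>\<eta>. \<Prod>i\<in>?I. complex_of_real (wt i (P \<eta>)))" by (simp only: MN)
    then have "integrable lborel (\<lambda>\<eta>. Re (\<Prod>i\<in>?I. complex_of_real (wt i (P \<eta>))))" by (rule integrable_Re)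
    moreover have "Re (\<Prod>i\<in>?I. complex_of_real (wt i (P \<eta>))) = w \<eta>" for \<eta>
      unfolding w_def by (simp flip: of_real_prod)
    ultimately show ?thesis by simp
  qed
  have main: "g \<xi> = ((\<Prod>i\<in>?I. c i) * complex_of_real (1 / k)) * (\<integral>\<eta>. cis (- \<sigma> \<xi> \<eta>) * b \<eta> \<partial>lborel)" for \<xi>
  proof -
    define F where "F i y = cis (\<epsilon> i * g0 (\<pi> i y) \<xi>) * a i (\<pi> i y)" for i y
    have F\<pi>: "F i (\<pi> i y) = F i y" if "i \<in> ?I" for i y
      by (simp add: F_def \<pi>id[OF that \<pi>V[OF that]])
    have Fm: "F i \<in> borel_measurable borel" if "i \<in> ?I" for i
    proof -
      have "continuous_on UNIV (\<lambda>y. cis (\<epsilon> i * g0 (\<pi> i y) \<xi>))"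
        by (intro continuous_intros g.continuous_on \<pi>cont)
      then have "(\<lambda>y. cis (\<epsilon> i * g0 (\<pi> i y) \<xi>)) \<in> borel_measurable borel" by (rule borel_measurable_continuous_onI)
      from borel_measurable_times[OF this a_meas[OF that]] show ?thesis unfolding F_def[abs_def] .
    qed
    have Fi: "integrable (\<Pi>\<^sub>M b\<in>B i. lborel) (\<lambda>\<omega>. F i (\<Sum>e\<in>B i. \<omega> e *\<^sub>R e))" if i: "i \<in> ?I" for i
    proof -
      obtain C where C: "\<And>vs x. norm (iter_deriv vs (\<lambda>y. a i (\<pi> i y)) x) \<le> C vs * wt i x"
        by (rule weighted_bounds[OF apull[OF i]]) blast
      show ?thesis
      proof (rule Bochner_Integration.integrable_bound[OF integrable_mult_right[OF wt_int[OF i], of "C []"]])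
        show "(\<lambda>\<omega>. F i (\<Sum>e\<in>B i. \<omega> e *\<^sub>R e)) \<in> borel_measurable (\<Pi>\<^sub>M b\<in>B i. lborel)"
          by (rule measurable_combination[OF Bp(2)[OF i] subset_refl Fm[OF i]])
        show "AE \<omega> in (\<Pi>\<^sub>M b\<in>B i. lborel). norm (F i (\<Sum>e\<in>B i. \<omega> e *\<^sub>R e)) \<le> norm (C [] * wt i (\<Sum>e\<in>B i. \<omega> e *\<^sub>R e))"
        proof (intro AE_I2)
          fix \<omega> :: "'w \<Rightarrow> real"
          have "norm (F i (\<Sum>e\<in>B i. \<omega> e *\<^sub>R e)) \<le> C [] * wt i (\<Sum>e\<in>B i. \<omega> e *\<^sub>R e)"
            using C[of "[]"] by (simp add: F_def norm_mult)
          then show "norm (F i (\<Sum>e\<in>B i. \<omega> e *\<^sub>R e)) \<le> norm (C [] * wt i (\<Sum>e\<in>B i. \<omega> e *\<^sub>R e))" by simp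
        qed
      qed
    qed
    have "g \<xi> = g (\<Sum>i\<in>?I. \<pi> i \<xi>)" by (simp only: sum\<pi>)
    also have "\<dots> = (\<Prod>i\<in>?I. Fdag i (a i) (\<pi> i \<xi>))" by (rule g) (rule \<pi>V)
    also have "\<dots> = (\<Prod>i\<in>?I. c i * (\<integral>\<omega>. F i (\<Sum>e\<in>B i. \<omega> e *\<^sub>R e) \<partial>(\<Pi>\<^sub>M b\<in>B i. lborel)))"
    proof (rule prod.cong[OF refl])
      fix i assume i: "i \<in> ?I"
      show "Fdag i (a i) (\<pi> i \<xi>) = c i * (\<integral>\<omega>. F i (\<Sum>e\<in>B i. \<omega> e *\<^sub>R e) \<partial>(\<Pi>\<^sub>M b\<in>B i. lborel))"
        unfolding F_eq[OF i] F_def g\<pi>[OF i BV[OF i]] \<pi>id[OF i BV[OF i]] by (rule refl)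
    qed
    also have "\<dots> = (\<Prod>i\<in>?I. c i) * (\<integral>x. (\<Prod>i\<in>?I. F i (M x)) \<partial>lborel)"
      unfolding prod.distrib using blocks(2)[of F, OF Fm F\<pi> Fi] by simp
    also have "(\<integral>x. (\<Prod>i\<in>?I. F i (M x)) \<partial>lborel) = complex_of_real (1 / k) * (\<integral>\<eta>. (\<Prod>i\<in>?I. F i (M (N \<eta>))) \<partial>lborel)"
    proof -
      have "(\<lambda>x. \<Prod>i\<in>?I. F i (M x)) \<in> borel_measurable borel"
        by (intro borel_measurable_prod measurable_compose[OF Mmeas] Fm)
      from k(2)[OF this] show ?thesis using k(1) by (simp add: scaleR_conv_of_real)
    qed
    also have "(\<integral>\<eta>. (\<Prod>i\<in>?I. F i (M (N \<eta>))) \<partial>lborel) = (\<integral>\<eta>. cis (- \<sigma> \<xi> \<eta>) * b \<eta> \<partial>lborel)"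
    proof (rule Bochner_Integration.integral_cong[OF refl])
      fix \<eta>
      \<comment> \<open>The signs rebuild E, which cancels the E in P; what remains is g0(\<xi>, J
        \<eta>) = \<sigma>(\<xi>, J J \<eta>) = -\<sigma>(\<xi>, \<eta>).\<close>
      have "(\<Sum>i\<in>?I. \<epsilon> i * g0 (\<pi> i (P \<eta>)) \<xi>) = g0 (E (P \<eta>)) \<xi>"
        by (simp add: E_def g.sum_left g.scaleR_left)
      also have "\<dots> = g0 \<xi> (J \<eta>)" unfolding P_def EE by (rule g_sym[OF ip])
      also have "\<dots> = - \<sigma> \<xi> \<eta>" by (simp add: J(2,3) \<sigma>.minus_right)
      finally have ph: "(\<Sum>i\<in>?I. \<epsilon> i * g0 (\<pi> i (P \<eta>)) \<xi>) = - \<sigma> \<xi> \<eta>" .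
      show "(\<Prod>i\<in>?I. F i (M (N \<eta>))) = cis (- \<sigma> \<xi> \<eta>) * b \<eta>"
        unfolding MN F_def prod.distrib b_def ph[symmetric] by (simp add: cis_sum)
    qed
    finally show ?thesis by (simp only: mult.assoc)
  qed
  show ?thesis by (rule that[OF bw b1 wi main])
qed

section \<open>The trace-class theorem\<close>

theorem corollary7p3:
  fixes \<sigma> g0 :: "'w::euclidean_space \<Rightarrow> 'w \<Rightarrow> real"
    and l :: nat
    and V :: "nat \<Rightarrow> 'w set"
    and t :: "nat \<Rightarrow> real"
    and a :: "nat \<Rightarrow> 'w \<Rightarrow> complex"
    and Fdag :: "nat \<Rightarrow> ('w \<Rightarrow> complex) \<Rightarrow> 'w \<Rightarrow> complex"
    and g :: "'w \<Rightarrow> complex"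
    and T :: "'w \<Rightarrow> 'w"
    and W :: "'w \<Rightarrow> 'h::complex_hilbert_space \<Rightarrow> 'h"
  assumes "symplectic_form \<sigma>"
    and "compatible_inner_product \<sigma> g0"
    and "orthogonal_decomposition g0 l V"
    and "\<And>i. i \<in> {1..l} \<Longrightarrow> t i > real (dim (V i))"
    and "\<And>i. i \<in> {1..l} \<Longrightarrow> a i \<in> symbol_class g0 (V i) (- t i)"
    and "\<And>i. i \<in> {1..l} \<Longrightarrow> Fdag i = fourier g0 (V i) \<or> Fdag i = inv_fourier g0 (V i)"
    and "\<And>x. (\<And>i. i \<in> {1..l} \<Longrightarrow> x i \<in> V i) \<Longrightarrow>
            g (\<Sum>i=1..l. x i) = (\<Prod>i=1..l. Fdag i (a i) (x i))"
    and "linear T"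
    and "bij (\<lambda>\<xi>. T \<xi> + symplectic_adjoint \<sigma> T \<xi>)"
    and "omega_representation \<sigma> T W"
    and "irreducible_rep W"
  shows "extends_to_trace_class W (Op \<sigma> W (functional_of \<sigma> g))"
proof -
  have \<sigma>bil: "bilinear \<sigma>" and anti: "\<And>x y. \<sigma> x y = - \<sigma> y x" and nd: "\<And>x. (\<And>y. \<sigma> x y = 0) \<Longrightarrow> x = 0"
    using assms(1) unfolding symplectic_form_def by blast+
  interpret \<sigma>: bounded_bilinear \<sigma>
    using \<sigma>bil bilinear_conv_bounded_bilinear by blast
  obtain L :: "'w \<Rightarrow> 'w" where L: "linear L" "bij L" "\<And>x y. \<sigma> x y = L x \<bullet> y"
    by (rule symplectic_form_representation[OF \<sigma>bil nd]; blast)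
  define S where "S = symplectic_adjoint \<sigma> T"
  \<comment> \<open>Nondegeneracy gives existence of the adjoint through L and its uniqueness, and
    with them access to the \<open>THE\<close> in \<open>symplectic_adjoint\<close>.\<close>
  have S: "\<sigma> (S x) y = \<sigma> x (T y)" for x y
  proof -
    define S' where "S' x = inv L (adjoint T (L x))" for x
    have S': "\<sigma> (S' x) y = \<sigma> x (T y)" for x y
      using adjoint_works[OF assms(8), of y "L x"] L(2)
      by (simp add: L(3) S'_def bij_is_surj surj_f_inv_f inner_commute)
    have "R = S'" if "\<forall>x y. \<sigma> (R x) y = \<sigma> x (T y)" for R
    proof
      fix x
      have "\<sigma> (R x - S' x) y = 0" for y using that S'[of x y] by (simp add: \<sigma>.diff_left)
      then have "R x - S' x = 0" by (rule nd)
      then show "R x = S' x" by simp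
    qed
    then have "S = S'"
      unfolding S_def symplectic_adjoint_def using S' by (intro the_equality) auto
    then show ?thesis using S' by simp
  qed
  interpret weyl_rep "\<lambda>x y. \<sigma> x (T y)" W
  proof (intro weyl_rep.intro)
    show "bilinear (\<lambda>x y. \<sigma> x (T y))"
      by (simp add: bilinear_def linear_iff \<sigma>.add_left \<sigma>.add_right \<sigma>.scaleR_left \<sigma>.scaleR_right
          linear_add[OF assms(8)] linear_scale[OF assms(8)])
  qed (use assms(10) in \<open>auto simp: omega_representation_def omega_def\<close>)
  interpret nondegenerate_weyl_rep "\<lambda>x y. \<sigma> x (T y)" W
  proof (intro nondegenerate_weyl_rep.intro weyl_rep_axioms nondegenerate_weyl_rep_axioms.intro)
    \<comment> \<open>Here s x y = \<sigma>((T + S) x, y), so a vector in the radical of the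
      commutation form lies in the kernel of T + S.\<close>
    fix x assume x: "\<And>y. s x y = 0"
    have "\<sigma> (T x + S x) y = 0" for y
      using x[of y] anti[of y "T x"] by (simp add: s_def S \<sigma>.add_left)
    then have "T x + S x = 0" by (rule nd)
    \<comment> \<open>The injective map T + S is compared at x and at 0, so its value at 0 is
      computed; S is known only through its defining identity.\<close>
    moreover have "\<sigma> (S 0) y = 0" for y by (simp add: S \<sigma>.zero_left)
    then have "S 0 = 0" by (rule nd)
    then have "T 0 + S 0 = 0" by (simp add: linear_0[OF assms(8)])
    ultimately show "x = 0"
      using injD[OF bij_is_inj[OF assms(9)[folded S_def]], of x 0] by simp
  qed
  obtain b w K where b: "b \<in> weighted w" "b \<in> weighted (\<lambda>x. 1)" "integrable lborel w"
    and gb: "\<And>\<xi>. g \<xi> = K * (\<integral>\<eta>. cis (- \<sigma> \<xi> \<eta>) * b \<eta> \<partial>lborel)"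
    by (rule tensor_fourier_representation[OF assms(1-7)]) blast+
  obtain A where A: "trace_class A" "\<And>\<phi> \<psi>. cinner \<phi> (A \<psi>) = (\<integral>x. b x * cinner \<phi> (W x \<psi>) \<partial>lborel)"
    by (rule integrated_trace_class[OF assms(11) b]) blast
  obtain c where c: "c > 0" "symplectic_measure \<sigma> = density lborel (\<lambda>_. ennreal c)"
    "\<And>a. a \<in> schwartz \<Longrightarrow> symplectic_fourier \<sigma> (symplectic_fourier \<sigma> a) = a"
    by (rule symplectic_measure_properties[OF assms(1)]) blast
  have bi: "integrable lborel b" by (rule weighted_integrable[OF b(1,3)])
  have bm: "b \<in> borel_measurable borel" using bi by auto
  have Lm: "(\<lambda>\<eta>. cis (- \<sigma> \<xi> \<eta>)) \<in> borel_measurable borel" for \<xi>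
    unfolding L(3) by measurable
  have intM: "(\<integral>x. f x \<partial>symplectic_measure \<sigma>) = complex_of_real c * (\<integral>x. f x \<partial>lborel)"
    if "f \<in> borel_measurable borel" for f
    unfolding c(2) using that c(1) by (subst integral_density) (auto simp: scaleR_conv_of_real)
  have "Op \<sigma> W (functional_of \<sigma> g) \<psi> \<phi> = cinner \<phi> (K *\<^sub>C A \<psi>)"
    if "\<psi> \<in> smooth_vectors W" "\<phi> \<in> smooth_vectors W" for \<psi> \<phi>
  proof -
    define v where "v = (\<lambda>\<xi>. cnj (cinner \<phi> (W \<xi> \<psi>)))"
    have v: "v \<in> schwartz" unfolding v_def by (rule coefficient_schwartz[OF that(2,1)])
    have FF: "fourier_wrt (symplectic_measure \<sigma>) \<sigma> (fourier_wrt (symplectic_measure \<sigma>) \<sigma> v) = v"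
      using c(3)[OF v] by (simp add: symplectic_fourier_def)
    \<comment> \<open>Chosen so that c d = K, which converts between Lebesgue and symplectic
      measure.\<close>
    define d where "d = K * complex_of_real (1 / c)"
    have gM: "g \<xi> = (\<integral>\<eta>. cis (- \<sigma> \<xi> \<eta>) * (d * b \<eta>) \<partial>symplectic_measure \<sigma>)" for \<xi>
    proof -
      have "(\<integral>\<eta>. cis (- \<sigma> \<xi> \<eta>) * (d * b \<eta>) \<partial>symplectic_measure \<sigma>)
          = complex_of_real c * (\<integral>\<eta>. d * (cis (- \<sigma> \<xi> \<eta>) * b \<eta>) \<partial>lborel)"
        using Lm bm by (subst intM) (auto simp: mult.left_commute)
      also have "\<dots> = (complex_of_real c * d) * (\<integral>\<eta>. cis (- \<sigma> \<xi> \<eta>) * b \<eta> \<partial>lborel)"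
        by (simp only: integral_mult_right_zero mult.assoc)
      also have "complex_of_real c * d = K" using c(1) by (simp add: d_def)
      finally show ?thesis by (simp only: gb)
    qed
    have "Op \<sigma> W (functional_of \<sigma> g) \<psi> \<phi>
        = (\<integral>\<xi>. cnj (fourier_wrt (symplectic_measure \<sigma>) \<sigma> v \<xi>) * g \<xi> \<partial>symplectic_measure \<sigma>)"
      by (simp add: Op_def symplectic_fourier_dist_def functional_of_def symplectic_fourier_def v_def)
    \<comment> \<open>Op pairs the transform of v with g, and \<open>gM\<close> exhibits g as the
      transform of d b; Parseval's formula removes both transforms.\<close>
    also have "\<dots> = (\<integral>\<eta>. cnj (v \<eta>) * (d * b \<eta>) \<partial>symplectic_measure \<sigma>)"
      unfolding gM by (rule fourier_wrt_pairing[OF assms(1) L c(1,2) v FF]) (use bi in simp)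
    also have "\<dots> = complex_of_real c * (\<integral>\<eta>. d * (b \<eta> * cinner \<phi> (W \<eta> \<psi>)) \<partial>lborel)"
      using bm by (subst intM) (auto simp: v_def mult_ac)
    also have "\<dots> = (complex_of_real c * d) * (\<integral>\<eta>. b \<eta> * cinner \<phi> (W \<eta> \<psi>) \<partial>lborel)"
      by (simp only: integral_mult_right_zero mult.assoc)
    also have "complex_of_real c * d = K" using c(1) by (simp add: d_def)
    finally show ?thesis by (simp only: cinner_scaleC_right A(2))
  qed
  moreover have "trace_class (\<lambda>x. K *\<^sub>C A x)" by (rule trace_class_scale[OF A(1)])
  ultimately show ?thesis unfolding extends_to_trace_class_def by blast
qed

end
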